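(* Let $(M,\widetilde B)$ be a root of unity quantum seed satisfying condition (Coprime). Then there is a unique isomorphism of labelled graphs from the exchange graph $E_\varepsilon(M,\widetilde B)$ to the exchange graph $E(\widetilde B)$ which sends the vertex corresponding to the seed $(M,\widetilde B)$ to the vertex corresponding to the classical seed $(\widetilde{\mathbf x},\widetilde B)$, where $\widetilde{\mathbf x}=(M(e_1)^\ell,\dots,M(e_N)^\ell)$.
   Context: Let $\ell$ be a positive integer, $\mathbb Z_\ell=\mathbb Z/\ell\mathbb Z$, $\varepsilon^{1/2}\in\mathbb C$ a primitive $\ell$-th root of unity, $\mathcal A^{1/2}_\varepsilon=\mathbb Z[\varepsilon^{1/2}]$, and $\varepsilon^{a/2}=(\varepsilon^{1/2})^a$ for $a\in\mathbb Z_\ell$. $\overline C$ is the reduction mod $\ell$ of an integer matrix $C$; $e_1,\dots,e_N$ is the standard basis of $\mathbb Z^N$. For a skew-symmetric bilinear form $\Lambda:\mathbb Z^N\times\mathbb Z^N\to\mathbb Z_\ell$ with matrix $(\lambda_{ij})$, $\mathcal T_\varepsilon(\Lambda)$ is the $\mathcal A^{1/2}_\varepsilon$-algebra with basis $\{X^f\}_{f\in\mathbb Z^N}$ and $X^fX^g=\varepsilon^{\Lambda(f,g)/2}X^{f+g}$. A root of unity toric frame of a division algebra $\mathcal F$ over $\mathbb Q(\varepsilon^{1/2})$ is a map $M:\mathbb Z^N\to\mathcal F$ such that for some (unique) skew-symmetric $\Lambda=:\Lambda_M$ there is an injective $\mathcal A^{1/2}_\varepsilon$-algebra map $\phi:\mathcal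 T_\varepsilon(\Lambda)\to\mathcal F$, $\phi(X^f)=M(f)$, with $\mathcal F$ the skew field of fractions of its image. Fix $\mathrm{ex}\subseteq[1,N]$. An exchange matrix $\widetilde B=(b_{ij})$ is an integer matrix with rows indexed by $[1,N]$, columns by $\mathrm{ex}$, principal part $B$, $k$-th column $b^k$. $(\Lambda,\widetilde B)$ is $\ell$-compatible if there is $D=\mathrm{diag}(d_j)_{j\in\mathrm{ex}}$, $d_j\in\mathbb Z_{>0}$, with $DB$ skew-symmetric and $\sum_k\overline b_{kj}\lambda_{ki}=\delta_{ij}\overline d_j$ in $\mathbb Z_\ell$ for all $i\in[1,N]$, $j\in\mathrm{ex}$. A root of unity quantum seed is $(M,\widetilde B)$ with $(\Lambda_M,\widetilde B)$ $\ell$-compatible. Condition (Coprime): $\ell$ is odd and coprime to all $d_k$, $k\in\mathrm{ex}$. For $b\in\mathbb Z^N$, $[b]_\pm$ keeps the entries $b_i$ with $\pm b_i\ge0$ and sets the others to $0$. Mutation in direction $k\in\mathrm{ex}$: $\mu_k(\widetilde B)=(b'_{ij})$, $b'_{ij}=-b_{ij}$ if $i=k$ or $j=k$, otherwise $b'_{ij}=b_{ij}+(|b_{ik}|b_{kj}+b_{ik}|b_{kj}|)/2$; $\mu_k(M)$ is the root of unity toric frame with matrix $\overline E^\top\Lambda_M\overline E$ ($E$: $e_{ij}=\delta_{ij}$ for $j\neq k$, $e_{kk}=-1$, $e_{ik}=\max(0,-b_{ik})$ for $i\ne k$) and $\mu_k(M)(e_j)=M(e_j)$ ($j\ne k$),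 $\mu_k(M)(e_k)=M(-e_k+[b^k]_+)+M(-e_k-[b^k]_-)$. The exchange graph $E_\varepsilon(M,\widetilde B)$ is the labelled graph whose vertices correspond to the root of unity quantum seeds mutation-equivalent to $(M,\widetilde B)$ and whose edges are seed mutations $\mu_k$, labelled by $k$. Classically, for a seed $(\widetilde{\mathbf x},\widetilde B)$ ($\widetilde{\mathbf x}=(x_1,\dots,x_N)$ a transcendence basis generating a field over $\mathbb Q$), mutation $\mu_k$ replaces $x_k$ by $x_k'$ with $x_kx_k'=\prod_{b_{ik}>0}x_i^{b_{ik}}+\prod_{b_{ik}<0}x_i^{-b_{ik}}$ and $\widetilde B$ by $\mu_k(\widetilde B)$; the exchange graph $E(\widetilde B)$ is the labelled graph with vertices corresponding to seeds mutation-equivalent to $(\widetilde{\mathbf x},\widetilde B)$ and edges given by mutations labelled by their directions. A map of labelled graphs is a graph map preserving edge labels. (Here $M(e_1)^\ell,\dots,M(e_N)^\ell$ are algebraically independent commuting elements, so $(\widetilde{\mathbf x},\widetilde B)$ is a classical seed in the field they generate.) *)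

theory Defs
  imports Complex_Main "HOL-Library.Function_Algebras"
begin

text \<open>zeta plays the role of eps^(1/2), a primitive l-th root of unity; eps^(a/2) = zeta^(a mod l).\<close>

definition primitive_root :: "nat \<Rightarrow> complex \<Rightarrow> bool" where
  "primitive_root l z \<longleftrightarrow> 0 < l \<and> z ^ l = 1 \<and> (\<forall>m. 0 < m \<and> m < l \<longrightarrow> z ^ m \<noteq> 1)"

definition rpow :: "nat \<Rightarrow> complex \<Rightarrow> int \<Rightarrow> complex" where
  "rpow l z a = z ^ nat (a mod int l)"

definition Zring :: "nat \<Rightarrow> complex \<Rightarrow> complex set" where
  "Zring l z = {w. \<exists>c::nat \<Rightarrow> int. w = (\<Sum>a<l. of_int (c a) * z ^ a)}"

definition Qfield :: "nat \<Rightarrow> complex \<Rightarrow> complex set" where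
  "Qfield l z = {w. \<exists>c::nat \<Rightarrow> rat. w = (\<Sum>a<l. of_rat (c a) * z ^ a)}"

definition cyclo_algebra :: "nat \<Rightarrow> complex \<Rightarrow> (complex \<Rightarrow> 'a::division_ring) \<Rightarrow> bool" where
  "cyclo_algebra l z sc \<longleftrightarrow> primitive_root l z \<and> sc 1 = 1 \<and>
     (\<forall>x\<in>Qfield l z. \<forall>y\<in>Qfield l z. sc (x + y) = sc x + sc y \<and> sc (x * y) = sc x * sc y) \<and>
     (\<forall>x\<in>Qfield l z. \<forall>y. sc x * y = y * sc x)"

definition unitv :: "'n \<Rightarrow> 'n \<Rightarrow> int" where
  "unitv j = (\<lambda>i. if i = j then 1 else 0)"

definition posp :: "('n \<Rightarrow> int) \<Rightarrow> 'n \<Rightarrow> int" where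
  "posp b = (\<lambda>i. if b i \<ge> 0 then b i else 0)"

definition negp :: "('n \<Rightarrow> int) \<Rightarrow> 'n \<Rightarrow> int" where
  "negp b = (\<lambda>i. if b i \<le> 0 then b i else 0)"

definition bilin :: "('n::finite \<Rightarrow> 'n \<Rightarrow> int) \<Rightarrow> ('n \<Rightarrow> int) \<Rightarrow> ('n \<Rightarrow> int) \<Rightarrow> int" where
  "bilin L f g = (\<Sum>i\<in>UNIV. \<Sum>j\<in>UNIV. f i * L i j * g j)"

definition skew_mod :: "nat \<Rightarrow> ('n \<Rightarrow> 'n \<Rightarrow> int) \<Rightarrow> bool" where
  "skew_mod l L \<longleftrightarrow> (\<forall>i j. L i j mod int l = (- L j i) mod int l)"

text \<open>Image of the quantum torus: the A-span of the M(f).\<close>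
definition tspan :: "nat \<Rightarrow> complex \<Rightarrow> (complex \<Rightarrow> 'a::division_ring) \<Rightarrow> (('n \<Rightarrow> int) \<Rightarrow> 'a) \<Rightarrow> 'a set" where
  "tspan l z sc M = {y. \<exists>S c. finite S \<and> (\<forall>f\<in>S. c f \<in> Zring l z) \<and> y = (\<Sum>f\<in>S. sc (c f) * M f)}"

text \<open>M is a root of unity toric frame with (matrix of) form L: the A-linear map
  phi(X^f) = M(f) is a unital algebra map from T_eps(L) (multiplicativity + M 0 = 1),
  injective (the M(f) are A-linearly independent), and the division ring is the
  (Ore) skew field of fractions of its image.\<close>
definition toric_frame :: "nat \<Rightarrow> complex \<Rightarrow> (complex \<Rightarrow> 'a::division_ring) \<Rightarrow>
    (('n::finite \<Rightarrow> int) \<Rightarrow> 'a) \<Rightarrow> ('n \<Rightarrow> 'n \<Rightarrow> int) \<Rightarrow> bool" where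
  "toric_frame l z sc M L \<longleftrightarrow>
     skew_mod l L \<and>
     M 0 = 1 \<and>
     (\<forall>f g. M f * M g = sc (rpow l z (bilin L f g)) * M (f + g)) \<and>
     (\<forall>S c. finite S \<longrightarrow> (\<forall>f\<in>S. c f \<in> Zring l z) \<longrightarrow>
        (\<Sum>f\<in>S. sc (c f) * M f) = 0 \<longrightarrow> (\<forall>f\<in>S. c f = 0)) \<and>
     (\<forall>y. \<exists>a\<in>tspan l z sc M. \<exists>b\<in>tspan l z sc M. b \<noteq> 0 \<and> y = a * inverse b)"

text \<open>An exchange matrix with columns indexed by ex is represented as a function
  'n => 'n => int whose columns outside ex are zero.\<close>
definition exmat :: "'n set \<Rightarrow> ('n \<Rightarrow> 'n \<Rightarrow> int) \<Rightarrow> bool" where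
  "exmat ex B \<longleftrightarrow> (\<forall>i j. j \<notin> ex \<longrightarrow> B i j = 0)"

definition bmut :: "'n set \<Rightarrow> 'n \<Rightarrow> ('n \<Rightarrow> 'n \<Rightarrow> int) \<Rightarrow> ('n \<Rightarrow> 'n \<Rightarrow> int)" where
  "bmut ex k B = (\<lambda>i j. if j \<notin> ex then 0
      else if i = k \<or> j = k then - B i j
      else B i j + (\<bar>B i k\<bar> * B k j + B i k * \<bar>B k j\<bar>) div 2)"

definition compat_with :: "nat \<Rightarrow> 'n::finite set \<Rightarrow> ('n \<Rightarrow> 'n \<Rightarrow> int) \<Rightarrow> ('n \<Rightarrow> 'n \<Rightarrow> int) \<Rightarrow> ('n \<Rightarrow> int) \<Rightarrow> bool" where
  "compat_with l ex L B D \<longleftrightarrow>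
     (\<forall>j\<in>ex. D j > 0) \<and>
     (\<forall>i\<in>ex. \<forall>j\<in>ex. D i * B i j = - (D j * B j i)) \<and>
     (\<forall>i. \<forall>j\<in>ex. (\<Sum>k\<in>UNIV. B k j * L k i) mod int l = (if i = j then D j else 0) mod int l)"

definition compatible :: "nat \<Rightarrow> 'n::finite set \<Rightarrow> ('n \<Rightarrow> 'n \<Rightarrow> int) \<Rightarrow> ('n \<Rightarrow> 'n \<Rightarrow> int) \<Rightarrow> bool" where
  "compatible l ex L B \<longleftrightarrow> (\<exists>D. compat_with l ex L B D)"

type_synonym ('a, 'n) qseed = "(('n \<Rightarrow> int) \<Rightarrow> 'a) \<times> ('n \<Rightarrow> 'n \<Rightarrow> int)"

definition is_qseed :: "nat \<Rightarrow> complex \<Rightarrow> (complex \<Rightarrow> 'a::division_ring) \<Rightarrow> 'n::finite set \<Rightarrow> ('a, 'n) qseed \<Rightarrow> bool" where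
  "is_qseed l z sc ex s \<longleftrightarrow> exmat ex (snd s) \<and>
     (\<exists>L. toric_frame l z sc (fst s) L \<and> compatible l ex L (snd s))"

definition Emat :: "'n \<Rightarrow> ('n \<Rightarrow> 'n \<Rightarrow> int) \<Rightarrow> 'n \<Rightarrow> 'n \<Rightarrow> int" where
  "Emat k B i j = (if j \<noteq> k then (if i = j then 1 else 0)
                   else if i = k then -1 else max 0 (- B i k))"

definition mut_form :: "'n::finite \<Rightarrow> ('n \<Rightarrow> 'n \<Rightarrow> int) \<Rightarrow> ('n \<Rightarrow> 'n \<Rightarrow> int) \<Rightarrow> ('n \<Rightarrow> 'n \<Rightarrow> int)" where
  "mut_form k B L = (\<lambda>a b. \<Sum>i\<in>UNIV. \<Sum>j\<in>UNIV. Emat k B i a * L i j * Emat k B j b)"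

definition qmut :: "nat \<Rightarrow> complex \<Rightarrow> (complex \<Rightarrow> 'a::division_ring) \<Rightarrow> 'n::finite set \<Rightarrow> 'n \<Rightarrow>
    ('a, 'n) qseed \<Rightarrow> ('a, 'n) qseed \<Rightarrow> bool" where
  "qmut l z sc ex k s t \<longleftrightarrow> k \<in> ex \<and>
     (let M = fst s; B = snd s; M' = fst t; bk = (\<lambda>i. B i k) in
       snd t = bmut ex k B \<and>
       (\<exists>L. toric_frame l z sc M L \<and> toric_frame l z sc M' (mut_form k B L)) \<and>
       (\<forall>j. j \<noteq> k \<longrightarrow> M' (unitv j) = M (unitv j)) \<and>
       M' (unitv k) = M (- unitv k + posp bk) + M (- unitv k - negp bk))"

definition qstep :: "nat \<Rightarrow> complex \<Rightarrow> (complex \<Rightarrow> 'a::division_ring) \<Rightarrow> 'n::finite set \<Rightarrow> 'n \<Rightarrow>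
    ('a, 'n) qseed \<Rightarrow> ('a, 'n) qseed \<Rightarrow> bool" where
  "qstep l z sc ex k s t \<longleftrightarrow> is_qseed l z sc ex s \<and> is_qseed l z sc ex t \<and> qmut l z sc ex k s t"

text \<open>Cluster variables live in the (commutative) subfield of 'a they generate; products
  are taken along a fixed ordering of the index type, which is irrelevant since the
  factors commute.\<close>
type_synonym ('a, 'n) cseed = "('n \<Rightarrow> 'a) \<times> ('n \<Rightarrow> 'n \<Rightarrow> int)"

definition cmut :: "'n::{finite,linorder} set \<Rightarrow> 'n \<Rightarrow> ('a::division_ring, 'n) cseed \<Rightarrow> ('a, 'n) cseed \<Rightarrow> bool" where
  "cmut ex k s t \<longleftrightarrow> k \<in> ex \<and>
     (let x = fst s; B = snd s;
          P = prod_list (map (\<lambda>i. if B i k > 0 then x i ^ nat (B i k) else 1) (sorted_list_of_set UNIV));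
          Q = prod_list (map (\<lambda>i. if B i k < 0 then x i ^ nat (- B i k) else 1) (sorted_list_of_set UNIV))
      in t = (x(k := (P + Q) * inverse (x k)), bmut ex k B))"

definition reach :: "('n \<Rightarrow> 's \<Rightarrow> 's \<Rightarrow> bool) \<Rightarrow> 'n set \<Rightarrow> 's \<Rightarrow> 's set" where
  "reach step ex s0 = {s. (\<lambda>u v. \<exists>k\<in>ex. step k u v)\<^sup>*\<^sup>* s0 s}"

definition labelled_iso :: "('n \<Rightarrow> 's \<Rightarrow> 's \<Rightarrow> bool) \<Rightarrow> ('n \<Rightarrow> 't \<Rightarrow> 't \<Rightarrow> bool) \<Rightarrow> 'n set \<Rightarrow>
    's \<Rightarrow> 't \<Rightarrow> ('s \<Rightarrow> 't) \<Rightarrow> bool" where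
  "labelled_iso step1 step2 ex s1 s2 phi \<longleftrightarrow>
     bij_betw phi (reach step1 ex s1) (reach step2 ex s2) \<and>
     phi s1 = s2 \<and>
     (\<forall>u\<in>reach step1 ex s1. \<forall>v\<in>reach step1 ex s1. \<forall>k\<in>ex.
        step1 k u v \<longleftrightarrow> step2 k (phi u) (phi v))"

end

theory Submission
  imports Defs
begin

text \<open>The map sends a seed (M, B) to the classical seed with variables M(e_i)^l.

  It commutes with mutation: x' = M'(e_k) satisfies x'^l = M(l g) + M(l h), where M(g) + M(h) is the exchange
  relation for x', because x'^l is central while the mixed terms of its expansion do not commute with M(e_k).
  As every seed can be mutated, the map is onto; what remains is injectivity.

  Injectivity rests on the Laurent phenomenon: if M and N are reachable frames, y = N(e_i) is a Laurent
  polynomial in M. If also y^l = M(e_i)^l, then comparing leading terms for every grading shows that y is a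
  monomial, y = a M(e_i) with a^l = 1. The anti-automorphism that fixes all M(f) and conjugates the scalars
  fixes the variables of every reachable seed, so a is real, and a = 1 as l is odd.

  The Laurent phenomenon follows the caterpillar argument of Fomin and Zelevinsky: for mutations
  i, j, i from s0 through s1, s2 to s3, a common element of the quantum tori of s1 and s3 lies in that of s0.
  Coprimality becomes: l-th powers are central, the l-th power of the variable x_i of s1 is homogeneous for a
  grading that annihilates the i-th column of B, and the variables x_i, x_j of s3 have a single monomial
  as leading term for this grading, hence are regular modulo that power.\<close>

section \<open>Quantum tori\<close>

text \<open>Passing to \<open>l\<close>-th powers forgets roots of unity, so recovering a variable
  from its \<open>l\<close>-th power is the real obstacle. In a noncommutative division ring no
  unique factorization is at hand to say that exchange polynomials are coprime. Monomials with
  exponents divisible by \<open>l\<close> take over: they are central, and suitable ones clear the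
  denominators of any Laurent polynomial. Coprimality of \<open>l\<close> and \<open>d_k\<close>
  enters twice: the mixed terms of an \<open>l\<close>-th power fail to commute with
  \<open>M(e_k)\<close>, and two columns of \<open>B\<close> are linearly independent, which
  supplies the grading when \<open>b_ji = 0\<close>. The second use needs \<open>l > 1\<close>; for
  \<open>l = 1\<close> the variables are their own powers. The anti-automorphism fixes every
  variable because an exchange relation is a sum of two normalized monomials with coefficient 1, and
  such a monomial is invariant under reversing products and inverting \<open>q\<close>. Commutators
  contain only \<open>2 L(f, g)\<close>; oddness of \<open>l\<close> therefore also recovers the
  form from them, so that a frame is determined by its values on unit vectors.\<close>

definition smul :: "int \<Rightarrow> ('n \<Rightarrow> int) \<Rightarrow> 'n \<Rightarrow> int" where
  "smul k f = (\<lambda>i. k * f i)"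

lemma smul_apply: "smul k f i = k * f i"
  by (simp add: smul_def)

lemma bilin_add_left: "bilin L (f + g) h = bilin L f h + bilin L g h"
  by (simp add: bilin_def algebra_simps sum.distrib)

lemma bilin_add_right: "bilin L h (f + g) = bilin L h f + bilin L h g"
  by (simp add: bilin_def algebra_simps sum.distrib)

lemma bilin_diff_left: "bilin L (f - g) h = bilin L f h - bilin L g h"
  by (simp add: bilin_def algebra_simps sum_subtractf)

lemma bilin_diff_right: "bilin L h (f - g) = bilin L h f - bilin L h g"
  by (simp add: bilin_def algebra_simps sum_subtractf)

lemma bilin_uminus_left: "bilin L (- f) h = - bilin L f h"
  by (simp add: bilin_def sum_negf)

lemma bilin_uminus_right: "bilin L h (- f) = - bilin L h f"
  by (simp add: bilin_def sum_negf)

lemma bilin_smul_left: "bilin L (smul k f) h = k * bilin L f h"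
  by (simp add: bilin_def sum_distrib_left mult_ac smul_apply)

lemma bilin_smul_right: "bilin L h (smul k f) = k * bilin L h f"
  by (simp add: bilin_def sum_distrib_left mult_ac smul_apply)

lemma bilin_zero_right [simp]: "bilin L h 0 = 0"
  by (simp add: bilin_def)

lemma bilin_unitv_right: "bilin L f (unitv j) = (\<Sum>i\<in>UNIV. f i * L i j)"
  unfolding bilin_def unitv_def by (simp add: if_distrib cong: if_cong)

lemmas bilin_linear = bilin_add_left bilin_add_right bilin_diff_left bilin_diff_right
  bilin_uminus_left bilin_uminus_right bilin_smul_left bilin_smul_right

text \<open>Induction on the l1-norm. The signs of \<open>f j\<close> in the two steps mean that the
  walk from 0 to \<open>f\<close> never turns back, so sign conditions on \<open>f\<close> are
  inherited by all earlier exponents.\<close>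

lemma exponent_induct [consumes 1, case_names zero plus minus]:
  fixes f :: "'n::finite \<Rightarrow> int"
  assumes "\<forall>i. i \<notin> J \<longrightarrow> f i = 0" and "P 0"
    and "\<And>f j. j \<in> J \<Longrightarrow> \<forall>i. i \<notin> J \<longrightarrow> f i = 0 \<Longrightarrow> f j \<ge> 0 \<Longrightarrow> P f \<Longrightarrow> P (f + unitv j)"
    and "\<And>f j. j \<in> J \<Longrightarrow> \<forall>i. i \<notin> J \<longrightarrow> f i = 0 \<Longrightarrow> f j \<le> 0 \<Longrightarrow> P f \<Longrightarrow> P (f - unitv j)"
  shows "P f"
  using assms(1)
proof (induction "\<Sum>i\<in>UNIV. nat \<bar>f i\<bar>" arbitrary: f rule: less_induct)
  case less
  show ?case
  proof (cases "f = 0")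
    case True then show ?thesis using assms(2) by simp
  next
    case False
    then obtain j where j: "f j \<noteq> 0" by (auto simp: fun_eq_iff)
    then have jJ: "j \<in> J" using less(2) by blast
    define g where "g = (if f j > 0 then f - unitv j else f + unitv j)"
    have smaller: "(\<Sum>i\<in>UNIV. nat \<bar>g i\<bar>) < (\<Sum>i\<in>UNIV. nat \<bar>f i\<bar>)"
      by (rule sum_strict_mono_ex1) (use j in \<open>auto simp: g_def unitv_def intro!: bexI[of _ j]\<close>)
    have supp: "g i = 0" if "i \<notin> J" for i
      using less(2) that jJ by (auto simp: g_def unitv_def)
    have Pg: "P g" using less(1)[OF smaller] supp by blast
    show ?thesis
    proof (cases "f j > 0")
      case True
      then have "f = g + unitv j" "g j \<ge> 0" by (simp_all add: g_def unitv_def)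
      then show ?thesis using assms(3)[OF jJ _ _ Pg] supp by simp
    next
      case False
      then have "f = g - unitv j" "g j \<le> 0" using j by (simp_all add: g_def unitv_def)
      then show ?thesis using assms(4)[OF jJ _ _ Pg] supp by simp
    qed
  qed
qed

text \<open>A stands for the image of Z[zeta] in the division ring, q n for the image of zeta^n, and bar for complex
  conjugation on A.\<close>

locale torus_scalars =
  fixes l :: nat and A :: "'a::division_ring set" and q :: "int \<Rightarrow> 'a" and bar :: "'a \<Rightarrow> 'a"
  assumes l_odd: "odd l"
    and one_A: "1 \<in> A"
    and add_A: "\<And>a b. a \<in> A \<Longrightarrow> b \<in> A \<Longrightarrow> a + b \<in> A"
    and mult_A: "\<And>a b. a \<in> A \<Longrightarrow> b \<in> A \<Longrightarrow> a * b \<in> A"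
    and uminus_A: "\<And>a. a \<in> A \<Longrightarrow> - a \<in> A"
    and central_A: "\<And>a y. a \<in> A \<Longrightarrow> a * y = y * a"
    and two_nz: "(2::'a) \<noteq> 0"
    and q_A: "\<And>n. q n \<in> A"
    and q_add: "\<And>m n. q (m + n) = q m * q n"
    and q_one_iff: "\<And>n. q n = 1 \<longleftrightarrow> int l dvd n"
    and bar_A: "\<And>a. a \<in> A \<Longrightarrow> bar a \<in> A"
    and bar_add: "\<And>a b. a \<in> A \<Longrightarrow> b \<in> A \<Longrightarrow> bar (a + b) = bar a + bar b"
    and bar_mult: "\<And>a b. a \<in> A \<Longrightarrow> b \<in> A \<Longrightarrow> bar (a * b) = bar a * bar b"
    and bar_q: "\<And>n. bar (q n) = q (- n)"
    and bar_nz: "\<And>a. a \<in> A \<Longrightarrow> bar a = 0 \<Longrightarrow> a = 0"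
    and real_root: "\<And>a. a \<in> A \<Longrightarrow> bar a = a \<Longrightarrow> a ^ l = 1 \<Longrightarrow> a = 1"
begin

lemma l_pos: "l > 0"
  using l_odd odd_pos by blast

lemma zero_A: "0 \<in> A"
  using add_A[OF one_A uminus_A[OF one_A]] by simp

lemma power_A: "a \<in> A \<Longrightarrow> a ^ n \<in> A"
  by (induction n) (auto intro: one_A mult_A)

lemma q_0 [simp]: "q 0 = 1"
  by (simp add: q_one_iff)

lemma q_minus_mult [simp]: "q (- n) * q n = 1" "q n * q (- n) = 1"
  by (simp_all flip: q_add)

lemma q_nz [simp]: "q n \<noteq> 0"
  using q_minus_mult(1)[of n] by force

lemma q_eq_iff: "q m = q n \<longleftrightarrow> int l dvd m - n"
proof -
  have "q m = q (m - n) * q n" by (simp flip: q_add)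
  then show ?thesis by (metis q_one_iff mult_1 mult_right_cancel q_nz)
qed

lemma q_cong: "int l dvd m - n \<Longrightarrow> q m = q n"
  by (simp add: q_eq_iff)

lemma q_mult_left: "q m * (q n * y) = q (m + n) * y"
  by (simp add: q_add mult.assoc)

lemma q_comm: "y * q n = q n * y"
  by (simp add: central_A q_A)

lemma q_move: "y * (q n * x) = q n * (y * x)"
  by (metis mult.assoc q_comm)

lemma A_move: "a \<in> A \<Longrightarrow> y * (a * x) = a * (y * x)"
  by (metis mult.assoc central_A)

text \<open>Commuting two monomials produces \<open>q\<close> of twice the form; for odd
  \<open>l\<close> this still determines the form modulo \<open>l\<close>.\<close>

lemma l_dvd_double: "int l dvd 2 * n \<longleftrightarrow> int l dvd n"
proof -
  have "coprime (int l) 2" using l_odd by simp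
  then show ?thesis by (simp add: coprime_dvd_mult_right_iff)
qed

text \<open>Exponents may repeat, so closure under sums needs no merging; \<open>lspan_sumD\<close>
  merges when distinct exponents matter. The set \<open>F\<close> carries support conditions such as
  homogeneity or degree bounds.\<close>

inductive_set lspan :: "(('n \<Rightarrow> int) \<Rightarrow> 'a) \<Rightarrow> ('n \<Rightarrow> int) set \<Rightarrow> 'a set" for M F where
  zero: "0 \<in> lspan M F"
| step: "y \<in> lspan M F \<Longrightarrow> a \<in> A \<Longrightarrow> f \<in> F \<Longrightarrow> y + a * M f \<in> lspan M F"

lemma lspan_term: "a \<in> A \<Longrightarrow> f \<in> F \<Longrightarrow> a * M f \<in> lspan M F"
  using lspan.step[OF lspan.zero] by force

lemma lspan_gen: "f \<in> F \<Longrightarrow> M f \<in> lspan M F"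
  using lspan_term[OF one_A] by fastforce

lemma lspan_add: "x \<in> lspan M F \<Longrightarrow> y \<in> lspan M F \<Longrightarrow> x + y \<in> lspan M F"
proof (induction x rule: lspan.induct)
  case (step x a f)
  then show ?case using lspan.step[of "x + y" M F a f] by (simp add: algebra_simps)
qed auto

lemma lspan_scale: "y \<in> lspan M F \<Longrightarrow> a \<in> A \<Longrightarrow> a * y \<in> lspan M F"
proof (induction y rule: lspan.induct)
  case (step x b f)
  then show ?case using lspan.step[of "a * x" M F "a * b" f]
    by (simp add: distrib_left mult.assoc mult_A)
qed (simp add: lspan.zero)

lemma lspan_uminus: "y \<in> lspan M F \<Longrightarrow> - y \<in> lspan M F"
  using lspan_scale[OF _ uminus_A[OF one_A]] by force

lemma lspan_diff: "x \<in> lspan M F \<Longrightarrow> y \<in> lspan M F \<Longrightarrow> x - y \<in> lspan M F"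
  using lspan_add[OF _ lspan_uminus] by force

lemma lspan_mono: "y \<in> lspan M F \<Longrightarrow> F \<subseteq> G \<Longrightarrow> y \<in> lspan M G"
  by (induction y rule: lspan.induct) (auto intro: lspan.intros)

lemma lspan_sum: "(\<And>i. i \<in> S \<Longrightarrow> c i \<in> lspan M F) \<Longrightarrow> sum c S \<in> lspan M F"
  by (induction S rule: infinite_finite_induct) (auto intro: lspan.zero lspan_add)

lemma lspan_sumD:
  assumes "y \<in> lspan M F"
  shows "\<exists>S c. finite S \<and> S \<subseteq> F \<and> (\<forall>f. c f \<in> A) \<and> y = (\<Sum>f\<in>S. c f * M f)"
  using assms
proof (induction y rule: lspan.induct)
  case zero
  then show ?case by (intro exI[of _ "{}"] exI[of _ "\<lambda>_. 0"]) (simp add: zero_A)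
next
  case (step y a f)
  then obtain S c where S: "finite S" "S \<subseteq> F" "\<forall>f. c f \<in> A" "y = (\<Sum>f\<in>S. c f * M f)"
    by blast
  define c' where "c' = c(f := (if f \<in> S then c f + a else a))"
  have rest: "(\<Sum>h\<in>S - {f}. c' h * M h) = (\<Sum>h\<in>S - {f}. c h * M h)"
    by (rule sum.cong) (auto simp: c'_def)
  have "y + a * M f = (\<Sum>h\<in>insert f S. c' h * M h)"
  proof (cases "f \<in> S")
    case True
    then have "insert f S = S" by auto
    with True S rest show ?thesis
      by (simp add: sum.remove[of S f] c'_def algebra_simps)
  next
    case False
    with S rest show ?thesis by (simp add: c'_def)
  qed
  moreover have "\<forall>h. c' h \<in> A" using S step by (auto simp: c'_def add_A)
  ultimately show ?case using S step by (intro exI[of _ "insert f S"] exI[of _ c']) auto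
qed

lemma lspan_split:
  assumes "y \<in> lspan M F"
  obtains u v where "y = u + v" "u \<in> lspan M {f\<in>F. P f}" "v \<in> lspan M {f\<in>F. \<not> P f}"
proof -
  have "\<exists>u v. y = u + v \<and> u \<in> lspan M {f\<in>F. P f} \<and> v \<in> lspan M {f\<in>F. \<not> P f}"
    using assms
  proof (induction y rule: lspan.induct)
    case zero
    then show ?case by (intro exI[of _ 0]) (simp add: lspan.zero)
  next
    case (step y a f)
    then obtain u v where uv: "y = u + v" "u \<in> lspan M {f\<in>F. P f}" "v \<in> lspan M {f\<in>F. \<not> P f}"
      by blast
    show ?case
    proof (cases "P f")
      case True
      then have "u + a * M f \<in> lspan M {f\<in>F. P f}" using uv step by (auto intro: lspan.step)
      then show ?thesis using uv
        by (intro exI[of _ "u + a * M f"] exI[of _ v]) (simp add: algebra_simps)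
    next
      case False
      then have "v + a * M f \<in> lspan M {f\<in>F. \<not> P f}" using uv step by (auto intro: lspan.step)
      then show ?thesis using uv
        by (intro exI[of _ u] exI[of _ "v + a * M f"]) (simp add: algebra_simps)
    qed
  qed
  then show ?thesis using that by blast
qed

section \<open>Toric frames over abstract scalars\<close>

definition independent :: "(('n \<Rightarrow> int) \<Rightarrow> 'a) \<Rightarrow> bool" where
  "independent M \<longleftrightarrow> (\<forall>S c. finite S \<longrightarrow> (\<forall>f\<in>S. c f \<in> A) \<longrightarrow> (\<Sum>f\<in>S. c f * M f) = 0 \<longrightarrow> (\<forall>f\<in>S. c f = 0))"

text \<open>The counterpart of \<open>toric_frame\<close> with the scalars already embedded in the
  division ring; \<open>toric_frame_iff\<close> identifies the two.\<close>

definition frame :: "(('n::finite \<Rightarrow> int) \<Rightarrow> 'a) \<Rightarrow> ('n \<Rightarrow> 'n \<Rightarrow> int) \<Rightarrow> bool" where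
  "frame M L \<longleftrightarrow>
     (\<forall>i j. int l dvd L i j + L j i) \<and> M 0 = 1 \<and>
     (\<forall>f g. M f * M g = q (bilin L f g) * M (f + g)) \<and> independent M \<and>
     (\<forall>y. \<exists>a\<in>lspan M UNIV. \<exists>b\<in>lspan M UNIV. b \<noteq> 0 \<and> y = a * inverse b)"

lemma frame_0: "frame M L \<Longrightarrow> M 0 = 1"
  by (simp add: frame_def)

lemma frame_mult: "frame M L \<Longrightarrow> M f * M g = q (bilin L f g) * M (f + g)"
  by (simp add: frame_def)

lemma frame_fractions: "frame M L \<Longrightarrow> \<exists>a\<in>lspan M UNIV. \<exists>b\<in>lspan M UNIV. b \<noteq> 0 \<and> y = a * inverse b"
  by (simp add: frame_def)

lemma frame_indep: "frame M L \<Longrightarrow> independent M"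
  by (simp add: frame_def)

lemma independentD:
  "independent M \<Longrightarrow> finite S \<Longrightarrow> (\<And>f. f \<in> S \<Longrightarrow> c f \<in> A) \<Longrightarrow> (\<Sum>f\<in>S. c f * M f) = 0 \<Longrightarrow> f \<in> S \<Longrightarrow> c f = 0"
  unfolding independent_def by blast

lemma bilin_skew:
  assumes "frame M L"
  shows "int l dvd bilin L f g + bilin L g f"
proof -
  have "bilin L g f = (\<Sum>i\<in>UNIV. \<Sum>j\<in>UNIV. g j * L j i * f i)"
    unfolding bilin_def by (rule sum.swap)
  then have "bilin L f g + bilin L g f = (\<Sum>i\<in>UNIV. \<Sum>j\<in>UNIV. f i * (L i j + L j i) * g j)"
    by (simp add: bilin_def algebra_simps sum.distrib)
  moreover have "int l dvd (\<Sum>i\<in>UNIV. \<Sum>j\<in>UNIV. f i * (L i j + L j i) * g j)"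
    using assms by (intro dvd_sum dvd_mult2 dvd_mult) (simp add: frame_def)
  ultimately show ?thesis by simp
qed

lemma bilin_self: "frame M L \<Longrightarrow> int l dvd bilin L f f"
  using bilin_skew[of M L f f] l_dvd_double[of "bilin L f f"] by simp

lemma bilin_skew': "frame M L \<Longrightarrow> int l dvd bilin L g f - (- bilin L f g)"
  using bilin_skew[of M L f g] by (simp add: add.commute)

lemma frame_inverse_mult: assumes "frame M L" shows "M f * M (- f) = 1" "M (- f) * M f = 1"
proof -
  have "q (- bilin L f f) = 1" using bilin_self[OF assms] by (simp add: q_one_iff)
  then show "M f * M (- f) = 1" "M (- f) * M f = 1" using assms
    by (simp_all add: frame_mult frame_0 bilin_linear)
qed

lemma frame_nz: "frame M L \<Longrightarrow> M f \<noteq> 0"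
  using frame_inverse_mult(1)[of M L f] by auto

lemma frame_inverse: "frame M L \<Longrightarrow> inverse (M f) = M (- f)"
  using frame_inverse_mult(1)[of M L f] inverse_unique by blast

lemma frame_comm:
  assumes "frame M L"
  shows "M f * M g = q (2 * bilin L f g) * (M g * M f)"
proof -
  have "q (2 * bilin L f g) * q (bilin L g f) = q (bilin L f g)"
    unfolding q_add[symmetric]
    by (rule q_cong) (use bilin_skew[OF assms, of f g] in \<open>simp add: algebra_simps\<close>)
  then show ?thesis using assms by (simp add: frame_mult add.commute mult.assoc[symmetric])
qed

lemma frame_comm_eq:
  assumes "frame M L" "int l dvd bilin L f g"
  shows "M f * M g = M g * M f"
  using frame_comm[OF assms(1), of f g] assms(2) by (simp add: q_one_iff[THEN iffD2])

lemma l_dvd_bilin_smul: "int l dvd bilin L (smul (int l) f) g"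
  by (simp add: bilin_smul_left)

lemma frame_central: "frame M L \<Longrightarrow> M (smul (int l) f) * M g = M g * M (smul (int l) f)"
  by (rule frame_comm_eq[OF _ l_dvd_bilin_smul])

lemma frame_add_parallel:
  assumes "frame M L" "int l dvd bilin L f g"
  shows "M (f + g) = M f * M g"
  using assms by (simp add: frame_mult q_one_iff[THEN iffD2])

lemma frame_add_central:
  "frame M L \<Longrightarrow> M (smul (int l) f + g) = M (smul (int l) f) * M g"
  by (rule frame_add_parallel[OF _ l_dvd_bilin_smul])

lemma frame_power: assumes "frame M L" shows "M f ^ n = M (smul (int n) f)"
proof (induction n)
  case 0
  have "smul (int 0) f = 0" by (simp add: fun_eq_iff smul_apply)
  then show ?case using frame_0[OF assms] by (simp only: power_0)
next
  case (Suc n)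
  have "M f ^ Suc n = M f * M (smul (int n) f)" using Suc by simp
  also have "\<dots> = M (f + smul (int n) f)"
    by (rule frame_add_parallel[OF assms, symmetric]) (simp add: bilin_smul_right bilin_self[OF assms])
  also have "f + smul (int n) f = smul (int (Suc n)) f" by (simp add: fun_eq_iff smul_apply algebra_simps)
  finally show ?case .
qed

lemma lspan_commute:
  assumes "y \<in> lspan M F" "\<And>f. f \<in> F \<Longrightarrow> x * M f = M f * x"
  shows "x * y = y * x"
  using assms
proof (induction y rule: lspan.induct)
  case (step y a f)
  have "x * (a * M f) = a * M f * x" using A_move[OF step(2), of x "M f"] step(3) step.prems by (simp add: mult.assoc)
  then show ?case using step by (simp add: distrib_left distrib_right)
qed simp

text \<open>An element commuting with all monomials commutes with their span, hence with numerator
  and denominator of any right fraction.\<close>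

lemma frame_center:
  assumes "frame M L"
  shows "M (smul (int l) f) * y = y * M (smul (int l) f)"
proof -
  let ?c = "M (smul (int l) f)"
  obtain a b where ab: "a \<in> lspan M UNIV" "b \<in> lspan M UNIV" "b \<noteq> 0" "y = a * inverse b"
    using frame_fractions[OF assms] by blast
  have cM: "?c * M g = M g * ?c" for g
    by (rule frame_central[OF assms])
  have ca: "?c * a = a * ?c"
    using cM by (rule lspan_commute[OF ab(1)])
  have cb: "?c * b = b * ?c"
    using cM by (rule lspan_commute[OF ab(2)])
  have "?c * y * b = ?c * a" using ab(3,4) by (simp add: mult.assoc)
  also have "\<dots> = y * b * ?c" unfolding ca using ab(3,4) by (simp add: mult.assoc)
  also have "\<dots> = y * ?c * b" by (simp only: mult.assoc cb)
  finally show ?thesis using ab(3) by simp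
qed

text \<open>Only the product rule is assumed, because through \<open>subalgebra_lspan_gen\<close>
  this also serves the mutated map before it is known to be a frame.\<close>

lemma lspan_mult_gen:
  assumes mult: "\<And>f g. M f * M g = q (bilin L f g) * M (f + g)"
    and "x \<in> lspan M F" "y \<in> lspan M G" "\<And>f g. f \<in> F \<Longrightarrow> g \<in> G \<Longrightarrow> f + g \<in> H"
  shows "x * y \<in> lspan M H"
  using assms(2)
proof (induction x rule: lspan.induct)
  case (step x a f)
  have "a * M f * y \<in> lspan M H"
    using assms(3)
  proof (induction y rule: lspan.induct)
    case (step y b g)
    have "a * M f * (b * M g) = a * (b * q (bilin L f g)) * M (f + g)"
      using mult[of f g] A_move[OF \<open>b \<in> A\<close>, of "M f" "M g"] by (simp add: mult.assoc)
    moreover have "\<dots> \<in> lspan M H"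
      by (intro lspan_term mult_A q_A assms(4) \<open>a \<in> A\<close> \<open>b \<in> A\<close> \<open>f \<in> F\<close> \<open>g \<in> G\<close>)
    ultimately show ?case using step by (simp add: distrib_left lspan_add)
  qed (simp add: lspan.zero)
  then show ?case using step by (simp add: distrib_right lspan_add)
qed (simp add: lspan.zero)

lemma lspan_mult:
  "frame M L \<Longrightarrow> x \<in> lspan M F \<Longrightarrow> y \<in> lspan M G \<Longrightarrow> (\<And>f g. f \<in> F \<Longrightarrow> g \<in> G \<Longrightarrow> f + g \<in> H) \<Longrightarrow>
    x * y \<in> lspan M H"
  by (rule lspan_mult_gen[OF frame_mult])

lemma lspan_disjoint:
  assumes "independent M" "y \<in> lspan M F" "y \<in> lspan M G" "F \<inter> G = {}"
  shows "y = 0"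
proof -
  obtain S c where S: "finite S" "S \<subseteq> F" "\<forall>f. c f \<in> A" "y = (\<Sum>f\<in>S. c f * M f)"
    using lspan_sumD[OF assms(2)] by blast
  obtain T d where T: "finite T" "T \<subseteq> G" "\<forall>f. d f \<in> A" "y = (\<Sum>f\<in>T. d f * M f)"
    using lspan_sumD[OF assms(3)] by blast
  have ST: "S \<inter> T = {}" using S T assms(4) by blast
  define e where "e f = (if f \<in> S then c f else - d f)" for f
  have "(\<Sum>f\<in>S \<union> T. e f * M f) = (\<Sum>f\<in>S. e f * M f) + (\<Sum>f\<in>T. e f * M f)"
    using S T ST by (simp add: sum.union_disjoint)
  also have "(\<Sum>f\<in>S. e f * M f) = y" unfolding S(4) by (rule sum.cong) (auto simp: e_def)
  also have "(\<Sum>f\<in>T. e f * M f) = - y" unfolding T(4) sum_negf[symmetric]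
    by (rule sum.cong) (use ST in \<open>auto simp: e_def\<close>)
  finally have "(\<Sum>f\<in>S \<union> T. e f * M f) = 0" by simp
  then have "e f = 0" if "f \<in> S" for f
    using independentD[OF assms(1), of "S \<union> T" e f] S T that by (auto simp: e_def uminus_A)
  then show ?thesis unfolding S(4) by (intro sum.neutral) (auto simp: e_def)
qed

lemma lspan_components_zero:
  assumes "independent M" "finite N" "(\<Sum>n\<in>N. y n) = 0"
    and "\<And>n. n \<in> N \<Longrightarrow> y n \<in> lspan M (F n)"
    and "\<And>m n. m \<in> N \<Longrightarrow> n \<in> N \<Longrightarrow> m \<noteq> n \<Longrightarrow> F m \<inter> F n = {}" and "n \<in> N"
  shows "y n = 0"
proof (rule lspan_disjoint[OF assms(1)])
  show "y n \<in> lspan M (F n)" using assms by blast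
  have "y n = - (\<Sum>m\<in>N - {n}. y m)"
    using assms(3) sum.remove[OF assms(2,6), of y] by (simp add: eq_neg_iff_add_eq_0)
  moreover have "(\<Sum>m\<in>N - {n}. y m) \<in> lspan M (\<Union>m\<in>N - {n}. F m)"
  proof (rule lspan_sum)
    fix m assume m: "m \<in> N - {n}"
    then show "y m \<in> lspan M (\<Union>m\<in>N - {n}. F m)"
      by (intro lspan_mono[OF assms(4)]) auto
  qed
  ultimately show "y n \<in> lspan M (\<Union>m\<in>N - {n}. F m)" by (simp add: lspan_uminus)
  show "F n \<inter> (\<Union>m\<in>N - {n}. F m) = {}" using assms(5,6) by blast
qed

lemma frame_unitv_step:
  assumes "frame M L"
  shows "M (f + unitv j) = q (- bilin L f (unitv j)) * (M f * M (unitv j))"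
    and "M (f - unitv j) = q (bilin L f (unitv j)) * (M f * inverse (M (unitv j)))"
proof -
  show "M (f + unitv j) = q (- bilin L f (unitv j)) * (M f * M (unitv j))"
    by (simp add: frame_mult[OF assms] q_mult_left)
  have "M f * inverse (M (unitv j)) = q (- bilin L f (unitv j)) * M (f - unitv j)"
    using frame_mult[OF assms, of f "- unitv j"] by (simp add: frame_inverse[OF assms] bilin_linear)
  then show "M (f - unitv j) = q (bilin L f (unitv j)) * (M f * inverse (M (unitv j)))"
    by (simp add: q_mult_left)
qed

text \<open>The factor \<open>q (2 * bilin L f g)\<close> can be read off from the commutator of the
  two elements, and \<open>l\<close> is odd.\<close>

lemma frames_agree_form:
  assumes M: "frame M L" "frame M' L'" and "M f = M' f" "M g = M' g"
  shows "int l dvd bilin L f g - bilin L' f g"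
proof -
  have "q (2 * bilin L f g) * (M g * M f) = q (2 * bilin L' f g) * (M g * M f)"
    using frame_comm[OF M(1), of f g] frame_comm[OF M(2), of f g] assms(3,4) by metis
  moreover have "M g * M f \<noteq> 0" using frame_nz[OF M(1)] by simp
  ultimately have "q (2 * bilin L f g) = q (2 * bilin L' f g)"
    by (metis (no_types) mult_right_cancel)
  then have "int l dvd 2 * (bilin L f g - bilin L' f g)"
    by (simp add: q_eq_iff algebra_simps)
  then show ?thesis by (simp only: l_dvd_double)
qed

text \<open>Nothing relates \<open>L\<close> and \<open>L'\<close> beforehand: at each induction
  step, two elements on which the frames already agree yield the congruence between the forms by
  \<open>frames_agree_form\<close>.\<close>

lemma frames_agree:
  assumes M: "frame M L" "frame M' L'" and J: "\<And>j. j \<in> J \<Longrightarrow> M (unitv j) = M' (unitv j)"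
    and f: "\<And>i. i \<notin> J \<Longrightarrow> f i = 0"
  shows "M f = M' f"
proof -
  have "\<forall>i. i \<notin> J \<longrightarrow> f i = 0" using f by blast
  then show ?thesis
  proof (induction f rule: exponent_induct)
    case zero
    show ?case using frame_0[OF M(1)] frame_0[OF M(2)] by metis
  next
    case (plus f j)
    note IH = plus.IH J[OF plus(1)]
    have "q (- bilin L f (unitv j)) = q (- bilin L' f (unitv j))"
      using frames_agree_form[OF M IH] by (simp add: q_eq_iff dvd_diff_commute)
    then have "M (f + unitv j) = M' (f + unitv j)"
      unfolding frame_unitv_step(1)[OF M(1)] frame_unitv_step(1)[OF M(2)] IH by simp
    then show ?case .
  next
    case (minus f j)
    note IH = minus.IH J[OF minus(1)]
    have "q (bilin L f (unitv j)) = q (bilin L' f (unitv j))"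
      using frames_agree_form[OF M IH] by (simp add: q_eq_iff)
    then have "M (f - unitv j) = M' (f - unitv j)"
      unfolding frame_unitv_step(2)[OF M(1)] frame_unitv_step(2)[OF M(2)] IH by simp
    then show ?case .
  qed
qed

lemma frames_eq:
  "frame M L \<Longrightarrow> frame M' L' \<Longrightarrow> (\<And>j. M (unitv j) = M' (unitv j)) \<Longrightarrow> M = M'"
  using frames_agree[of M L M' L' UNIV] by blast

section \<open>Subalgebras and clearing of denominators\<close>

definition subalgebra :: "'a set \<Rightarrow> bool" where
  "subalgebra R \<longleftrightarrow> A \<subseteq> R \<and> (\<forall>x\<in>R. \<forall>y\<in>R. x + y \<in> R \<and> x * y \<in> R)"

lemma subalgebra_lspan_gen:
  assumes "\<And>f g. M f * M g = q (bilin L f g) * M (f + g)" "M 0 = 1"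
  shows "subalgebra (lspan M UNIV)"
  unfolding subalgebra_def
proof (intro conjI ballI subsetI)
  show "a \<in> lspan M UNIV" if "a \<in> A" for a
    using lspan_term[OF that, of 0 UNIV M] assms(2) by simp
  show "x * y \<in> lspan M UNIV" if "x \<in> lspan M UNIV" "y \<in> lspan M UNIV" for x y
    by (rule lspan_mult_gen[OF assms(1) that]) simp
qed (rule lspan_add)

lemma subalgebra_lspan: "frame M L \<Longrightarrow> subalgebra (lspan M UNIV)"
  by (rule subalgebra_lspan_gen[OF frame_mult frame_0])

lemma subalgebra_monomials:
  assumes "frame M L" and R: "subalgebra R"
    and gen: "\<And>j. M (unitv j) \<in> R" "\<And>j. j \<notin> J \<Longrightarrow> M (- unitv j) \<in> R"
    and f: "\<And>j. j \<in> J \<Longrightarrow> f j \<ge> 0"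
  shows "M f \<in> R"
proof -
  have "(\<forall>j\<in>J. f j \<ge> 0) \<longrightarrow> M f \<in> R"
  proof (rule exponent_induct[of UNIV f])
    show "(\<forall>j\<in>J. 0 \<le> (0::'b \<Rightarrow> int) j) \<longrightarrow> M 0 \<in> R"
      using R one_A by (auto simp: frame_0[OF assms(1)] subalgebra_def)
  next
    fix f :: "'b \<Rightarrow> int" and j
    assume "f j \<ge> 0" and IH: "(\<forall>j\<in>J. f j \<ge> 0) \<longrightarrow> M f \<in> R"
    have "q (- bilin L f (unitv j)) * (M f * M (unitv j)) \<in> R" if "M f \<in> R"
      using R gen(1) q_A that unfolding subalgebra_def by blast
    moreover have "\<forall>j\<in>J. f j \<ge> 0" if "\<forall>i\<in>J. (f + unitv j) i \<ge> 0"
      using that \<open>f j \<ge> 0\<close> by (auto simp: unitv_def split: if_splits)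
    ultimately show "(\<forall>i\<in>J. (f + unitv j) i \<ge> 0) \<longrightarrow> M (f + unitv j) \<in> R"
      using IH frame_unitv_step(1)[OF assms(1), of f j] by auto
  next
    fix f :: "'b \<Rightarrow> int" and j
    assume "f j \<le> 0" and IH: "(\<forall>j\<in>J. f j \<ge> 0) \<longrightarrow> M f \<in> R"
    show "(\<forall>i\<in>J. (f - unitv j) i \<ge> 0) \<longrightarrow> M (f - unitv j) \<in> R"
    proof
      assume nn: "\<forall>i\<in>J. (f - unitv j) i \<ge> 0"
      \<comment> \<open>A subtraction step starts from \<open>f j \<le> 0\<close>, so its result is
        negative at \<open>j\<close>, which is excluded on \<open>J\<close>.\<close>
      then have "j \<notin> J" using \<open>f j \<le> 0\<close> by (force simp: unitv_def)
      moreover have "\<forall>i\<in>J. f i \<ge> 0" using nn by (force simp: unitv_def split: if_splits)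
      ultimately have "q (bilin L f (unitv j)) * (M f * M (- unitv j)) \<in> R"
        using R IH gen(2) q_A unfolding subalgebra_def by blast
      then show "M (f - unitv j) \<in> R"
        using frame_unitv_step(2)[OF assms(1), of f j] by (simp add: frame_inverse[OF assms(1)])
    qed
  qed auto
  then show ?thesis using f by blast
qed

text \<open>The multiplier has exponents divisible by \<open>l\<close>, hence is central. All large
  \<open>m\<close> are allowed so that one multiplier can serve two elements.\<close>

lemma subalgebra_clear_denominators:
  assumes "frame M L" and R: "subalgebra R"
    and gen: "\<And>j. M (unitv j) \<in> R" "\<And>j. j \<notin> J \<Longrightarrow> M (- unitv j) \<in> R"
    and y: "y \<in> lspan M UNIV"
  shows "\<exists>n. \<forall>m\<ge>n. M (smul (int l) (\<lambda>j. if j \<in> J then int m else 0)) * y \<in> R"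
  using y
proof (induction y rule: lspan.induct)
  case zero
  then show ?case using R zero_A by (auto simp: subalgebra_def)
next
  case (step y a f)
  then obtain n where n: "\<forall>m\<ge>n. M (smul (int l) (\<lambda>j. if j \<in> J then int m else 0)) * y \<in> R" by blast
  define N where "N = (\<Sum>j\<in>UNIV. nat \<bar>f j\<bar>)"
  have N: "int N \<ge> \<bar>f j\<bar>" for j
  proof -
    have "nat \<bar>f j\<bar> \<le> N" unfolding N_def by (rule member_le_sum) auto
    then show ?thesis by linarith
  qed
  show ?case
  proof (intro exI[of _ "n + N"] allI impI)
    fix m assume m: "m \<ge> n + N"
    let ?c = "smul (int l) (\<lambda>j. if j \<in> J then int m else 0)"
    have "M (?c + f) \<in> R"
    proof (rule subalgebra_monomials[OF assms(1) R gen])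
      fix j assume "j \<in> J"
      have "int m \<le> int l * int m" using l_pos by (simp add: mult_le_cancel_right1)
      moreover have "- f j \<le> int m" using N[of j] m by linarith
      ultimately show "(?c + f) j \<ge> 0" using \<open>j \<in> J\<close> by (simp add: smul_apply)
    qed auto
    then have "a * M (?c + f) \<in> R" using step R unfolding subalgebra_def by blast
    moreover have "M ?c * (a * M f) = a * M (?c + f)"
      unfolding frame_add_central[OF assms(1)] by (rule A_move[OF step(2)])
    moreover have "M ?c * y \<in> R" using n m by simp
    ultimately show "M ?c * (y + a * M f) \<in> R"
      using R by (simp add: distrib_left subalgebra_def)
  qed
qed

end

section \<open>Bilinear forms under the change of basis of a mutation\<close>

lemma bilin_sum_left: "bilin L (\<lambda>i. \<Sum>a\<in>UNIV. f a * C a i) v = (\<Sum>a\<in>UNIV. f a * bilin L (C a) v)"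
proof -
  have "bilin L (\<lambda>i. \<Sum>a\<in>UNIV. f a * C a i) v
    = (\<Sum>i\<in>UNIV. \<Sum>j\<in>UNIV. \<Sum>a\<in>UNIV. f a * (C a i * L i j * v j))"
    by (simp add: bilin_def sum_distrib_right mult.assoc)
  also have "\<dots> = (\<Sum>i\<in>UNIV. \<Sum>a\<in>UNIV. \<Sum>j\<in>UNIV. f a * (C a i * L i j * v j))"
    by (intro sum.cong refl sum.swap)
  also have "\<dots> = (\<Sum>a\<in>UNIV. \<Sum>i\<in>UNIV. \<Sum>j\<in>UNIV. f a * (C a i * L i j * v j))"
    by (rule sum.swap)
  finally show ?thesis by (simp add: bilin_def sum_distrib_left)
qed

lemma bilin_transpose: "bilin L u v = bilin (\<lambda>i j. L j i) v u"
  unfolding bilin_def by (subst sum.swap) (simp add: mult_ac)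

lemma bilin_sum_right: "bilin L u (\<lambda>i. \<Sum>a\<in>UNIV. f a * C a i) = (\<Sum>a\<in>UNIV. f a * bilin L u (C a))"
  by (subst (1 2) bilin_transpose) (rule bilin_sum_left)

lemma bilin_pullback:
  "bilin (\<lambda>a b. bilin L (C a) (C b)) f g
    = bilin L (\<lambda>i. \<Sum>a\<in>UNIV. f a * C a i) (\<lambda>i. \<Sum>a\<in>UNIV. g a * C a i)"
  by (simp add: bilin_sum_left bilin_sum_right) (simp add: bilin_def sum_distrib_left mult_ac)

text \<open>This applies to \<open>f\<close> the matrix whose \<open>k\<close>-th column is
  \<open>h\<close> and whose other columns are unit vectors, the shape of the matrix E.\<close>

lemma sum_mutation_column:
  "(\<lambda>i. \<Sum>a\<in>UNIV. f a * (if a = k then h else unitv a) i) = f(k := 0) + smul (f k) (h :: 'n::finite \<Rightarrow> int)"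
proof
  fix i
  have "(\<Sum>a\<in>UNIV. f a * (if a = k then h else unitv a) i)
      = f k * h i + (\<Sum>a\<in>UNIV - {k}. f a * unitv a i)"
    by (subst sum.remove[of _ k]) (auto intro!: sum.cong)
  also have "(\<Sum>a\<in>UNIV - {k}. f a * unitv a i) = (\<Sum>a\<in>UNIV - {k}. if a = i then f a else 0)"
    by (rule sum.cong) (auto simp: unitv_def)
  also have "\<dots> = (f(k := 0)) i" by simp
  finally show "(\<Sum>a\<in>UNIV. f a * (if a = k then h else unitv a) i) = (f(k := 0) + smul (f k) h) i"
    by (simp add: smul_apply)
qed

lemma posp_negp: "posp b + negp b = b"
  by (auto simp: posp_def negp_def fun_eq_iff)

context torus_scalars
begin

lemma q_commute_powi:
  assumes "x * y = q m * (y * x)" "x \<noteq> 0"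
  shows "x powi n * y = q (n * m) * (y * x powi n)"
proof -
  have pos: "x ^ n * y = q (int n * m) * (y * x ^ n)" if "x * y = q m * (y * x)" for x m n
  proof (induction n)
    case (Suc n)
    have "x ^ Suc n * y = x * (q (int n * m) * (y * x ^ n))" using Suc by (simp add: mult.assoc)
    also have "\<dots> = q (int n * m) * (x * y * x ^ n)" by (simp add: q_move mult.assoc)
    also have "\<dots> = q (int n * m + m) * (y * x * x ^ n)" using that by (simp add: q_add mult.assoc)
    finally show ?case by (simp add: algebra_simps)
  qed simp
  have "inverse x * (x * y) * inverse x = inverse x * (q m * (y * x)) * inverse x"
    using assms(1) by simp
  then have "y * inverse x = q m * (inverse x * y)"
    using assms(2) by (simp add: q_move mult.assoc) (simp flip: mult.assoc)
  then have inv: "inverse x * y = q (- m) * (y * inverse x)"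
    by (simp add: q_mult_left)
  show ?thesis
  proof (cases "n \<ge> 0")
    case True
    then show ?thesis using pos[OF assms(1), of "nat n"] by (simp add: power_int_def)
  next
    case False
    then show ?thesis using pos[OF inv, of "nat (- n)"] by (simp add: power_int_def)
  qed
qed

text \<open>Independence settles distinct exponents. Equal ones correspond to a vanishing column of
  the exchange matrix, and then the sum is \<open>2 * M g\<close>.\<close>

lemma two_terms_nz:
  assumes "frame M L"
  shows "M g + M h \<noteq> 0"
proof
  assume 0: "M g + M h = 0"
  show False
  proof (cases "g = h")
    case True
    then have "2 * M g = 0" using 0 by (simp add: mult_2)
    then show False using two_nz frame_nz[OF assms] by simp
  next
    case False
    then have "(\<Sum>f\<in>{g, h}. 1 * M f) = 0" using 0 by simp
    from independentD[OF frame_indep[OF assms] _ _ this, of g] show False by (simp add: one_A)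
  qed
qed

end

section \<open>Mutation of toric frames\<close>

text \<open>b is the k-th column of the exchange matrix and d the k-th entry of D. The exponent h is also the k-th column
  of the matrix E, so that L' is the transformed form. In M', normal ordering splits off the power of x.\<close>

locale torus_mutation = torus_scalars l A q bar for l and A :: "'a::division_ring set" and q bar +
  fixes M :: "('n::finite \<Rightarrow> int) \<Rightarrow> 'a" and L :: "'n \<Rightarrow> 'n \<Rightarrow> int"
    and k :: 'n and b :: "'n \<Rightarrow> int" and d :: int
  assumes M: "frame M L"
    and b_k: "b k = 0"
    and pairing: "int l dvd bilin L b y - d * y k"
begin

definition g where "g = - unitv k + posp b"
definition h where "h = - unitv k - negp b"
definition x where "x = M g + M h"

lemma g_h: "g = h + b"
  using posp_negp[of b] by (simp add: g_def h_def algebra_simps)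

lemma g_k: "g k = - 1" and h_k: "h k = - 1"
  using b_k by (simp_all add: g_def h_def posp_def negp_def unitv_def)

lemma x_nz: "x \<noteq> 0"
  by (simp add: x_def two_terms_nz[OF M])

lemma pairing_0: "y k = 0 \<Longrightarrow> int l dvd bilin L b y"
  using pairing[of y] by simp

lemma g_h_pairing: "y k = 0 \<Longrightarrow> int l dvd bilin L g y - bilin L h y"
  using pairing_0[of y] by (simp add: g_h bilin_linear)

text \<open>The two monomials of \<open>x\<close> differ by \<open>b\<close>, which pairs to 0
  modulo \<open>l\<close> with exponents vanishing at \<open>k\<close>; so both acquire the same
  factor when moved past \<open>M r\<close>.\<close>

lemma x_comm:
  assumes "r k = 0"
  shows "x * M r = q (2 * bilin L h r) * (M r * x)"
proof -
  have "int l dvd 2 * (bilin L g r - bilin L h r)"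
    using g_h_pairing[of r, OF assms] by (rule dvd_mult)
  then have eq: "q (2 * bilin L g r) = q (2 * bilin L h r)"
    by (intro q_cong) (simp add: right_diff_distrib)
  have "x * M r = q (2 * bilin L g r) * (M r * M g) + q (2 * bilin L h r) * (M r * M h)"
    unfolding x_def distrib_right frame_comm[OF M, of g r] frame_comm[OF M, of h r] ..
  then show ?thesis by (simp add: eq x_def distrib_left)
qed

lemma x_powi_comm: "r k = 0 \<Longrightarrow> x powi n * M r = q (2 * n * bilin L h r) * (M r * x powi n)"
  using q_commute_powi[OF x_comm x_nz, of r n] by (simp add: mult_ac)

lemma x_powi_comm': "r k = 0 \<Longrightarrow> M r * x powi n = q (- 2 * n * bilin L h r) * (x powi n * M r)"
  by (simp add: x_powi_comm q_mult_left)

text \<open>The power of \<open>q\<close> is forced by the product rule for \<open>L'\<close>: the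
  form of \<open>f k\<close> times the \<open>k\<close>-th unit vector with the rest of
  \<open>f\<close> is \<open>f k * bilin L h (f(k := 0))\<close>.\<close>

definition M' where "M' f = q (- f k * bilin L h (f(k := 0))) * (x powi f k * M (f(k := 0)))"
definition L' where "L' = (\<lambda>a c. bilin L (if a = k then h else unitv a) (if c = k then h else unitv c))"

lemma bilin_L': "bilin L' f f' = bilin L (f(k := 0) + smul (f k) h) (f'(k := 0) + smul (f' k) h)"
  unfolding L'_def bilin_pullback sum_mutation_column ..

lemma upd_add: "(f + f')(k := 0) = f(k := 0) + f'(k := (0::int))"
  by (simp add: fun_eq_iff)

lemma M'_rest: "r k = 0 \<Longrightarrow> M' r = M r"
  by (simp add: M'_def fun_upd_idem)

lemma M'_k: "M' (unitv k) = x"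
proof -
  have "(unitv k)(k := 0::int) = 0" by (simp add: unitv_def fun_eq_iff)
  then show ?thesis using frame_0[OF M] by (simp add: M'_def unitv_def)
qed

lemma M'_minus_k: "M' (- unitv k) = inverse x"
proof -
  have "(- unitv k)(k := 0::int) = 0" by (simp add: unitv_def fun_eq_iff)
  then show ?thesis using frame_0[OF M] by (simp add: M'_def unitv_def)
qed

lemma M'_0: "M' 0 = 1"
  using M'_rest[OF zero_fun_apply] frame_0[OF M] by (rule trans)

lemma q_mult_q: "(q m * u) * (q n * v) = q m * (q n * (u * v))"
  by (simp only: mult.assoc q_move[of u])

lemma M'_mult: "M' f * M' f' = q (bilin L' f f') * M' (f + f')"
proof -
  let ?n = "f k" and ?n' = "f' k" and ?r = "f(k := 0)" and ?s = "f'(k := 0)"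
  have r0: "?r k = 0" by simp
  have "M' f * M' f' = q (- ?n * bilin L h ?r) * (q (- ?n' * bilin L h ?s) *
      (x powi ?n * (M ?r * x powi ?n') * M ?s))"
    unfolding M'_def q_mult_q by (simp only: mult.assoc)
  also have "\<dots> = q (- ?n * bilin L h ?r - ?n' * bilin L h ?s - 2 * ?n' * bilin L h ?r + bilin L ?r ?s)
      * (x powi (?n + ?n') * M (?r + ?s))"
  proof -
    have "x powi ?n * (M ?r * x powi ?n') * M ?s
        = q (- 2 * ?n' * bilin L h ?r) * (x powi ?n * x powi ?n' * (M ?r * M ?s))"
      unfolding x_powi_comm'[of ?r, OF r0] by (simp only: q_move mult.assoc)
    also have "x powi ?n * x powi ?n' * (M ?r * M ?s) = q (bilin L ?r ?s) * (x powi (?n + ?n') * M (?r + ?s))"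
      by (simp only: frame_mult[OF M] q_move power_int_add x_nz simp_thms)
    finally have comm: "x powi ?n * (M ?r * x powi ?n') * M ?s = q (- 2 * ?n' * bilin L h ?r) *
      (q (bilin L ?r ?s) * (x powi (?n + ?n') * M (?r + ?s)))" .
    show ?thesis unfolding comm q_mult_left by (simp add: algebra_simps)
  qed
  also have "q (- ?n * bilin L h ?r - ?n' * bilin L h ?s - 2 * ?n' * bilin L h ?r + bilin L ?r ?s)
      = q (bilin L' f f' - (?n + ?n') * bilin L h (?r + ?s))"
  proof (rule q_cong)
    \<comment> \<open>The two exponents of \<open>q\<close> differ by multiples of the skew-symmetry
      defects of \<open>L\<close>, which vanish modulo \<open>l\<close>.\<close>
    have "(- ?n * bilin L h ?r - ?n' * bilin L h ?s - 2 * ?n' * bilin L h ?r + bilin L ?r ?s)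
        - (bilin L' f f' - (?n + ?n') * bilin L h (?r + ?s))
      = - (?n' * (bilin L h ?r + bilin L ?r h) + ?n * ?n' * bilin L h h)"
      unfolding bilin_L' by (simp add: bilin_linear) (simp add: algebra_simps)
    moreover have "int l dvd - (?n' * (bilin L h ?r + bilin L ?r h) + ?n * ?n' * bilin L h h)"
      using bilin_skew[OF M] bilin_self[OF M] by (simp add: dvd_mult)
    ultimately show "int l dvd (- ?n * bilin L h ?r - ?n' * bilin L h ?s - 2 * ?n' * bilin L h ?r + bilin L ?r ?s)
        - (bilin L' f f' - (?n + ?n') * bilin L h (?r + ?s))" by simp
  qed
  also have "q (bilin L' f f' - (?n + ?n') * bilin L h (?r + ?s)) * (x powi (?n + ?n') * M (?r + ?s))
      = q (bilin L' f f') * M' (f + f')"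
    unfolding M'_def upd_add by (simp add: q_mult_left) (simp add: algebra_simps)
  finally show ?thesis .
qed

lemma subalgebra_M': "subalgebra (lspan M' UNIV)"
  by (rule subalgebra_lspan_gen[OF M'_mult M'_0])

lemma M_rest_M': "r k = 0 \<Longrightarrow> M r \<in> lspan M' UNIV"
  using M'_rest[of r] lspan_gen[of r UNIV M'] by simp

text \<open>Multiplying by \<open>M (unitv k)\<close> cancels the component -1 at \<open>k\<close>
  in both \<open>g\<close> and \<open>h\<close>, so the old variable becomes a Laurent polynomial in
  the new ones.\<close>

lemma x_M_k: "M (unitv k) = inverse x * (q (bilin L g (unitv k)) * M (posp b) + q (bilin L h (unitv k)) * M (- negp b))"
proof -
  have "g + unitv k = posp b" "h + unitv k = - negp b" by (simp_all add: g_def h_def)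
  then have "x * M (unitv k) = q (bilin L g (unitv k)) * M (posp b) + q (bilin L h (unitv k)) * M (- negp b)"
    by (simp add: x_def distrib_right frame_mult[OF M])
  then show ?thesis using x_nz by (metis mult.assoc mult_1 left_inverse)
qed

lemma M_unitv_M': "M (unitv j) \<in> lspan M' UNIV"
proof (cases "j = k")
  case True
  have "M (posp b) \<in> lspan M' UNIV" "M (- negp b) \<in> lspan M' UNIV"
    using b_k by (intro M_rest_M'; simp add: posp_def negp_def)+
  moreover have "inverse x \<in> lspan M' UNIV" using lspan_gen[of "- unitv k" UNIV M'] M'_minus_k by simp
  ultimately show ?thesis using subalgebra_M' q_A unfolding True subalgebra_def
    by (subst x_M_k) (blast intro: lspan_add lspan_scale)
next
  case False
  then show ?thesis by (intro M_rest_M') (simp add: unitv_def)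
qed

text \<open>Among the old variables only the inverse of the \<open>k\<close>-th may be missing from
  the span of \<open>M'\<close>. A central monomial in that variable brings numerator and
  denominator into the span, and it cancels from the fraction.\<close>

lemma M'_fractions: "\<exists>a\<in>lspan M' UNIV. \<exists>c\<in>lspan M' UNIV. c \<noteq> 0 \<and> y = a * inverse c"
proof -
  obtain a c where ac: "a \<in> lspan M UNIV" "c \<in> lspan M UNIV" "c \<noteq> 0" "y = a * inverse c"
    using frame_fractions[OF M] by blast
  let ?N = "\<lambda>m. M (smul (int l) (\<lambda>j. if j \<in> {k} then int m else 0))"
  have minus: "M (- unitv j) \<in> lspan M' UNIV" if "j \<notin> {k}" for j
    using that by (intro M_rest_M') (simp add: unitv_def)
  note clear = subalgebra_clear_denominators[OF M subalgebra_M' M_unitv_M' minus]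
  obtain n1 where n1: "\<forall>m\<ge>n1. ?N m * a \<in> lspan M' UNIV" using clear ac(1) by blast
  obtain n2 where n2: "\<forall>m\<ge>n2. ?N m * c \<in> lspan M' UNIV" using clear ac(2) by blast
  define m where "m = n1 + n2"
  have "?N m * a = a * ?N m" "?N m * c = c * ?N m" by (rule frame_center[OF M])+
  moreover have "y = (a * ?N m) * inverse (c * ?N m)"
    using ac frame_nz[OF M] by (simp add: nonzero_inverse_mult_distrib mult.assoc)
       (simp flip: mult.assoc)
  moreover have "?N m * a \<in> lspan M' UNIV" "?N m * c \<in> lspan M' UNIV"
    using n1 n2 by (simp_all add: m_def)
  moreover have "c * ?N m \<noteq> 0" using ac frame_nz[OF M] by simp
  ultimately show ?thesis by metis
qed

lemma x_power_homogeneous: "x ^ n \<in> lspan M {f. f k = - int n}"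
proof (induction n)
  case 0
  then show ?case using lspan_gen[of 0 "{f. f k = 0}" M] frame_0[OF M] by simp
next
  case (Suc n)
  have "x \<in> lspan M {f. f k = - 1}"
    unfolding x_def by (intro lspan_add lspan_gen) (simp_all add: g_k h_k)
  then have "x * x ^ n \<in> lspan M {f. f k = - int (Suc n)}"
    by (rule lspan_mult[OF M _ Suc]) simp
  then show ?case by simp
qed

text \<open>Multiplication by \<open>x ^ m\<close> makes all powers of \<open>x\<close> nonnegative,
  so they expand in \<open>M\<close>. Since \<open>x ^ p\<close> has degree \<open>- p\<close> at
  \<open>k\<close>, terms with different powers of \<open>x\<close> are separated by this degree;
  for a fixed power, \<open>x\<close> cancels and independence of \<open>M\<close> applies.\<close>

lemma M'_independent: "independent M'"
  unfolding independent_def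
proof (intro allI impI ballI)
  fix S c f0
  assume S: "finite S" "\<forall>f\<in>S. c f \<in> A" "(\<Sum>f\<in>S. c f * M' f) = 0" "f0 \<in> S"
  define m where "m = (\<Sum>f\<in>S. nat \<bar>f k\<bar>)"
  have m: "int m + f k \<ge> 0" if "f \<in> S" for f
  proof -
    have "nat \<bar>f k\<bar> \<le> m" unfolding m_def using S(1) that by (intro member_le_sum) auto
    then show ?thesis by linarith
  qed
  define a where "a f = c f * q (- f k * bilin L h (f(k := 0)))" for f
  have aA: "a f \<in> A" if "f \<in> S" for f using S(2) that by (simp add: a_def mult_A q_A)
  define w where "w n = (\<Sum>f | f \<in> S \<and> f k = n. a f * M (f(k := 0)))" for n
  define N where "N = (\<lambda>f. f k) ` S"
  have summand: "x ^ m * (c f * M' f) = x powi (int m + f k) * (a f * M (f(k := 0)))" if "f \<in> S" for f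
  proof -
    have cA: "a f * y = y * a f" "c f * y = y * c f" for y
      using central_A aA S(2) that by auto
    have "c f * M' f = x powi f k * (a f * M (f(k := 0)))"
      unfolding M'_def by (metis a_def cA(1) mult.assoc)
    then show ?thesis by (simp add: power_int_add x_nz mult.assoc)
  qed
  have "0 = x ^ m * (\<Sum>f\<in>S. c f * M' f)" using S(3) by simp
  also have "\<dots> = (\<Sum>f\<in>S. x powi (int m + f k) * (a f * M (f(k := 0))))"
    by (simp add: sum_distrib_left summand)
  also have "\<dots> = (\<Sum>n\<in>N. \<Sum>f | f \<in> S \<and> f k = n. x powi (int m + f k) * (a f * M (f(k := 0))))"
    unfolding N_def using S(1) by (subst sum.group[symmetric, where g = "\<lambda>f. f k" and T = "(\<lambda>f. f k) ` S"]) auto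
  also have "\<dots> = (\<Sum>n\<in>N. x powi (int m + n) * w n)"
    unfolding w_def by (intro sum.cong refl) (simp add: sum_distrib_left)
  finally have sum0: "(\<Sum>n\<in>N. x powi (int m + n) * w n) = 0" by simp
  have "x powi (int m + f0 k) * w (f0 k) = 0"
  proof (rule lspan_components_zero[OF frame_indep[OF M] _ sum0])
    show "finite N" "f0 k \<in> N" using S by (auto simp: N_def)
    fix n assume "n \<in> N"
    then have "int m + n \<ge> 0" using m by (auto simp: N_def)
    then obtain p where p: "int m + n = int p" using nonneg_int_cases by blast
    have "w n \<in> lspan M {f. f k = 0}"
      unfolding w_def by (rule lspan_sum) (auto intro!: lspan_term aA)
    then have "x ^ p * w n \<in> lspan M {f. f k = - int p}"
      by (rule lspan_mult[OF M x_power_homogeneous]) simp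
    then show "x powi (int m + n) * w n \<in> lspan M {f. f k = - (int m + n)}" by (simp add: p)
  qed auto
  then have w0: "w (f0 k) = 0" using x_nz by simp
  define S0 where "S0 = {f\<in>S. f k = f0 k}"
  have inj: "inj_on (\<lambda>f. f(k := 0)) S0"
  proof (rule inj_onI)
    fix f f' assume "f \<in> S0" "f' \<in> S0" and eq: "f(k := 0) = f'(k := 0)"
    then have "f k = f' k" by (simp add: S0_def)
    then show "f = f'" using eq by (metis fun_upd_triv fun_upd_upd)
  qed
  \<comment> \<open>All exponents in \<open>S0\<close> have the same entry at \<open>k\<close>, so
    restoring that entry inverts its deletion.\<close>
  let ?i = "\<lambda>r. r(k := f0 k)"
  have "(\<Sum>r\<in>(\<lambda>f. f(k := 0)) ` S0. a (?i r) * M r) = (\<Sum>f\<in>S0. a (?i (f(k := 0))) * M (f(k := 0)))"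
    using inj by (simp add: sum.reindex)
  also have "\<dots> = w (f0 k)"
    unfolding w_def S0_def by (rule sum.cong) (auto simp: fun_upd_idem)
  finally have sum0': "(\<Sum>r\<in>(\<lambda>f. f(k := 0)) ` S0. a (?i r) * M r) = 0" using w0 by simp
  have "(\<lambda>r. a (?i r)) (f0(k := 0)) = 0"
  proof (rule independentD[OF frame_indep[OF M] _ _ sum0'])
    show "finite ((\<lambda>f. f(k := 0)) ` S0)" using S(1) by (simp add: S0_def)
    show "f0(k := 0) \<in> (\<lambda>f. f(k := 0)) ` S0" using S(4) by (simp add: S0_def)
    fix r assume "r \<in> (\<lambda>f. f(k := 0)) ` S0"
    then obtain f where "f \<in> S0" "r = f(k := 0)" by blast
    then have "?i r = f" by (auto simp: S0_def)
    then show "a (?i r) \<in> A" using \<open>f \<in> S0\<close> aA by (simp add: S0_def)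
  qed
  then show "c f0 = 0" by (simp add: a_def)
qed

theorem frame_M': "frame M' L'"
  unfolding frame_def
  using M'_0 M'_mult M'_independent M'_fractions bilin_skew[OF M] by (auto simp: L'_def)

end

section \<open>Mutation of exchange matrices\<close>

lemma posp_uminus: "posp (- b) = - negp b" and negp_uminus: "negp (- b) = - posp b"
  by (auto simp: posp_def negp_def fun_eq_iff)

text \<open>The division by 2 is always exact. The third form is the second after both entries
  change sign, as happens when a mutation is repeated.\<close>

lemma half_abs_sum:
  fixes x y :: int
  shows "2 * ((\<bar>x\<bar> * y + x * \<bar>y\<bar>) div 2) = \<bar>x\<bar> * y + x * \<bar>y\<bar>"
    and "(\<bar>x\<bar> * y + x * \<bar>y\<bar>) div 2 = max 0 x * max 0 y - max 0 (- x) * max 0 (- y)"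
    and "(- (\<bar>x\<bar> * y) - x * \<bar>y\<bar>) div 2 = max 0 (- x) * max 0 (- y) - max 0 x * max 0 y"
  by (auto simp: abs_if max_def)

abbreviation (input) col :: "('n \<Rightarrow> 'n \<Rightarrow> int) \<Rightarrow> 'n \<Rightarrow> 'n \<Rightarrow> int" where
  "col B k \<equiv> (\<lambda>i. B i k)"

lemma exmat_bmut: "exmat ex (bmut ex k B)"
  by (simp add: exmat_def bmut_def)

lemma bmut_bmut:
  assumes "exmat ex B" "k \<in> ex"
  shows "bmut ex k (bmut ex k B) = B"
proof (intro ext)
  fix i j
  show "bmut ex k (bmut ex k B) i j = B i j"
    using assms by (auto simp: bmut_def exmat_def half_abs_sum(2,3))
qed

lemma col_bmut: "k \<in> ex \<Longrightarrow> col (bmut ex k B) k = - col B k"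
  by (simp add: bmut_def fun_eq_iff)

lemma compat_with_skew: "compat_with l ex L B D \<Longrightarrow> i \<in> ex \<Longrightarrow> j \<in> ex \<Longrightarrow> D i * B i j = - (D j * B j i)"
  unfolding compat_with_def by blast

lemma compat_with_pos: "compat_with l ex L B D \<Longrightarrow> i \<in> ex \<Longrightarrow> D i > 0"
  unfolding compat_with_def by blast

lemma compat_with_diag: "compat_with l ex L B D \<Longrightarrow> k \<in> ex \<Longrightarrow> B k k = 0"
  using compat_with_skew[of l ex L B D k k] compat_with_pos[of l ex L B D k] by simp

lemma compat_with_pairing:
  assumes "compat_with l ex L B D" "j \<in> ex"
  shows "int l dvd bilin L (col B j) y - D j * y j"
proof -
  have "bilin L (col B j) y = (\<Sum>i\<in>UNIV. (\<Sum>k\<in>UNIV. B k j * L k i) * y i)"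
    unfolding bilin_def by (subst sum.swap) (simp add: sum_distrib_right)
  moreover have "D j * y j = (\<Sum>i\<in>UNIV. (if i = j then D j else 0) * y i)"
  proof -
    have "(\<Sum>i\<in>UNIV. (if i = j then D j else 0) * y i) = (\<Sum>i\<in>UNIV. if i = j then D j * y i else 0)"
      by (rule sum.cong) auto
    then show ?thesis by simp
  qed
  ultimately have eq: "bilin L (col B j) y - D j * y j
      = (\<Sum>i\<in>UNIV. ((\<Sum>k\<in>UNIV. B k j * L k i) - (if i = j then D j else 0)) * y i)"
    by (simp add: left_diff_distrib sum_subtractf)
  have "int l dvd (\<Sum>k\<in>UNIV. B k j * L k i) - (if i = j then D j else 0)" for i
    using assms unfolding compat_with_def mod_eq_dvd_iff by blast
  then show ?thesis unfolding eq by (intro dvd_sum dvd_mult2)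
qed

lemma compat_with_intro:
  assumes "\<And>j. j \<in> ex \<Longrightarrow> D j > 0" "\<And>i j. i \<in> ex \<Longrightarrow> j \<in> ex \<Longrightarrow> D i * B i j = - (D j * B j i)"
    and pair: "\<And>i j. j \<in> ex \<Longrightarrow> int l dvd bilin L (col B j) (unitv i) - (if i = j then D j else 0)"
  shows "compat_with l ex L B D"
  unfolding compat_with_def mod_eq_dvd_iff
proof (intro conjI ballI allI)
  fix i j assume "j \<in> ex"
  then show "int l dvd (\<Sum>k\<in>UNIV. B k j * L k i) - (if i = j then D j else 0)"
    using pair[of j i] by (simp only: bilin_unitv_right)
qed (use assms(1,2) in blast)+

lemma mut_form_bilin:
  assumes "B k k = 0"
  shows "mut_form k B L = (\<lambda>a c. bilin L (if a = k then - unitv k - negp (col B k) else unitv a)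
    (if c = k then - unitv k - negp (col B k) else unitv c))"
proof -
  have "(\<lambda>i. Emat k B i a) = (if a = k then - unitv k - negp (col B k) else unitv a)" for a
    using assms by (auto simp: Emat_def unitv_def negp_def fun_eq_iff)
  moreover have "mut_form k B L = (\<lambda>a c. bilin L (\<lambda>i. Emat k B i a) (\<lambda>i. Emat k B i c))"
    by (simp add: mut_form_def bilin_def)
  ultimately show ?thesis by simp
qed

text \<open>Doubling removes the division in \<open>bmut\<close>. As \<open>D\<close> is positive,
  the skew relation holds for absolute values without the sign, so the entries of \<open>D\<close>
  can be moved through every product.\<close>

lemma bmut_skew:
  assumes "compat_with l ex L B D" "k \<in> ex" "i \<in> ex" "j \<in> ex"
  shows "D i * bmut ex k B i j = - (D j * bmut ex k B j i)"
proof (cases "i = k \<or> j = k")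
  case True
  then show ?thesis using compat_with_skew[OF assms(1,3,4)] assms by (auto simp: bmut_def)
next
  case False
  note skew = compat_with_skew[OF assms(1)]
  note pos = compat_with_pos[OF assms(1,3)] compat_with_pos[OF assms(1,4)] compat_with_pos[OF assms(1,2)]
  have abs: "D i * \<bar>B i k\<bar> = D k * \<bar>B k i\<bar>" "D j * \<bar>B j k\<bar> = D k * \<bar>B k j\<bar>"
    using arg_cong[OF skew[OF assms(3,2)], of abs] arg_cong[OF skew[OF assms(4,2)], of abs] pos
    by (simp_all add: abs_mult)
  have two: "2 * bmut ex k B a c = 2 * B a c + (\<bar>B a k\<bar> * B k c + B a k * \<bar>B k c\<bar>)"
    if "a \<noteq> k" "c \<noteq> k" "c \<in> ex" for a c
    using half_abs_sum(1)[of "B a k" "B k c"] that by (simp add: bmut_def)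
  have ij: "i \<noteq> k" "j \<noteq> k" using False by auto
  have "2 * (D i * bmut ex k B i j) = D i * (2 * bmut ex k B i j)" by simp
  also have "\<dots> = 2 * (D i * B i j) + (D i * \<bar>B i k\<bar>) * B k j + (D i * B i k) * \<bar>B k j\<bar>"
    unfolding two[OF ij assms(4)] by (simp add: algebra_simps)
  also have "\<dots> = - (2 * (D j * B j i) + (D j * \<bar>B j k\<bar>) * B k i + (D j * B j k) * \<bar>B k i\<bar>)"
    unfolding abs skew[OF assms(3,2)] skew[OF assms(4,2)] skew[OF assms(3,4)] by (simp add: algebra_simps)
  also have "2 * (D j * B j i) + (D j * \<bar>B j k\<bar>) * B k i + (D j * B j k) * \<bar>B k i\<bar>
      = D j * (2 * bmut ex k B j i)"
    unfolding two[OF ij(2,1) assms(3)] by (simp add: algebra_simps)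
  also have "D j * (2 * bmut ex k B j i) = 2 * (D j * bmut ex k B j i)" by (rule mult.left_commute)
  finally show ?thesis by linarith
qed

text \<open>The identity E B' = B F, with E and F the elementary matrices of Berenstein and Zelevinsky.\<close>

lemma mutation_of_column:
  assumes "k \<in> ex" "j \<in> ex" "B k k = 0"
  shows "(col (bmut ex k B) j)(k := 0) + smul (bmut ex k B k j) (- unitv k - negp (col B k))
    = (if j = k then - col B k else col B j + smul (max 0 (B k j)) (col B k))"
proof (intro ext)
  fix i
  show "((col (bmut ex k B) j)(k := 0) + smul (bmut ex k B k j) (- unitv k - negp (col B k))) i
    = (if j = k then - col B k else col B j + smul (max 0 (B k j)) (col B k)) i"
    using assms by (cases "i = k"; cases "B i k \<ge> 0"; cases "B k j \<ge> 0")
      (auto simp: bmut_def half_abs_sum(2) negp_def unitv_def smul_apply max_def algebra_simps)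
qed

section \<open>The reverse exchange relation and powers of the new variable\<close>

context torus_mutation
begin

text \<open>This is \<open>x_M_k\<close> with the normalization of \<open>M'\<close>. The factors
  match because \<open>bilin L g g\<close> and \<open>bilin L h h\<close> vanish modulo
  \<open>l\<close>, and \<open>g\<close> and \<open>h\<close> pair equally with
  \<open>posp b\<close>.\<close>

lemma M_k_from_M': "M (unitv k) = M' (- unitv k + posp b) + M' (- unitv k - negp b)"
proof -
  have upd: "(- unitv k + posp b)(k := 0) = posp b" "(- unitv k - negp b)(k := 0) = - negp b"
    using b_k by (auto simp: posp_def negp_def unitv_def fun_eq_iff)
  have at_k: "(- unitv k + posp b) k = - 1" "(- unitv k - negp b) k = - 1"
    using b_k by (simp_all add: posp_def negp_def unitv_def)
  have p: "posp b = g + unitv k" and n: "- negp b = h + unitv k" by (simp_all add: g_def h_def)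
  have pk: "posp b k = 0" using b_k by (simp add: posp_def)
  have "int l dvd bilin L g g - (bilin L g (posp b) - bilin L h (posp b))"
    using bilin_self[OF M, of g] g_h_pairing[of "posp b", OF pk] by (rule dvd_diff)
  also have "bilin L g g - (bilin L g (posp b) - bilin L h (posp b)) = bilin L h (posp b) - bilin L g (unitv k)"
    by (simp add: p bilin_linear)
  finally have e1: "q (bilin L h (posp b)) = q (bilin L g (unitv k))" by (rule q_cong)
  have "int l dvd bilin L h (- negp b) - bilin L h (unitv k)"
    using bilin_self[OF M, of h] by (simp add: n bilin_linear)
  then have e2: "q (bilin L h (- negp b)) = q (bilin L h (unitv k))" by (rule q_cong)
  have "M' (- unitv k + posp b) = q (bilin L g (unitv k)) * (inverse x * M (posp b))"
    "M' (- unitv k - negp b) = q (bilin L h (unitv k)) * (inverse x * M (- negp b))"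
    unfolding M'_def upd at_k by (simp_all add: e1 e2)
  then show ?thesis
    by (subst x_M_k) (simp only: distrib_left q_move)
qed

text \<open>A word with \<open>r\<close> letters \<open>g\<close> and \<open>n - r\<close> letters
  \<open>h\<close> has exponent \<open>n h + r b\<close>. The values \<open>r = 0\<close> and
  \<open>r = n\<close> each come from one word and are the two monomials split off.\<close>

lemma x_power_expansion:
  assumes "n > 0"
  shows "x ^ n - M (smul (int n) g) - M (smul (int n) h)
    \<in> lspan M {f. \<exists>r. 0 < r \<and> r < int n \<and> f = smul (int n) h + smul r b}"
  using assms
proof (induction n rule: nat_induct_non_zero)
  case 1
  have "smul 1 f = f" for f :: "'n \<Rightarrow> int" by (simp add: smul_def)
  then show ?case by (simp add: x_def lspan.zero)
next
  case (Suc n)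
  let ?F = "\<lambda>n. {f. \<exists>r. 0 < r \<and> r < int n \<and> f = smul (int n) h + smul r b}"
  define w where "w = x ^ n - M (smul (int n) g) - M (smul (int n) h)"
  have Sg: "smul (int (Suc n)) f = f + smul (int n) f" for f :: "'n \<Rightarrow> int"
    by (simp add: fun_eq_iff smul_apply algebra_simps)
  have pow: "M (smul (int (Suc n)) f) = M f * M (smul (int n) f)" for f
    unfolding frame_power[OF M, symmetric] by simp
  have "x ^ Suc n = (M g + M h) * (M (smul (int n) g) + M (smul (int n) h) + w)"
    by (simp add: w_def flip: x_def)
  then have eq: "x ^ Suc n - M (smul (int (Suc n)) g) - M (smul (int (Suc n)) h)
      = M g * M (smul (int n) h) + M h * M (smul (int n) g) + M g * w + M h * w"
    by (simp only: pow) (simp add: algebra_simps)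
  have "g + smul (int n) h = smul (int (Suc n)) h + smul 1 b"
    by (simp add: g_h fun_eq_iff smul_apply algebra_simps)
  then have t1: "g + smul (int n) h \<in> ?F (Suc n)" using Suc(1) by force
  have "h + smul (int n) g = smul (int (Suc n)) h + smul (int n) b"
    by (simp add: g_h fun_eq_iff smul_apply algebra_simps)
  then have t2: "h + smul (int n) g \<in> ?F (Suc n)" using Suc(1) by force
  have t3: "g + f \<in> ?F (Suc n)" if f: "f \<in> ?F n" for f
  proof -
    obtain r where r: "0 < r" "r < int n" "f = smul (int n) h + smul r b" using f by blast
    then have "g + f = smul (int (Suc n)) h + smul (r + 1) b"
      by (simp add: g_h fun_eq_iff smul_apply algebra_simps)
    then show ?thesis using r by (intro CollectI exI[of _ "r + 1"]) simp
  qed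
  have t4: "h + f \<in> ?F (Suc n)" if f: "f \<in> ?F n" for f
  proof -
    obtain r where r: "0 < r" "r < int n" "f = smul (int n) h + smul r b" using f by blast
    then have "h + f = smul (int (Suc n)) h + smul r b"
      by (simp add: fun_eq_iff smul_apply algebra_simps)
    then show ?thesis using r by (intro CollectI exI[of _ r]) simp
  qed
  have w: "w \<in> lspan M (?F n)" using Suc.IH unfolding w_def .
  have single: "M f \<in> lspan M {f}" for f by (simp add: lspan_gen)
  have "M g * M (smul (int n) h) \<in> lspan M (?F (Suc n))"
    by (rule lspan_mult[OF M single single]) (use t1 in simp)
  moreover have "M h * M (smul (int n) g) \<in> lspan M (?F (Suc n))"
    by (rule lspan_mult[OF M single single]) (use t2 in simp)
  moreover have "M g * w \<in> lspan M (?F (Suc n))"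
    by (rule lspan_mult[OF M single w]) (use t3 in blast)
  moreover have "M h * w \<in> lspan M (?F (Suc n))"
    by (rule lspan_mult[OF M single w]) (use t4 in blast)
  ultimately show ?case unfolding eq by (intro lspan_add)
qed

end

text \<open>Conjugation by M v multiplies M f by the power 2 L(v, f) of zeta, so M f survives in w only if that power is 1.\<close>

lemma (in torus_scalars) lspan_centralizer:
  assumes M: "frame M L" and w: "w \<in> lspan M F" and comm: "M v * w = w * M v"
    and F: "\<And>f. f \<in> F \<Longrightarrow> \<not> int l dvd bilin L f v"
  shows "w = 0"
proof -
  obtain S c where S: "finite S" "S \<subseteq> F" "\<forall>f. c f \<in> A" "w = (\<Sum>f\<in>S. c f * M f)"
    using lspan_sumD[OF w] by blast
  have conj: "M v * (c f * M f) * M (- v) = c f * q (- (2 * bilin L f v)) * M f" for f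
  proof -
    have "q (2 * bilin L v f) = q (- (2 * bilin L f v))"
    proof (rule q_cong)
      have "int l dvd 2 * (bilin L v f + bilin L f v)"
        using bilin_skew[OF M, of v f] by (rule dvd_mult)
      then show "int l dvd 2 * bilin L v f - - (2 * bilin L f v)" by (simp add: algebra_simps)
    qed
    then have "M v * M f * M (- v) = q (- (2 * bilin L f v)) * M f"
      by (simp add: frame_comm[OF M, of v f] mult.assoc frame_inverse_mult[OF M])
    moreover have "M v * (c f * M f) * M (- v) = c f * (M v * M f * M (- v))"
      using A_move[of "c f" "M v"] S(3) by (simp add: mult.assoc)
    ultimately show ?thesis by (simp add: mult.assoc)
  qed
  have "w = M v * w * M (- v)" by (simp add: comm mult.assoc frame_inverse_mult[OF M])
  also have "\<dots> = (\<Sum>f\<in>S. c f * q (- (2 * bilin L f v)) * M f)"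
    unfolding S(4) by (simp add: sum_distrib_left sum_distrib_right conj)
  finally have "(\<Sum>f\<in>S. (c f * q (- (2 * bilin L f v)) - c f) * M f) = 0"
    unfolding S(4) by (simp add: left_diff_distrib sum_subtractf)
  then have "c f * q (- (2 * bilin L f v)) - c f = 0" if "f \<in> S" for f
    using that S by (intro independentD[OF frame_indep[OF M] S(1), of "\<lambda>f. c f * q (- (2 * bilin L f v)) - c f"])
      (auto intro!: mult_A q_A add_A uminus_A simp: diff_conv_add_uminus simp del: add_uminus_conv_diff)
  moreover have "q (- (2 * bilin L f v)) \<noteq> 1" if "f \<in> S" for f
  proof -
    have "\<not> int l dvd 2 * bilin L f v" using F S(2) that l_dvd_double by blast
    then show ?thesis by (simp add: q_one_iff)
  qed
  ultimately have "c f = 0" if "f \<in> S" for f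
    using that by (metis eq_iff_diff_eq_0 mult.right_neutral mult_cancel_left)
  then show ?thesis unfolding S(4) by simp
qed

text \<open>\<open>x ^ l\<close> is central as a monomial of the frame \<open>M'\<close>, so the
  mixed part commutes with \<open>M (unitv k)\<close>. Its exponents \<open>l h + r b\<close> pair
  with that unit vector to \<open>r d\<close> modulo \<open>l\<close>, nonzero for
  \<open>0 < r < l\<close> by coprimality.\<close>

lemma (in torus_mutation) x_power_l:
  assumes "coprime (int l) d"
  shows "x ^ l = M (smul (int l) g) + M (smul (int l) h)"
proof -
  define w where "w = x ^ l - M (smul (int l) g) - M (smul (int l) h)"
  have "w = 0"
  proof (rule lspan_centralizer[OF M])
    show "w \<in> lspan M {f. \<exists>r. 0 < r \<and> r < int l \<and> f = smul (int l) h + smul r b}"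
      unfolding w_def by (rule x_power_expansion[OF l_pos])
    have "x ^ l = M' (smul (int l) (unitv k))"
      using frame_power[OF frame_M', of "unitv k"] M'_k by simp
    then have "x ^ l * y = y * x ^ l" for y by (simp only: frame_center[OF frame_M'])
    then show "M (unitv k) * w = w * M (unitv k)"
      unfolding w_def by (simp add: left_diff_distrib right_diff_distrib frame_center[OF M])
    fix f assume "f \<in> {f. \<exists>r. 0 < r \<and> r < int l \<and> f = smul (int l) h + smul r b}"
    then obtain r where r: "0 < r" "r < int l" "f = smul (int l) h + smul r b" by blast
    have "int l dvd r * (bilin L b (unitv k) - d)"
      using pairing[of "unitv k"] by (simp add: unitv_def)
    moreover have "bilin L f (unitv k) - int l * bilin L h (unitv k) - r * (bilin L b (unitv k) - d) = r * d"
      by (simp add: r(3) bilin_linear algebra_simps)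
    ultimately have "int l dvd bilin L f (unitv k) \<Longrightarrow> int l dvd r * d"
      by (metis dvd_diff dvd_triv_left)
    moreover have "\<not> int l dvd r * d"
      using r assms by (simp add: coprime_dvd_mult_left_iff zdvd_not_zless)
    ultimately show "\<not> int l dvd bilin L f (unitv k)" by blast
  qed
  then show ?thesis by (simp add: w_def algebra_simps)
qed

section \<open>Seeds\<close>

text \<open>A single \<open>D\<close> serves all seeds, since mutation preserves compatibility with
  the same \<open>D\<close>.\<close>

locale seed_scalars = torus_scalars l A q bar for l and A :: "'a::division_ring set" and q bar +
  fixes ex :: "'n::finite set" and D :: "'n \<Rightarrow> int"
  assumes coprime_D: "\<And>k. k \<in> ex \<Longrightarrow> coprime (int l) (D k)"
begin

definition seed :: "(('n \<Rightarrow> int) \<Rightarrow> 'a) \<Rightarrow> ('n \<Rightarrow> 'n \<Rightarrow> int) \<Rightarrow> ('n \<Rightarrow> 'n \<Rightarrow> int) \<Rightarrow> bool" where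
  "seed M L B \<longleftrightarrow> frame M L \<and> exmat ex B \<and> compat_with l ex L B D"

definition exchange :: "(('n \<Rightarrow> int) \<Rightarrow> 'a) \<Rightarrow> ('n \<Rightarrow> int) \<Rightarrow> 'n \<Rightarrow> 'a" where
  "exchange M b k = M (- unitv k + posp b) + M (- unitv k - negp b)"

text \<open>The form of the new frame is left open: the values on unit vectors determine the frame,
  and commutators then determine the form modulo \<open>l\<close>. This makes symmetry in
  \<open>s\<close> and \<open>t\<close> easy to express.\<close>

definition mstep :: "'n \<Rightarrow> ('a, 'n) qseed \<Rightarrow> ('a, 'n) qseed \<Rightarrow> bool" where
  "mstep k s t \<longleftrightarrow> k \<in> ex \<and> (\<exists>L. seed (fst s) L (snd s)) \<and> (\<exists>L. seed (fst t) L (snd t)) \<and>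
     snd t = bmut ex k (snd s) \<and> (\<forall>j. j \<noteq> k \<longrightarrow> fst t (unitv j) = fst s (unitv j)) \<and>
     fst t (unitv k) = exchange (fst s) (col (snd s) k) k"

lemma seedD:
  assumes "seed M L B"
  shows "frame M L" "exmat ex B" "compat_with l ex L B D"
  using assms by (simp_all add: seed_def)

lemma mstepD:
  assumes "mstep k s t"
  shows "k \<in> ex" "\<exists>L. seed (fst s) L (snd s)" "\<exists>L. seed (fst t) L (snd t)" "snd t = bmut ex k (snd s)"
    "\<And>j. j \<noteq> k \<Longrightarrow> fst t (unitv j) = fst s (unitv j)" "fst t (unitv k) = exchange (fst s) (col (snd s) k) k"
  using assms unfolding mstep_def by blast+

lemma seed_torus_mutation:
  assumes "seed M L B" "k \<in> ex"
  shows "torus_mutation l A q bar M L k (col B k) (D k)"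
proof
  show "frame M L" using seedD[OF assms(1)] by blast
  show "B k k = 0" by (rule compat_with_diag[OF seedD(3)[OF assms(1)] assms(2)])
  show "int l dvd bilin L (col B k) y - D k * y k" for y
    by (rule compat_with_pairing[OF seedD(3)[OF assms(1)] assms(2)])
qed

text \<open>For compatibility put \<open>y = E e_i\<close>. By \<open>mutation_of_column\<close> the
  new column \<open>j \<noteq> k\<close> pairs with \<open>e_i\<close> as the old column
  \<open>j\<close> plus \<open>max 0 (B k j)\<close> times column \<open>k\<close> pairs with
  \<open>y\<close>. The result is the entry of \<open>D\<close>, except for two corrections at
  \<open>i = k\<close>, which cancel.\<close>

lemma seed_mutation:
  assumes S: "seed M L B" and k: "k \<in> ex"
  obtains M' where "seed M' (mut_form k B L) (bmut ex k B)"
    "\<And>j. j \<noteq> k \<Longrightarrow> M' (unitv j) = M (unitv j)" "M' (unitv k) = exchange M (col B k) k"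
proof -
  interpret T: torus_mutation l A q bar M L k "col B k" "D k"
    by (rule seed_torus_mutation[OF assms])
  note compat = seedD(3)[OF S]
  have form: "mut_form k B L = T.L'"
    unfolding T.L'_def T.h_def by (rule mut_form_bilin) (rule T.b_k)
  have compat': "compat_with l ex T.L' (bmut ex k B) D"
  proof (rule compat_with_intro)
    show "D j > 0" if "j \<in> ex" for j by (rule compat_with_pos[OF compat that])
    show "D i * bmut ex k B i j = - (D j * bmut ex k B j i)" if "i \<in> ex" "j \<in> ex" for i j
      by (rule bmut_skew[OF compat k that])
    fix i j assume j: "j \<in> ex"
    define y where "y = (unitv i)(k := 0) + smul (unitv i k) T.h"
    have bil: "bilin T.L' (col (bmut ex k B) j) (unitv i)
        = bilin L (if j = k then - col B k else col B j + smul (max 0 (B k j)) (col B k)) y"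
      unfolding T.bilin_L' y_def[symmetric] mutation_of_column[of k ex j B, OF k j T.b_k, symmetric]
      by (simp only: T.h_def)
    have yk: "y k = (if i = k then - 1 else 0)"
      by (simp add: y_def smul_apply T.h_k unitv_def)
    have yj: "y j = (if i = j then 1 else 0) + (if i = k then max 0 (- B j k) else 0)" if "j \<noteq> k"
      using that by (auto simp: y_def smul_apply T.h_def unitv_def negp_def)
    show "int l dvd bilin T.L' (col (bmut ex k B) j) (unitv i) - (if i = j then D j else 0)"
    proof (cases "j = k")
      case True
      have "int l dvd - (bilin L (col B k) y - D k * y k)" using T.pairing[of y] by (simp only: dvd_minus_iff)
      also have "- (bilin L (col B k) y - D k * y k)
          = bilin T.L' (col (bmut ex k B) j) (unitv i) - (if i = j then D j else 0)"
        unfolding bil by (simp add: True yk bilin_linear)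
      finally show ?thesis .
    next
      case False
      let ?m = "max 0 (B k j)"
      have "D k * B k j = - (D j * B j k)" by (rule compat_with_skew[OF compat k j])
      then have "max (D k * 0) (D k * B k j) = max (D j * 0) (D j * (- B j k))" by simp
      \<comment> \<open>This is the cancellation at \<open>i = k\<close>: there
        \<open>y k = - 1\<close> and \<open>y j = max 0 (- B j k)\<close>.\<close>
      then have sk: "D k * ?m = D j * max 0 (- B j k)"
        using compat_with_pos[OF compat k] compat_with_pos[OF compat j]
        by (simp add: max_mult_distrib_left)
      have "int l dvd (bilin L (col B j) y - D j * y j) + ?m * (bilin L (col B k) y - D k * y k)"
        using compat_with_pairing[OF compat j, of y] T.pairing[of y] by (intro dvd_add dvd_mult)
      also have "(bilin L (col B j) y - D j * y j) + ?m * (bilin L (col B k) y - D k * y k)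
          = bilin T.L' (col (bmut ex k B) j) (unitv i) - D j * y j - ?m * (D k * y k)"
        unfolding bil by (simp add: False bilin_linear right_diff_distrib)
      also have "D j * y j + ?m * (D k * y k) = (if i = j then D j else 0)"
        unfolding yj[OF False] yk using sk by (auto simp: algebra_simps)
      then have "bilin T.L' (col (bmut ex k B) j) (unitv i) - D j * y j - ?m * (D k * y k)
          = bilin T.L' (col (bmut ex k B) j) (unitv i) - (if i = j then D j else 0)" by linarith
      finally show ?thesis .
    qed
  qed
  show ?thesis
  proof (rule that)
    show "seed T.M' (mut_form k B L) (bmut ex k B)"
      unfolding seed_def form by (intro conjI T.frame_M' exmat_bmut compat')
    show "T.M' (unitv j) = M (unitv j)" if "j \<noteq> k" for j
      using that by (intro T.M'_rest) (simp add: unitv_def)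
    show "T.M' (unitv k) = exchange M (col B k) k"
      unfolding T.M'_k T.x_def exchange_def T.g_def T.h_def ..
  qed
qed

lemma mstep_exists:
  assumes "seed (fst s) L (snd s)" "k \<in> ex"
  obtains t where "mstep k s t"
proof -
  obtain M' where M': "seed M' (mut_form k (snd s) L) (bmut ex k (snd s))"
    "\<And>j. j \<noteq> k \<Longrightarrow> M' (unitv j) = fst s (unitv j)" "M' (unitv k) = exchange (fst s) (col (snd s) k) k"
    using seed_mutation[OF assms] by blast
  then have "mstep k s (M', bmut ex k (snd s))"
    unfolding mstep_def fst_conv snd_conv using assms by blast
  then show ?thesis by (rule that)
qed

lemma mstep_deterministic:
  assumes "mstep k s t" "mstep k s t'"
  shows "t = t'"
proof (rule prod_eqI)
  note t = mstepD[OF assms(1)] and t' = mstepD[OF assms(2)]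
  obtain L where "seed (fst t) L (snd t)" using t(3) by blast
  then have f: "frame (fst t) L" by (rule seedD)
  obtain L' where "seed (fst t') L' (snd t')" using t'(3) by blast
  then have f': "frame (fst t') L'" by (rule seedD)
  have "fst t (unitv j) = fst t' (unitv j)" for j
    using t(5,6) t'(5,6) by (cases "j = k") simp_all
  then show "fst t = fst t'" by (rule frames_eq[OF f f'])
  show "snd t = snd t'" using t(4) t'(4) by simp
qed

lemma mstep_M':
  assumes "mstep k s t" "seed (fst s) L (snd s)"
  shows "torus_mutation l A q bar (fst s) L k (col (snd s) k) (D k)"
    and "fst t = torus_mutation.M' q (fst s) L k (col (snd s) k)"
proof -
  note t = mstepD[OF assms(1)]
  show T: "torus_mutation l A q bar (fst s) L k (col (snd s) k) (D k)"
    by (rule seed_torus_mutation[OF assms(2) t(1)])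
  interpret T: torus_mutation l A q bar "fst s" L k "col (snd s) k" "D k" by (rule T)
  obtain L' where "seed (fst t) L' (snd t)" using t(3) by blast
  then have f: "frame (fst t) L'" by (rule seedD)
  show "fst t = T.M'"
  proof (rule frames_eq[OF f T.frame_M'])
    fix j
    show "fst t (unitv j) = T.M' (unitv j)"
    proof (cases "j = k")
      case True
      show ?thesis unfolding True T.M'_k T.x_def T.g_def T.h_def t(6) exchange_def ..
    next
      case False
      then have "unitv j k = (0::int)" by (simp add: unitv_def)
      from T.M'_rest[of "unitv j", OF this] show ?thesis using t(5)[OF False] by simp
    qed
  qed
qed

lemma mstep_sym:
  assumes "mstep k s t"
  shows "mstep k t s"
proof -
  note t = mstepD[OF assms]
  obtain L where L: "seed (fst s) L (snd s)" using t(2) by blast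
  interpret T: torus_mutation l A q bar "fst s" L k "col (snd s) k" "D k"
    by (rule mstep_M'[OF assms L])
  have eq: "fst t = T.M'" by (rule mstep_M'[OF assms L])
  have "fst s (unitv k) = exchange (fst t) (col (snd t) k) k"
    unfolding t(4) col_bmut[OF t(1)] exchange_def posp_uminus negp_uminus eq
    by (subst T.M_k_from_M') (simp add: add.commute)
  moreover have "snd s = bmut ex k (snd t)"
    unfolding t(4) by (rule bmut_bmut[OF seedD(2)[OF L] t(1), symmetric])
  moreover have "\<forall>j. j \<noteq> k \<longrightarrow> fst s (unitv j) = fst t (unitv j)"
    by (intro allI impI t(5)[symmetric])
  ultimately show ?thesis unfolding mstep_def using t(1-3) by blast
qed

lemma mstep_power:
  assumes "mstep k s t"
  shows "fst t (unitv k) ^ l = fst s (smul (int l) (- unitv k + posp (col (snd s) k)))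
    + fst s (smul (int l) (- unitv k - negp (col (snd s) k)))"
proof -
  note t = mstepD[OF assms]
  obtain L where L: "seed (fst s) L (snd s)" using t(2) by blast
  interpret T: torus_mutation l A q bar "fst s" L k "col (snd s) k" "D k"
    by (rule mstep_M'[OF assms L])
  have "fst t (unitv k) = T.x"
    unfolding t(6) exchange_def T.x_def T.g_def T.h_def ..
  then show ?thesis using T.x_power_l[OF coprime_D[OF t(1)]] unfolding T.g_def T.h_def by simp
qed

lemma mstep_agree:
  assumes "mstep k s t" "f k = 0"
  shows "fst t f = fst s f"
proof -
  obtain L where L: "seed (fst s) L (snd s)" using mstepD(2)[OF assms(1)] by blast
  interpret T: torus_mutation l A q bar "fst s" L k "col (snd s) k" "D k"
    by (rule mstep_M'[OF assms(1) L])
  show ?thesis unfolding mstep_M'(2)[OF assms(1) L] by (rule T.M'_rest) (rule assms(2))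
qed

lemma mstep_nonneg:
  assumes "mstep k s t" "f k \<ge> 0"
  shows "fst t f \<in> lspan (fst s) {e. e k = - f k}"
proof -
  obtain L where L: "seed (fst s) L (snd s)" using mstepD(2)[OF assms(1)] by blast
  interpret T: torus_mutation l A q bar "fst s" L k "col (snd s) k" "D k"
    by (rule mstep_M'[OF assms(1) L])
  obtain n where n: "f k = int n" using assms(2) nonneg_int_cases by blast
  have "fst s (f(k := 0)) \<in> lspan (fst s) {e. e k = 0}" by (rule lspan_gen) simp
  then have "T.x ^ n * fst s (f(k := 0)) \<in> lspan (fst s) {e. e k = - int n}"
    by (rule lspan_mult[OF T.M T.x_power_homogeneous]) simp
  then show ?thesis unfolding mstep_M'(2)[OF assms(1) L] T.M'_def n
    by (simp add: lspan_scale q_A)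
qed

end

section \<open>The Laurent phenomenon\<close>

context torus_scalars
begin

text \<open>The leading coefficient is a power of zeta, hence invertible in \<open>A\<close>, so the
  leading monomial can be divided out.\<close>

definition monic_top :: "(('n \<Rightarrow> int) \<Rightarrow> int) \<Rightarrow> (('n \<Rightarrow> int) \<Rightarrow> 'a) \<Rightarrow> 'a \<Rightarrow> bool" where
  "monic_top d M y \<longleftrightarrow> (\<exists>a f w. y = q a * M f + w \<and> w \<in> lspan M {e. d e < d f})"

lemma monic_top_lspan: "monic_top d M y \<Longrightarrow> y \<in> lspan M UNIV"
  unfolding monic_top_def using lspan_mono[OF _ subset_UNIV]
  by (auto intro!: lspan_add lspan_term q_A)

lemma monic_top_mult:
  assumes M: "frame M L" and d: "\<And>f g. d (f + g) = d f + d g"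
    and "monic_top d M x" "monic_top d M y"
  shows "monic_top d M (x * y)"
proof -
  obtain a f v where x: "x = q a * M f + v" "v \<in> lspan M {e. d e < d f}"
    using assms(3) unfolding monic_top_def by blast
  obtain b g w where y: "y = q b * M g + w" "w \<in> lspan M {e. d e < d g}"
    using assms(4) unfolding monic_top_def by blast
  have f: "q a * M f \<in> lspan M {f}" and g: "q b * M g \<in> lspan M {g}"
    by (simp_all add: lspan_term q_A)
  let ?w = "q a * M f * w + v * (q b * M g) + v * w"
  have "?w \<in> lspan M {e. d e < d (f + g)}"
    by (intro lspan_add lspan_mult[OF M f y(2)] lspan_mult[OF M x(2) g] lspan_mult[OF M x(2) y(2)])
       (auto simp: d)
  moreover have "q a * M f * (q b * M g) = q a * (q b * (M f * M g))"
    by (simp only: mult.assoc q_move[of "M f"])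
  then have "q a * M f * (q b * M g) = q (a + b + bilin L f g) * M (f + g)"
    by (simp only: frame_mult[OF M] q_mult_left add.assoc)
  then have "x * y = q (a + b + bilin L f g) * M (f + g) + ?w"
    unfolding x(1) y(1) by (simp only: distrib_left distrib_right add_ac)
  ultimately show ?thesis unfolding monic_top_def by blast
qed

lemma monic_top_power:
  assumes M: "frame M L" and d: "\<And>f g. d (f + g) = d f + d g" and "monic_top d M y"
  shows "monic_top d M (y ^ n)"
proof (induction n)
  case 0
  have "1 = q 0 * M 0 + 0" by (simp only: q_0 frame_0[OF M] mult_1 add_0_right)
  then show ?case unfolding monic_top_def power_0 using lspan.zero by blast
next
  case (Suc n)
  show ?case unfolding power_Suc by (rule monic_top_mult[OF M d assms(3) Suc])
qed

lemma homogeneous_power: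
  assumes M: "frame M L" and d: "\<And>f g. d (f + g) = d f + d g" and "y \<in> lspan M {f. d f = (c::int)}"
  shows "y ^ n \<in> lspan M {f. d f = int n * c}"
proof (induction n)
  case 0
  have "d 0 = 0" using d[of 0 0] by simp
  then show ?case using lspan_gen[of 0 "{f. d f = 0}" M] frame_0[OF M] by simp
next
  case (Suc n)
  have "y * y ^ n \<in> lspan M {f. d f = int (Suc n) * c}"
    by (rule lspan_mult[OF M assms(3) Suc]) (auto simp: d algebra_simps)
  then show ?case by simp
qed

lemma lspan_bounded:
  assumes "w \<in> lspan M F"
  shows "\<exists>lo n. w \<in> lspan M {f\<in>F. lo \<le> d f \<and> d f < lo + int n}"
proof -
  obtain S c where S: "finite S" "S \<subseteq> F" "\<forall>f. c f \<in> A" "w = (\<Sum>f\<in>S. c f * M f)"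
    using lspan_sumD[OF assms] by blast
  define N where "N = (\<Sum>f\<in>S. nat \<bar>d f\<bar>)"
  have N: "\<bar>d f\<bar> \<le> int N" if "f \<in> S" for f
  proof -
    have "nat \<bar>d f\<bar> \<le> N" unfolding N_def using S(1) that by (intro member_le_sum) auto
    then show ?thesis by linarith
  qed
  \<comment> \<open>Degrees between \<open>- int N\<close> and \<open>int N\<close> take
    \<open>2 * N + 1\<close> values, the length of the half-open interval.\<close>
  have "w \<in> lspan M {f\<in>F. - int N \<le> d f \<and> d f < - int N + int (2 * N + 1)}"
    unfolding S(4)
  proof (intro lspan_sum lspan_term)
    fix f assume f: "f \<in> S"
    show "c f \<in> A" using S(3) by blast
    have "- int N \<le> d f" "d f < - int N + int (2 * N + 1)" using N[OF f] by linarith+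
    then show "f \<in> {f\<in>F. - int N \<le> d f \<and> d f < - int N + int (2 * N + 1)}" using S(2) f by blast
  qed
  then show ?thesis by blast
qed

lemma lspan_empty: "w \<in> lspan M {} \<Longrightarrow> w = 0"
  by (induction w rule: lspan.induct) auto

text \<open>An element whose leading part is a unit monomial is regular modulo a homogeneous central element:
  compare leading parts and induct on the width of the support.\<close>

lemma monic_top_regular:
  assumes M: "frame M L" and d: "\<And>f g. d (f + g) = d f + d g"
    and u: "monic_top d M u"
    and V: "V \<in> lspan M {f. d f = c}" "\<And>y. V * y = y * V"
    and w: "w \<in> lspan M UNIV" "w' \<in> lspan M UNIV" "u * w = V * w'"
  shows "\<exists>v\<in>lspan M UNIV. w = V * v"
proof -
  obtain a f0 ul where u': "u = q a * M f0 + ul" "ul \<in> lspan M {e. d e < d f0}"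
    using u unfolding monic_top_def by blast
  have top: "q a * M f0 \<in> lspan M {f. d f = d f0}" by (rule lspan_term[OF q_A]) simp
  have uU: "u \<in> lspan M UNIV" by (rule monic_top_lspan[OF u])
  have main: "\<exists>v\<in>lspan M UNIV. w = V * v"
    if "w \<in> lspan M {f. lo \<le> d f \<and> d f < lo + int n}" "w' \<in> lspan M UNIV" "u * w = V * w'" for lo n w w'
    using that
  proof (induction n arbitrary: w w')
    case 0
    have "{f. lo \<le> d f \<and> d f < lo + int 0} = {}" by auto
    then have "w \<in> lspan M {}" using 0(1) by (simp only:)
    then have "w = 0" by (rule lspan_empty)
    then show ?case using lspan.zero by (intro bexI[of _ 0]) auto
  next
    case (Suc n)
    let ?t = "lo + int n"
    obtain wt wr where ws: "w = wt + wr"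
        "wt \<in> lspan M {f \<in> {f. lo \<le> d f \<and> d f < lo + int (Suc n)}. d f = ?t}"
        "wr \<in> lspan M {f \<in> {f. lo \<le> d f \<and> d f < lo + int (Suc n)}. \<not> d f = ?t}"
      by (rule lspan_split[OF Suc.prems(1)])
    have wt: "wt \<in> lspan M {f. d f = ?t}" by (rule lspan_mono[OF ws(2)]) auto
    have wr: "wr \<in> lspan M {f. lo \<le> d f \<and> d f < lo + int n}" by (rule lspan_mono[OF ws(3)]) auto
    have wr': "wr \<in> lspan M {f. d f < ?t}" by (rule lspan_mono[OF wr]) auto
    \<comment> \<open>\<open>V\<close> shifts degrees by \<open>c\<close>, so \<open>xt\<close> is
      the part of \<open>w'\<close> that meets the leading part of \<open>u * w\<close>.\<close>
    obtain xt xr where xs: "w' = xt + xr" "xt \<in> lspan M {f\<in>UNIV. d f = d f0 + ?t - c}"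
        "xr \<in> lspan M {f\<in>UNIV. \<not> d f = d f0 + ?t - c}"
      by (rule lspan_split[OF Suc.prems(2)])
    define Y where "Y = q a * M f0 * wr + ul * wt + ul * wr"
    have "q a * M f0 * wt \<in> lspan M {f. d f = d f0 + ?t}"
      by (rule lspan_mult[OF M top wt]) (auto simp: d)
    moreover have "V * xt \<in> lspan M {f. d f = d f0 + ?t}"
      by (rule lspan_mult[OF M V(1) xs(2)]) (auto simp: d)
    ultimately have in_top: "q a * M f0 * wt - V * xt \<in> lspan M {f. d f = d f0 + ?t}"
      by (rule lspan_diff)
    have "Y \<in> lspan M {f. d f \<noteq> d f0 + ?t}"
      unfolding Y_def
      by (intro lspan_add lspan_mult[OF M top wr'] lspan_mult[OF M u'(2) wt] lspan_mult[OF M u'(2) wr'])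
         (auto simp: d)
    moreover have "V * xr \<in> lspan M {f. d f \<noteq> d f0 + ?t}"
      by (rule lspan_mult[OF M V(1) xs(3)]) (auto simp: d)
    ultimately have "V * xr - Y \<in> lspan M {f. d f \<noteq> d f0 + ?t}" by (intro lspan_diff)
    moreover have "q a * M f0 * wt - V * xt = V * xr - Y"
    proof -
      have "q a * M f0 * wt + Y = u * w" unfolding u'(1) ws(1) Y_def by (simp only: distrib_left distrib_right) (simp only: ac_simps)
      also have "\<dots> = V * xt + V * xr" unfolding Suc.prems(3) xs(1) by (rule distrib_left)
      finally show ?thesis by (simp add: diff_eq_eq eq_diff_eq add.commute add_diff_eq)
    qed
    \<comment> \<open>One side lives in the top degree only, the other side avoids it, so both
      vanish.\<close>
    ultimately have "q a * M f0 * wt - V * xt = 0"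
      using lspan_disjoint[OF frame_indep[OF M] in_top] by auto
    then have qwt: "q a * (M f0 * wt) = V * xt" by (simp add: mult.assoc)
    define v0 where "v0 = q (- a) * (M (- f0) * xt)"
    have "wt = q (- a) * (q a * (M (- f0) * M f0 * wt))"
      by (simp add: q_mult_left frame_inverse_mult[OF M])
    also have "q a * (M (- f0) * M f0 * wt) = M (- f0) * (q a * (M f0 * wt))"
      by (simp only: mult.assoc q_move[of "M (- f0)"])
    also have "\<dots> = M (- f0) * V * xt" unfolding qwt by (rule mult.assoc[symmetric])
    also have "\<dots> = V * (M (- f0) * xt)" unfolding V(2)[of "M (- f0)", symmetric] by (rule mult.assoc)
    also have "q (- a) * (V * (M (- f0) * xt)) = V * v0" unfolding v0_def by (rule q_move[symmetric])
    finally have wtV: "wt = V * v0" .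
    have xtU: "xt \<in> lspan M UNIV" by (rule lspan_mono[OF xs(2) subset_UNIV])
    have v0: "v0 \<in> lspan M UNIV" unfolding v0_def
      by (rule lspan_scale[OF lspan_mult[OF M lspan_gen xtU] q_A]) auto
    have uv0: "u * v0 \<in> lspan M UNIV" by (rule lspan_mult[OF M uU v0]) auto
    \<comment> \<open>Since \<open>wt = V * v0\<close>, the remainder \<open>wr\<close> satisfies an
      equation of the same kind with \<open>w' - u * v0\<close>, and its support is narrower by one
      degree.\<close>
    have "u * wr = u * w - u * (V * v0)" unfolding ws(1) wtV by (simp add: distrib_left)
    also have "u * (V * v0) = V * (u * v0)" by (simp only: mult.assoc[symmetric] V(2)[of u])
    also have "u * w - V * (u * v0) = V * (w' - u * v0)" unfolding Suc.prems(3) by (rule right_diff_distrib[symmetric])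
    finally obtain v1 where "v1 \<in> lspan M UNIV" "wr = V * v1"
      using Suc.IH[OF wr lspan_diff[OF Suc.prems(2) uv0]] by blast
    then show ?case using v0 unfolding ws(1) wtV
      by (intro bexI[of _ "v0 + v1"] lspan_add) (simp_all add: distrib_left)
  qed
  obtain lo n where "w \<in> lspan M {f\<in>UNIV. lo \<le> d f \<and> d f < lo + int n}"
    using lspan_bounded[OF w(1)] by blast
  then show ?thesis using main[of w lo n w'] w(2,3) by simp
qed

text \<open>In the grading by the entry at \<open>i\<close>, every word except the one using
  \<open>u\<close> alone contains \<open>v\<close> and so has positive degree.\<close>

lemma power_sum_leading:
  assumes M: "frame M L" and u: "u i = 0" and v: "v i \<ge> 1"
  shows "(M u + M v) ^ n - M (smul (int n) u) \<in> lspan M {e. e i \<ge> 1}"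
proof (induction n)
  case 0
  have "smul (int 0) u = 0" by (simp add: fun_eq_iff smul_apply)
  then have "M (smul (int 0) u) = 1" using frame_0[OF M] by metis
  then show ?case by (simp only: power_0 diff_self lspan.zero)
next
  case (Suc n)
  define w where "w = (M u + M v) ^ n - M (smul (int n) u)"
  have w: "w \<in> lspan M {e. e i \<ge> 1}" unfolding w_def by (rule Suc)
  have "(M u + M v) ^ Suc n = (M u + M v) * (M (smul (int n) u) + w)"
    by (simp add: w_def)
  also have "\<dots> = M u * M (smul (int n) u) + (M v * M (smul (int n) u) + (M u + M v) * w)"
    by (simp only: distrib_left distrib_right ac_simps)
  also have "M u * M (smul (int n) u) = M (smul (int (Suc n)) u)"
    unfolding frame_power[OF M, symmetric] by simp
  finally have eq: "(M u + M v) ^ Suc n - M (smul (int (Suc n)) u)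
      = M v * M (smul (int n) u) + (M u + M v) * w" by simp
  have nu: "M (smul (int n) u) \<in> lspan M {e. e i \<ge> 0}"
    by (rule lspan_gen) (simp add: smul_apply u)
  have v': "M v \<in> lspan M {e. e i \<ge> 1}" by (rule lspan_gen) (simp add: v)
  have uv: "M u + M v \<in> lspan M {e. e i \<ge> 0}" by (intro lspan_add lspan_gen) (use u v in auto)
  show ?case unfolding eq
    by (intro lspan_add lspan_mult[OF M v' nu] lspan_mult[OF M uv w]) auto
qed

end

text \<open>\<open>u\<close> is whichever of \<open>g\<close> and \<open>h\<close> has no component
  at \<open>i\<close>. Replacing \<open>x\<close> by \<open>M u\<close> loses only terms of larger
  degree at \<open>i\<close>, and the normalizing factor of \<open>M'\<close> is absorbed because
  \<open>u\<close> and \<open>h\<close> pair equally with \<open>f(k := 0)\<close>.\<close>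

lemma (in torus_mutation) M'_leading:
  assumes u: "u = g \<and> v = h \<or> u = h \<and> v = g" and ui: "u i = 0" "v i \<ge> 1" and i: "i \<noteq> k" and fk: "f k \<ge> 0"
  shows "M' f - M (smul (f k) u + f(k := 0)) \<in> lspan M {e. e i \<ge> f i + 1}"
proof -
  obtain n where n: "f k = int n" using fk nonneg_int_cases by blast
  let ?r = "f(k := 0)"
  have x: "x = M u + M v" using u by (auto simp: x_def add.commute)
  define w where "w = x ^ n - M (smul (int n) u)"
  have w: "w \<in> lspan M {e. e i \<ge> 1}"
    unfolding w_def x by (rule power_sum_leading[of M L u i v, OF M ui])
  have r0: "?r k = 0" by simp
  have "int l dvd bilin L u ?r - bilin L h ?r"
    using u g_h_pairing[of ?r, OF r0] by auto
  then have "int l dvd int n * (bilin L u ?r - bilin L h ?r)" by (rule dvd_mult)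
  then have eq: "q (- int n * bilin L h ?r) * q (int n * bilin L u ?r) = 1"
    by (simp add: q_one_iff algebra_simps flip: q_add)
  have "M' f = q (- int n * bilin L h ?r) * ((M (smul (int n) u) + w) * M ?r)"
    by (simp add: M'_def n w_def)
  also have "\<dots> = q (- int n * bilin L h ?r) * (M (smul (int n) u) * M ?r) + q (- int n * bilin L h ?r) * (w * M ?r)"
    by (simp only: distrib_left distrib_right)
  also have "q (- int n * bilin L h ?r) * (M (smul (int n) u) * M ?r) = M (smul (int n) u + ?r)"
    unfolding frame_mult[OF M] bilin_smul_left mult.assoc[symmetric] eq by simp
  finally have eq': "M' f - M (smul (f k) u + ?r) = q (- int n * bilin L h ?r) * (w * M ?r)"
    unfolding n by (simp only: add_diff_cancel_left')
  have "M ?r \<in> lspan M {e. e i = f i}" by (rule lspan_gen) (use i in simp)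
  then have "w * M ?r \<in> lspan M {e. e i \<ge> f i + 1}" by (rule lspan_mult[OF M w]) auto
  then show ?thesis unfolding eq' by (rule lspan_scale[OF _ q_A])
qed

section \<open>Leading terms after mutations in directions i, j, i\<close>

context seed_scalars
begin

text \<open>If all minors vanish, then \<open>B a i\<close> times the pairing of column
  \<open>j\<close> with \<open>e_j\<close> equals \<open>B a j\<close> times that of column
  \<open>i\<close> with \<open>e_j\<close>. Modulo \<open>l\<close> these are
  \<open>B a i * D j\<close> and 0. Hence column \<open>i\<close> vanishes modulo \<open>l\<close>,
  against its pairing \<open>D i\<close> with \<open>e_i\<close>.\<close>

lemma columns_independent:
  assumes "l > 1" and S: "seed M L B" and ij: "i \<in> ex" "j \<in> ex" "i \<noteq> j"
  obtains a c where "B a i * B c j \<noteq> B c i * B a j"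
proof -
  have pair: "int l dvd bilin L (col B k) y - D k * y k" if "k \<in> ex" for k y
    by (rule compat_with_pairing[OF seedD(3)[OF S] that])
  have "\<exists>a c. B a i * B c j \<noteq> B c i * B a j"
  proof (rule ccontr)
    assume "\<not> (\<exists>a c. B a i * B c j \<noteq> B c i * B a j)"
    then have minors: "B a i * B c j = B c i * B a j" for a c by blast
    have dvd: "int l dvd B a i" for a
    proof -
      have "B a i * bilin L (col B j) (unitv j) = (\<Sum>c\<in>UNIV. B a i * B c j * L c j)"
        by (simp add: bilin_unitv_right sum_distrib_left mult.assoc)
      also have "\<dots> = (\<Sum>c\<in>UNIV. B a j * (B c i * L c j))"
        by (rule sum.cong, rule refl, subst minors, simp)
      also have "\<dots> = B a j * bilin L (col B i) (unitv j)"
        by (simp add: bilin_unitv_right sum_distrib_left)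
      finally have eq: "B a i * D j = B a j * (bilin L (col B i) (unitv j) - D i * unitv j i)
          - B a i * (bilin L (col B j) (unitv j) - D j * unitv j j)"
        using ij(3) by (simp add: unitv_def right_diff_distrib)
      have "int l dvd B a i * D j"
        unfolding eq by (intro dvd_diff dvd_mult pair ij)
      then show ?thesis using coprime_D[OF ij(2)] by (simp add: coprime_dvd_mult_left_iff)
    qed
    have "int l dvd bilin L (col B i) (unitv i)"
      unfolding bilin_unitv_right by (intro dvd_sum dvd_mult2 dvd)
    moreover have "int l dvd bilin L (col B i) (unitv i) - D i"
      using pair[OF ij(1), of "unitv i"] by (simp add: unitv_def)
    ultimately have "int l dvd D i" by (metis dvd_diff_right_iff)
    with coprime_D[OF ij(1)] have "is_unit (int l)" by (metis coprime_common_divisor dvd_refl)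
    then show False using assms(1) by simp
  qed
  then show ?thesis using that by blast
qed

lemma mstep_frames:
  assumes "mstep k s t"
  obtains L L' where "frame (fst s) L" "frame (fst t) L'"
  using mstepD(2,3)[OF assms] seedD(1) by blast

lemma exchange_lspan: "exchange M b k \<in> lspan M UNIV"
  unfolding exchange_def by (intro lspan_add lspan_gen) auto

lemma mstep_unitv_lspan: "mstep k s t \<Longrightarrow> fst t (unitv j) \<in> lspan (fst s) UNIV"
  using mstepD(5,6)[of k s t] exchange_lspan lspan_gen[of "unitv j" UNIV "fst s"] by (cases "j = k") auto

lemma monic_top_monomial: "monic_top d M (M f)"
  unfolding monic_top_def using lspan.zero by (intro exI[of _ 0] exI[of _ f]) auto

lemma monic_top_two:
  assumes "d u \<noteq> d v"
  shows "monic_top d M (M u + M v)"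
proof (cases "d v < d u")
  case True
  then have "M v \<in> lspan M {e. d e < d u}" by (intro lspan_gen) simp
  then show ?thesis unfolding monic_top_def
    by (intro exI[of _ 0] exI[of _ u] exI[of _ "M v"]) simp
next
  case False
  then have "M u \<in> lspan M {e. d e < d v}" using assms by (intro lspan_gen) simp
  then show ?thesis unfolding monic_top_def
    by (intro exI[of _ 0] exI[of _ v] exI[of _ "M u"]) (simp add: add.commute)
qed

lemma mstep_nonneg_lspan:
  assumes "mstep k s t" "w \<in> lspan (fst t) {e. e k \<ge> c}" "c \<ge> 0"
  shows "w \<in> lspan (fst s) {e. e k \<le> - c}"
  using assms(2)
proof (induction w rule: lspan.induct)
  case (step y a f)
  then have "f k \<ge> c" by simp
  then have "fst t f \<in> lspan (fst s) {e. e k = - f k}" using assms(3) by (intro mstep_nonneg[OF assms(1)]) simp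
  then have "fst t f \<in> lspan (fst s) {e. e k \<le> - c}"
    by (rule lspan_mono) (use \<open>f k \<ge> c\<close> in auto)
  then show ?case using step by (intro lspan_add lspan_scale)
qed (rule lspan.zero)

text \<open>Of the two monomials of the variable x_i of s3, exactly one involves x_j. Replacing x_j there by its monomial
  without x_i gives, together with the other one, a multiple of the exchange relation between s0 and s1.\<close>

lemma bmut_column_exponents:
  assumes "i \<in> ex" "j \<in> ex" "i \<noteq> j" "B i i = 0" "B j j = 0"
  defines "b \<equiv> col B i" and "c \<equiv> col B j" and "b' \<equiv> col (bmut ex j B) i"
  shows "B j i > 0 \<Longrightarrow> smul (B j i) (- unitv j + posp c) + (- unitv i - negp b')(j := 0)
      = (posp b' - posp b) + (- unitv i - negp b)"
    and "B j i < 0 \<Longrightarrow> smul (- B j i) (- unitv j - negp c) + (- unitv i + posp b')(j := 0)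
      = (negp b - negp b') + (- unitv i + posp b)"
proof -
  have b': "b' a = (if a = j then - B j i else B a i + (max 0 (B a j) * max 0 (B j i) - max 0 (- B a j) * max 0 (- B j i)))" for a
    using assms(1,3) unfolding b'_def bmut_def half_abs_sum(2) by auto
  show "smul (B j i) (- unitv j + posp c) + (- unitv i - negp b')(j := 0)
      = (posp b' - posp b) + (- unitv i - negp b)" if "B j i > 0"
  proof
    fix a
    have sum: "posp b' a + negp b' a = b' a" "posp b a + negp b a = b a" by (auto simp: posp_def negp_def)
    show "(smul (B j i) (- unitv j + posp c) + (- unitv i - negp b')(j := 0)) a
      = ((posp b' - posp b) + (- unitv i - negp b)) a"
    proof (cases "a = j")
      case True
      have "posp b' j = 0" using that by (simp add: posp_def b')
      then show ?thesis using True sum assms(3,5) by (simp add: smul_apply unitv_def c_def posp_def b_def)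
    next
      case False
      have "b' a = b a + B j i * posp c a" using False that by (simp add: b' b_def c_def posp_def max_def)
      then show ?thesis using False sum by (simp add: smul_apply unitv_def)
    qed
  qed
  show "smul (- B j i) (- unitv j - negp c) + (- unitv i + posp b')(j := 0)
      = (negp b - negp b') + (- unitv i + posp b)" if "B j i < 0"
  proof
    fix a
    have sum: "posp b' a + negp b' a = b' a" "posp b a + negp b a = b a" by (auto simp: posp_def negp_def)
    show "(smul (- B j i) (- unitv j - negp c) + (- unitv i + posp b')(j := 0)) a
      = ((negp b - negp b') + (- unitv i + posp b)) a"
    proof (cases "a = j")
      case True
      have "negp b' j = 0" using that by (simp add: negp_def b')
      then show ?thesis using True sum assms(3,5) by (simp add: smul_apply unitv_def c_def negp_def b_def)
    next
      case False
      have "b' a = b a - B j i * negp c a" using False that by (simp add: b' b_def c_def negp_def max_def)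
      then show ?thesis using False sum by (simp add: smul_apply unitv_def)
    qed
  qed
qed

context
  fixes i j s0 s1 s2 s3
  assumes ij: "i \<noteq> j" and st1: "mstep i s0 s1" and st2: "mstep j s1 s2" and st3: "mstep i s2 s3"
begin

text \<open>Here the two directions do not interact: the variable x_i of \<open>s3\<close> is that
  of \<open>s0\<close>, and x_j of \<open>s3\<close> is a sum of two monomials in \<open>s0\<close>.
  The grading is a minor against column \<open>i\<close>: it annihilates that column but not column
  \<open>j\<close>, by which those two monomials differ.\<close>

lemma tops_if_zero:
  assumes "l > 1" and B0: "snd s1 j i = 0"
  shows "\<exists>d. (\<forall>f g. d (f + g) = d f + d g) \<and> d (col (snd s1) i) = 0 \<and>
    monic_top d (fst s0) (fst s3 (unitv i)) \<and> monic_top d (fst s0) (fst s3 (unitv j))"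
proof -
  let ?B = "snd s1"
  note iex = mstepD(1)[OF st1] and jex = mstepD(1)[OF st2]
  obtain L1 where S1: "seed (fst s1) L1 ?B" using mstepD(3)[OF st1] by blast
  note compat = seedD(3)[OF S1]
  have Bij: "?B i j = 0"
    using compat_with_skew[OF compat jex iex] compat_with_pos[OF compat iex] B0 by simp
  obtain a c where ac: "?B a i * ?B c j \<noteq> ?B c i * ?B a j"
    by (rule columns_independent[OF assms(1) S1 iex jex ij])
  define d where "d f = ?B a i * f c - ?B c i * f a" for f
  have Bii: "?B i i = 0" and Bjj: "?B j j = 0" using compat_with_diag[OF compat] iex jex by auto
  define g h where "g = - unitv j + posp (col ?B j)" and "h = - unitv j - negp (col ?B j)"
  have gh: "g = h + col ?B j" using posp_negp[of "col ?B j"] by (simp add: g_def h_def algebra_simps)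
  have "d g - d h = d (col ?B j)" unfolding gh by (simp add: d_def algebra_simps)
  then have dgh: "d g \<noteq> d h" using ac by (simp add: d_def)
  have gi: "g i = 0" "h i = 0" using Bij ij by (simp_all add: g_def h_def unitv_def posp_def negp_def)
  have "fst s3 (unitv j) = fst s1 g + fst s1 h"
    using mstepD(5)[OF st3, of j] ij mstepD(6)[OF st2] by (simp add: exchange_def g_def h_def)
  also have "\<dots> = fst s0 g + fst s0 h" unfolding mstep_agree[of i s0 s1 g, OF st1 gi(1)] mstep_agree[of i s0 s1 h, OF st1 gi(2)] ..
  finally have top_j: "monic_top d (fst s0) (fst s3 (unitv j))"
    using monic_top_two[of d g h "fst s0", OF dgh] by simp
  have "col (snd s2) i = col ?B i"
    unfolding mstepD(4)[OF st2] using B0 iex ij by (auto simp: bmut_def)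
  then have "fst s3 (unitv i) = exchange (fst s2) (col ?B i) i"
    using mstepD(6)[OF st3] by simp
  also have "\<dots> = exchange (fst s1) (col ?B i) i"
  proof -
    have "(- unitv i + posp (col ?B i)) j = 0" "(- unitv i - negp (col ?B i)) j = 0"
      using B0 ij by (simp_all add: unitv_def posp_def negp_def)
    note z = this
    show ?thesis unfolding exchange_def mstep_agree[of j s1 s2 "- unitv i + posp (col ?B i)", OF st2 z(1)] mstep_agree[of j s1 s2 "- unitv i - negp (col ?B i)", OF st2 z(2)] ..
  qed
  also have "\<dots> = fst s0 (unitv i)" using mstepD(6)[OF mstep_sym[OF st1]] by simp
  finally have top_i: "monic_top d (fst s0) (fst s3 (unitv i))" by (simp add: monic_top_monomial)
  show ?thesis
    by (rule exI[of _ d]) (use top_i top_j in \<open>simp add: d_def algebra_simps\<close>)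
qed

text \<open>In the variable x_i of s3, the terms with a negative power of the variable x_i of s1 add up to a monomial
  times the variable x_i of s0; all other terms have smaller degree.\<close>

lemma tops_if_nonzero:
  assumes nz: "snd s1 j i \<noteq> 0"
  shows "monic_top (\<lambda>f. f i) (fst s0) (fst s3 (unitv i)) \<and> monic_top (\<lambda>f. f i) (fst s0) (fst s3 (unitv j))"
proof -
  let ?B = "snd s1" and ?B' = "snd s2" and ?d = "\<lambda>f :: 'n \<Rightarrow> int. f i"
  note iex = mstepD(1)[OF st1] and jex = mstepD(1)[OF st2]
  obtain L0 L1' where F0: "frame (fst s0) L0" by (rule mstep_frames[OF st1])
  obtain L1 where S1: "seed (fst s1) L1 ?B" using mstepD(3)[OF st1] by blast
  note compat = seedD(3)[OF S1] and F1 = seedD(1)[OF S1]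
  have Bii: "?B i i = 0" and Bjj: "?B j j = 0" using compat_with_diag[OF compat] iex jex by auto
  have skew: "D i * ?B i j = - (D j * ?B j i)" by (rule compat_with_skew[OF compat iex jex])
  note pos = compat_with_pos[OF compat iex] compat_with_pos[OF compat jex]
  have "sgn (D i * ?B i j) = sgn (- (D j * ?B j i))" by (simp only: skew)
  then have sgn: "sgn (?B i j) = - sgn (?B j i)" using pos by (simp add: sgn_mult)
  then have opp: "?B j i > 0 \<longleftrightarrow> ?B i j < 0" "?B j i < 0 \<longleftrightarrow> ?B i j > 0"
    by (auto simp: sgn_if split: if_splits)
  interpret T: torus_mutation l A q bar "fst s1" L1 j "col ?B j" "D j"
    by (rule mstep_M'[OF st2 S1])
  have M2: "fst s2 = T.M'" by (rule mstep_M'[OF st2 S1])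
  have s2j: "?B' j i = - ?B j i" unfolding mstepD(4)[OF st2] using iex by (simp add: bmut_def)
  \<comment> \<open>The entries \<open>B j i\<close> and \<open>B i j\<close> have opposite signs,
    so the sign of \<open>B j i\<close> tells which monomial of the exchange relation for x_j is
    free of x_i; this one is \<open>u\<close>.\<close>
  define u v where "u = (if ?B j i > 0 then T.g else T.h)" and "v = (if ?B j i > 0 then T.h else T.g)"
  have uv: "u = T.g \<and> v = T.h \<or> u = T.h \<and> v = T.g" by (simp add: u_def v_def)
  have ui: "u i = 0" and vi: "v i \<ge> 1"
    using opp nz ij unfolding u_def v_def T.g_def T.h_def by (auto simp: unitv_def posp_def negp_def)
  \<comment> \<open>The variable x_i of \<open>s1\<close> is homogeneous of degree -1 in x_i of
    \<open>s0\<close>, so nonnegative powers turn lower bounds on degrees into upper bounds.\<close>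
  have low: "w \<in> lspan (fst s0) {e. e i \<le> - c}" if "w \<in> lspan (fst s1) {e. e i \<ge> c}" "c \<ge> 0" for w c
    by (rule mstep_nonneg_lspan[OF st1 that])
  have "fst s3 (unitv j) = fst s1 T.g + fst s1 T.h"
    using mstepD(5)[OF st3, of j] ij mstepD(6)[OF st2] by (simp add: exchange_def T.g_def T.h_def)
  then have "fst s3 (unitv j) = fst s1 u + fst s1 v" using uv by (auto simp: add.commute)
  also have "fst s1 u = fst s0 u" by (rule mstep_agree[of i s0 s1 u, OF st1 ui])
  finally have s3j: "fst s3 (unitv j) = fst s0 u + fst s1 v" .
  have "fst s1 v \<in> lspan (fst s1) {e. e i \<ge> 1}" by (rule lspan_gen) (simp add: vi)
  then have "fst s1 v \<in> lspan (fst s0) {e. e i \<le> - 1}" by (rule low) simp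
  then have "fst s1 v \<in> lspan (fst s0) {e. e i < u i}" by (rule lspan_mono) (use ui in auto)
  then have top_j: "monic_top ?d (fst s0) (fst s3 (unitv j))"
    unfolding monic_top_def s3j by (intro exI[of _ 0] exI[of _ u] exI[of _ "fst s1 v"]) simp
  define b b' where "b = col ?B i" and "b' = col ?B' i"
  have b'_eq: "b' = col (bmut ex j ?B) i" unfolding b'_def mstepD(4)[OF st2] ..
  have bi: "b i = 0" by (simp add: b_def Bii)
  have b'i: "b' i = 0"
    using compat_with_diag[of l ex _ ?B' D i] iex mstepD(2)[OF st3] seedD(3) unfolding b'_def by blast
  define p1 p2 where "p1 = - unitv i + posp b" and "p2 = - unitv i - negp b"
  define r1 r2 where "r1 = - unitv i + posp b'" and "r2 = - unitv i - negp b'"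
  have r_i: "r1 i = - 1" "r2 i = - 1" using b'i by (simp_all add: r1_def r2_def unitv_def posp_def negp_def)
  have x0: "fst s0 (unitv i) = fst s1 p1 + fst s1 p2"
    using mstepD(6)[OF mstep_sym[OF st1]] by (simp add: exchange_def p1_def p2_def b_def)
  have s3i: "fst s3 (unitv i) = fst s2 r1 + fst s2 r2"
    using mstepD(6)[OF st3] by (simp add: exchange_def r1_def r2_def b'_def)
  have lead: "T.M' f - fst s1 (smul (f j) u + f(j := 0)) \<in> lspan (fst s1) {e. e i \<ge> 0}"
    if "f i = - 1" "f j \<ge> 0" for f
    using T.M'_leading[of u v i f, OF uv ui vi ij that(2)] that(1) by simp
  have ex_w: "\<exists>w. w i = 0 \<and> fst s3 (unitv i) - (fst s1 (w + p1) + fst s1 (w + p2)) \<in> lspan (fst s1) {e. e i \<ge> 0}"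
  proof (cases "?B j i > 0")
    case True
    \<comment> \<open>With this shift \<open>r1\<close> is exactly \<open>w + p1\<close>, and
      replacing x_j by \<open>u\<close> in \<open>r2\<close> yields \<open>w + p2\<close>. In the
      case of negative sign the two exponents exchange their roles.\<close>
    define w where "w = posp b' - posp b"
    have w1: "r1 = w + p1" by (simp add: w_def r1_def p1_def)
    have r2j: "r2 j = ?B j i" using True ij s2j by (simp add: r2_def unitv_def negp_def b'_def)
    have "smul (r2 j) u + r2(j := 0) = w + p2"
      unfolding r2j unfolding r2_def w_def p2_def b'_eq b_def u_def if_P[OF True] T.g_def
      by (rule bmut_column_exponents(1)[OF iex jex ij Bii Bjj True])
    then have "T.M' r2 - fst s1 (w + p2) \<in> lspan (fst s1) {e. e i \<ge> 0}"
      using lead[of r2, OF r_i(2)] r2j True by simp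
    moreover have "r1 j = 0" using True ij s2j by (simp add: r1_def unitv_def posp_def b'_def)
    then have "T.M' r1 = fst s1 (w + p1)" unfolding w1 by (rule T.M'_rest)
    then have "fst s3 (unitv i) - (fst s1 (w + p1) + fst s1 (w + p2)) = T.M' r2 - fst s1 (w + p2)"
      unfolding s3i M2 by simp
    moreover have "w i = 0" using bi b'i by (simp add: w_def posp_def)
    ultimately show ?thesis by (intro exI[of _ w]) (simp only: simp_thms)
  next
    case False
    then have neg: "?B j i < 0" using nz by simp
    define w where "w = negp b - negp b'"
    have w2: "r2 = w + p2" by (simp add: w_def r2_def p2_def)
    have r1j: "r1 j = - ?B j i" using neg ij s2j by (simp add: r1_def unitv_def posp_def b'_def)
    have "smul (r1 j) u + r1(j := 0) = w + p1"
      unfolding r1j unfolding r1_def w_def p1_def b'_eq b_def u_def if_not_P[OF False] T.h_def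
      by (rule bmut_column_exponents(2)[OF iex jex ij Bii Bjj neg])
    then have "T.M' r1 - fst s1 (w + p1) \<in> lspan (fst s1) {e. e i \<ge> 0}"
      using lead[of r1, OF r_i(1)] r1j neg by simp
    moreover have "r2 j = 0" using neg ij s2j by (simp add: r2_def unitv_def negp_def b'_def)
    then have "T.M' r2 = fst s1 (w + p2)" unfolding w2 by (rule T.M'_rest)
    then have "fst s3 (unitv i) - (fst s1 (w + p1) + fst s1 (w + p2)) = T.M' r1 - fst s1 (w + p1)"
      unfolding s3i M2 by (simp add: algebra_simps)
    moreover have "w i = 0" using bi b'i by (simp add: w_def negp_def)
    ultimately show ?thesis by (intro exI[of _ w]) (simp only: simp_thms)
  qed
  then obtain w where w: "w i = 0"
    "fst s3 (unitv i) - (fst s1 (w + p1) + fst s1 (w + p2)) \<in> lspan (fst s1) {e. e i \<ge> 0}" by blast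
  define R where "R = fst s3 (unitv i) - (fst s1 (w + p1) + fst s1 (w + p2))"
  \<comment> \<open>As \<open>w\<close> has no component at \<open>i\<close>, it pairs trivially
    with \<open>b\<close>, the difference of \<open>p1\<close> and \<open>p2\<close>. One common
    factor then leaves both monomials, and what remains is the exchange relation for x_i of
    \<open>s0\<close>.\<close>
  have "int l dvd bilin L1 b w - D i * w i"
    unfolding b_def by (rule compat_with_pairing[OF compat iex])
  then have bw: "int l dvd bilin L1 b w" using w(1) by simp
  have "p1 = p2 + b" using posp_negp[of b] by (simp add: p1_def p2_def algebra_simps)
  then have "bilin L1 w p1 - bilin L1 w p2 = bilin L1 w b" by (simp add: bilin_linear)
  moreover have "int l dvd bilin L1 w b"
    using bilin_skew'[OF F1, of w b] bw by (metis dvd_minus_iff dvd_diff_right_iff dvd_diff_left_iff)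
  ultimately have qq: "q (- bilin L1 w p1) = q (- bilin L1 w p2)"
    by (intro q_cong) (simp add: dvd_diff_commute)
  have add: "fst s1 (w + p) = q (- bilin L1 w p) * (fst s1 w * fst s1 p)" for p
    by (simp add: frame_mult[OF F1] q_mult_left)
  have "fst s1 (w + p1) + fst s1 (w + p2) = q (- bilin L1 w p1) * (fst s1 w * fst s0 (unitv i))"
    unfolding add x0 qq by (simp only: distrib_left)
  also have "fst s1 w = fst s0 w" by (rule mstep_agree[of i s0 s1 w, OF st1 w(1)])
  finally have lead0: "fst s1 (w + p1) + fst s1 (w + p2)
      = q (- bilin L1 w p1 + bilin L0 w (unitv i)) * fst s0 (w + unitv i)"
    by (simp only: frame_mult[OF F0] q_mult_left)
  \<comment> \<open>The remainder has degree at most 0 in x_i of \<open>s0\<close>, below the degree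
    1 of \<open>w + unitv i\<close>.\<close>
  have "R \<in> lspan (fst s0) {e. e i \<le> - 0}" by (rule low) (use w(2) in \<open>simp_all add: R_def\<close>)
  then have R: "R \<in> lspan (fst s0) {e. ?d e < ?d (w + unitv i)}"
    by (rule lspan_mono) (use w(1) in \<open>auto simp: unitv_def\<close>)
  have "fst s3 (unitv i) = q (- bilin L1 w p1 + bilin L0 w (unitv i)) * fst s0 (w + unitv i) + R"
    unfolding lead0[symmetric] R_def by simp
  then have "monic_top ?d (fst s0) (fst s3 (unitv i))"
    unfolding monic_top_def using R by blast
  then show ?thesis using top_j by blast
qed

end

end

section \<open>The caterpillar step and the Laurent theorem\<close>

context seed_scalars
begin

text \<open>\<open>V\<close> and \<open>U\<close> clear the denominators of \<open>y\<close> with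
  respect to \<open>s1\<close> and \<open>s3\<close>. In \<open>U * (V * y) = V * (U * y)\<close>
  the factor \<open>U\<close> is regular modulo \<open>V\<close>, so \<open>V * y = V * v\<close>
  with \<open>v\<close> in the torus of \<open>s0\<close>, and \<open>V\<close> cancels.\<close>

lemma caterpillar:
  assumes l: "l > 1" and ij: "i \<noteq> j"
    and st1: "mstep i s0 s1" and st2: "mstep j s1 s2" and st3: "mstep i s2 s3"
    and y: "y \<in> lspan (fst s1) UNIV" "y \<in> lspan (fst s3) UNIV"
  shows "y \<in> lspan (fst s0) UNIV"
proof -
  let ?R = "lspan (fst s0) UNIV"
  obtain L0 L1 where F0: "frame (fst s0) L0" and F1: "frame (fst s1) L1" by (rule mstep_frames[OF st1])
  obtain L2 L3 where F3: "frame (fst s3) L3" by (rule mstep_frames[OF st3])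
  have R: "subalgebra ?R" by (rule subalgebra_lspan[OF F0])
  have "\<exists>d. (\<forall>f g. d (f + g) = d f + d g) \<and> d (col (snd s1) i) = 0 \<and>
    monic_top d (fst s0) (fst s3 (unitv i)) \<and> monic_top d (fst s0) (fst s3 (unitv j))"
  proof (cases "snd s1 j i = 0")
    case True
    then show ?thesis by (rule tops_if_zero[OF ij st1 st2 st3 l])
  next
    case False
    have "snd s1 i i = 0"
      using compat_with_diag[of l ex _ "snd s1" D i] mstepD(1,3)[OF st1] seedD(3) by blast
    then show ?thesis using tops_if_nonzero[OF ij st1 st2 st3 False] by (intro exI[of _ "\<lambda>f. f i"]) simp
  qed
  then obtain d where d: "\<And>f g. d (f + g) = d f + (d g :: int)" and db: "d (col (snd s1) i) = 0"
    and top_i: "monic_top d (fst s0) (fst s3 (unitv i))" and top_j: "monic_top d (fst s0) (fst s3 (unitv j))"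
    by blast
  have same1: "fst s1 (unitv a) = fst s0 (unitv a)" if "a \<noteq> i" for a by (rule mstepD(5)[OF st1 that])
  have same3: "fst s3 (unitv a) = fst s0 (unitv a)" if "a \<noteq> i" "a \<noteq> j" for a
    using that mstepD(5)[OF st1] mstepD(5)[OF st2] mstepD(5)[OF st3] by simp
  have gen1: "fst s1 (unitv a) \<in> ?R" for a by (rule mstep_unitv_lspan[OF st1])
  have gen1': "fst s1 (- unitv a) \<in> ?R" if "a \<notin> {i}" for a
    using same1[of a] that frame_inverse[OF F0, of "unitv a"] frame_inverse[OF F1, of "unitv a"]
      lspan_gen[of "- unitv a" UNIV "fst s0"] by auto
  have gen3: "fst s3 (unitv a) \<in> ?R" for a
    using same3[of a] monic_top_lspan[OF top_i] monic_top_lspan[OF top_j] lspan_gen[of "unitv a" UNIV "fst s0"]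
    by (cases "a = i"; cases "a = j") auto
  have gen3': "fst s3 (- unitv a) \<in> ?R" if "a \<notin> {i, j}" for a
    using same3[of a] that frame_inverse[OF F0, of "unitv a"] frame_inverse[OF F3, of "unitv a"]
      lspan_gen[of "- unitv a" UNIV "fst s0"] by auto
  obtain m where "\<forall>n\<ge>m. fst s1 (smul (int l) (\<lambda>a. if a \<in> {i} then int n else 0)) * y \<in> ?R"
    using subalgebra_clear_denominators[OF F1 R gen1 gen1' y(1)] by blast
  moreover define V where "V = fst s1 (smul (int l) (\<lambda>a. if a \<in> {i} then int m else 0))"
  ultimately have Vy: "V * y \<in> ?R" by simp
  obtain n where "\<forall>n'\<ge>n. fst s3 (smul (int l) (\<lambda>a. if a \<in> {i, j} then int n' else 0)) * y \<in> ?R"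
    using subalgebra_clear_denominators[OF F3 R gen3 gen3' y(2)] by blast
  moreover define U where "U = fst s3 (smul (int l) (\<lambda>a. if a \<in> {i, j} then int n else 0))"
  ultimately have Uy: "U * y \<in> ?R" by simp
  have Vcentral: "V * x = x * V" for x unfolding V_def by (rule frame_center[OF F1])
  have Vnz: "V \<noteq> 0" unfolding V_def by (rule frame_nz[OF F1])
  have "smul (int l) (\<lambda>a. if a \<in> {i} then int m else 0) = smul (int (l * m)) (unitv i)"
    by (auto simp: fun_eq_iff smul_apply unitv_def)
  then have V: "V = fst s1 (unitv i) ^ (l * m)" unfolding V_def frame_power[OF F1] by (simp only:)
  have "smul (int l) (\<lambda>a. if a \<in> {i, j} then int n else 0)
      = smul (int l) (smul (int n) (unitv i)) + smul (int (l * n)) (unitv j)"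
    using ij by (auto simp: fun_eq_iff smul_apply unitv_def)
  then have "U = fst s3 (smul (int l) (smul (int n) (unitv i))) * fst s3 (smul (int (l * n)) (unitv j))"
    unfolding U_def by (simp only: frame_add_central[OF F3])
  also have "smul (int l) (smul (int n) (unitv i)) = smul (int (l * n)) (unitv i)"
    by (simp add: fun_eq_iff smul_apply)
  finally have U: "U = fst s3 (unitv i) ^ (l * n) * fst s3 (unitv j) ^ (l * n)"
    unfolding frame_power[OF F3] .
  have Utop: "monic_top d (fst s0) U"
    unfolding U by (intro monic_top_mult[OF F0 d] monic_top_power[OF F0 d] top_i top_j)
  let ?b = "col (snd s0) i"
  have "snd s1 = bmut ex i (snd s0)" "i \<in> ex" using mstepD[OF st1] by blast+
  \<comment> \<open>Mutation at \<open>i\<close> negates column \<open>i\<close>, so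
    \<open>d\<close> vanishes on the column of \<open>s0\<close> too. The two monomials of the
    exchange relation then have equal degree, which makes the power \<open>V\<close>
    homogeneous.\<close>
  then have "d (- ?b) = 0" using db col_bmut[of i ex "snd s0"] by simp
  moreover have "d 0 = 0" using d[of 0 0] by simp
  ultimately have db': "d ?b = 0" using d[of ?b "- ?b"] by simp
  define p1 p2 where "p1 = - unitv i + posp ?b" and "p2 = - unitv i - negp ?b"
  have p: "p1 = p2 + ?b" using posp_negp[of ?b] by (simp add: p1_def p2_def algebra_simps)
  have dp: "d p1 = d p2" unfolding p d db' by simp
  have "fst s1 (unitv i) = fst s0 p1 + fst s0 p2"
    using mstepD(6)[OF st1] by (simp add: exchange_def p1_def p2_def)
  then have "fst s1 (unitv i) \<in> lspan (fst s0) {f. d f = d p2}"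
    using dp by (auto intro!: lspan_add lspan_gen)
  then have Vhom: "V \<in> lspan (fst s0) {f. d f = int (l * m) * d p2}"
    unfolding V by (rule homogeneous_power[OF F0 d])
  have "U * (V * y) = V * (U * y)" by (simp only: mult.assoc[symmetric] Vcentral[of U])
  then obtain v where "v \<in> ?R" "V * y = V * v"
    using monic_top_regular[OF F0 d Utop Vhom Vcentral Vy Uy] by blast
  then show ?thesis using Vnz by simp
qed

fun path :: "'n list \<Rightarrow> ('a, 'n) qseed \<Rightarrow> ('a, 'n) qseed \<Rightarrow> bool" where
  "path [] s t \<longleftrightarrow> s = t"
| "path (k # ks) s t \<longleftrightarrow> (\<exists>u. mstep k s u \<and> path ks u t)"

text \<open>Induction on the length of the path. If it starts with distinct \<open>i\<close> and
  \<open>j\<close>, mutate \<open>s2\<close> at \<open>i\<close> to get \<open>s3\<close>; from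
  \<open>s3\<close> the path \<open>i # ks''\<close> back through \<open>s2\<close> is one step
  shorter than the given path, so \<open>caterpillar\<close> applies. If \<open>i = j\<close>, the
  first two steps cancel.\<close>

theorem laurent:
  assumes "l > 1" "path ks s t"
  shows "fst t (unitv a) \<in> lspan (fst s) UNIV"
  using assms(2)
proof (induction ks arbitrary: s rule: length_induct)
  case (1 ks)
  show ?case
  proof (cases ks)
    case Nil
    then show ?thesis using 1 by (auto intro: lspan_gen)
  next
    case (Cons i ks')
    then obtain s1 where s1: "mstep i s s1" "path ks' s1 t" using 1 by auto
    show ?thesis
    proof (cases ks')
      case Nil
      then show ?thesis using s1 mstep_unitv_lspan by auto
    next
      case (Cons j ks'')
      then obtain s2 where s2: "mstep j s1 s2" "path ks'' s2 t" using s1 by auto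
      have len: "length ks'' < length ks" "length ks' < length ks" "length (i # ks'') < length ks"
        using Cons \<open>ks = i # ks'\<close> by auto
      show ?thesis
      proof (cases "i = j")
        case True
        then have "s2 = s" using mstep_deterministic[OF s2(1)] mstep_sym[OF s1(1)] by blast
        then show ?thesis using 1(1) len(1) s2(2) by blast
      next
        case False
        obtain L2 where "seed (fst s2) L2 (snd s2)" using mstepD(3)[OF s2(1)] by blast
        then obtain s3 where s3: "mstep i s2 s3" using mstep_exists mstepD(1)[OF s1(1)] by blast
        have "path (i # ks'') s3 t" unfolding path.simps using mstep_sym[OF s3] s2(2) by blast
        then have "fst t (unitv a) \<in> lspan (fst s3) UNIV" using 1(1) len(3) by blast
        moreover have "fst t (unitv a) \<in> lspan (fst s1) UNIV" using 1(1) len(2) s1(2) by blast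
        ultimately show ?thesis using caterpillar[OF assms(1) False s1(1) s2(1) s3] by blast
      qed
    qed
  qed
qed

end

section \<open>The bar involution\<close>

text \<open>Extension of an injective anti-homomorphism from a subring to its skew field of fractions.
  The Ore condition follows from every element being a right fraction.\<close>

locale fraction_involution =
  fixes r :: "'a::division_ring \<Rightarrow> 'a \<Rightarrow> bool"
  assumes r_add: "r x x' \<Longrightarrow> r y y' \<Longrightarrow> r (x + y) (x' + y')"
    and r_mult: "r x x' \<Longrightarrow> r y y' \<Longrightarrow> r (x * y) (y' * x')"
    and r_unique: "r x x' \<Longrightarrow> r x x'' \<Longrightarrow> x' = x''"
    and r_0: "r 0 0"
    and r_nz: "r x 0 \<Longrightarrow> x = 0"
    and r_1: "r 1 1"
    and r_fraction: "\<exists>a a' b b'. r a a' \<and> r b b' \<and> b \<noteq> 0 \<and> y = a * inverse b"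
begin

text \<open>An anti-homomorphism turns the right fraction of \<open>a\<close> and \<open>b\<close>
  into the left fraction of their images.\<close>

definition represents :: "'a \<Rightarrow> 'a \<Rightarrow> bool" where
  "represents y w \<longleftrightarrow> (\<exists>a a' b b'. r a a' \<and> r b b' \<and> b \<noteq> 0 \<and> y = a * inverse b \<and> w = inverse b' * a')"

lemma nz: "r x x' \<Longrightarrow> x \<noteq> 0 \<Longrightarrow> x' \<noteq> 0"
  using r_nz by blast

text \<open>Writing \<open>inverse b * d\<close> as a right fraction gives a common right multiple
  \<open>d * f = b * e\<close>; uniqueness of images transports it to a common left
  multiple.\<close>

lemma common_denominator:
  assumes "r b b'" "r d d'" "b \<noteq> 0"
  obtains e e' f f' where "r e e'" "r f f'" "f \<noteq> 0" "f' \<noteq> 0" "d * f = b * e" "f' * d' = e' * b'"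
    "inverse b * d = e * inverse f" "d' * inverse b' = inverse f' * e'"
proof -
  obtain e e' f f' where ef: "r e e'" "r f f'" "f \<noteq> 0" "inverse b * d = e * inverse f"
    using r_fraction[of "inverse b * d"] by blast
  have "d = b * (e * inverse f)" using ef(4)[symmetric] assms(3) by (simp flip: mult.assoc)
  then have df: "d * f = b * e" using ef(3) by (simp add: mult.assoc)
  have "r (b * e) (f' * d')" using r_mult[OF assms(2) ef(2)] df by simp
  then have fd: "f' * d' = e' * b'" using r_unique r_mult[OF assms(1) ef(1)] by blast
  have b': "b' \<noteq> 0" and f': "f' \<noteq> 0" using nz assms ef by blast+
  have "d' * inverse b' = inverse f' * (f' * d') * inverse b'" using f' by (simp flip: mult.assoc)
  also have "\<dots> = inverse f' * e'" unfolding fd using b' by (simp add: mult.assoc)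
  finally show ?thesis using that ef f' df fd by blast
qed

lemma represents_unique:
  assumes "represents y w" "represents y w'"
  shows "w = w'"
proof -
  obtain a a' b b' where ab: "r a a'" "r b b'" "b \<noteq> 0" "y = a * inverse b" "w = inverse b' * a'"
    using assms(1) unfolding represents_def by blast
  obtain c c' d d' where cd: "r c c'" "r d d'" "d \<noteq> 0" "y = c * inverse d" "w' = inverse d' * c'"
    using assms(2) unfolding represents_def by blast
  obtain e e' f f' where ef: "r e e'" "r f f'" "f \<noteq> 0" "f' \<noteq> 0" "d * f = b * e" "f' * d' = e' * b'"
    using common_denominator[OF ab(2) cd(2) ab(3)] by metis
  have b': "b' \<noteq> 0" and d': "d' \<noteq> 0" using nz ab cd by blast+
  have "a * e = y * (b * e)" using ab(3,4) by (simp add: mult.assoc) (simp flip: mult.assoc)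
  also have "\<dots> = c * f" unfolding ef(5)[symmetric] using cd(3,4) by (simp add: mult.assoc) (simp flip: mult.assoc)
  finally have "r (a * e) (f' * c')" using r_mult[OF cd(1) ef(2)] by simp
  then have ec: "e' * a' = f' * c'" using r_unique r_mult[OF ab(1) ef(1)] by blast
  have e': "e' \<noteq> 0" using ef(4,6) d' by auto
  have "w = inverse (e' * b') * (e' * a')"
    using ab(5) e' b' by (simp add: nonzero_inverse_mult_distrib mult.assoc) (simp flip: mult.assoc)
  also have "\<dots> = inverse (f' * d') * (f' * c')" unfolding ef(6) ec ..
  also have "\<dots> = w'"
    using cd(5) ef(4) d' by (simp add: nonzero_inverse_mult_distrib mult.assoc) (simp flip: mult.assoc)
  finally show ?thesis .
qed

lemma represents_exists: "\<exists>w. represents y w"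
  using r_fraction[of y] unfolding represents_def by blast

lemma represents_r: "r x x' \<Longrightarrow> represents x x'"
  unfolding represents_def using r_1
  by (intro exI[of _ x] exI[of _ x'] exI[of _ 1]) simp

lemma represents_add:
  assumes "represents y1 w1" "represents y2 w2"
  shows "represents (y1 + y2) (w1 + w2)"
proof -
  obtain a a' b b' where ab: "r a a'" "r b b'" "b \<noteq> 0" "y1 = a * inverse b" "w1 = inverse b' * a'"
    using assms(1) unfolding represents_def by blast
  obtain c c' d d' where cd: "r c c'" "r d d'" "d \<noteq> 0" "y2 = c * inverse d" "w2 = inverse d' * c'"
    using assms(2) unfolding represents_def by blast
  obtain e e' f f' where ef: "r e e'" "r f f'" "f \<noteq> 0" "f' \<noteq> 0" "d * f = b * e" "f' * d' = e' * b'"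
    using common_denominator[OF ab(2) cd(2) ab(3)] by metis
  have b': "b' \<noteq> 0" and d': "d' \<noteq> 0" using nz ab cd by blast+
  have e: "e \<noteq> 0" using ef(3,5) cd(3) by auto
  have e': "e' \<noteq> 0" using ef(4,6) d' by auto
  have "y1 = (a * e) * inverse (b * e)"
    using ab(3,4) e by (simp add: nonzero_inverse_mult_distrib mult.assoc) (simp flip: mult.assoc)
  moreover have "y2 = (c * f) * inverse (b * e)" unfolding ef(5)[symmetric]
    using cd(3,4) ef(3) by (simp add: nonzero_inverse_mult_distrib mult.assoc) (simp flip: mult.assoc)
  ultimately have y: "y1 + y2 = (a * e + c * f) * inverse (b * e)" by (simp add: distrib_right)
  have "w1 = inverse (e' * b') * (e' * a')"
    using ab(5) e' b' by (simp add: nonzero_inverse_mult_distrib mult.assoc) (simp flip: mult.assoc)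
  moreover have "w2 = inverse (e' * b') * (f' * c')" unfolding ef(6)[symmetric]
    using cd(5) ef(4) d' by (simp add: nonzero_inverse_mult_distrib mult.assoc) (simp flip: mult.assoc)
  ultimately have w: "w1 + w2 = inverse (e' * b') * (e' * a' + f' * c')" by (simp add: distrib_left)
  have "b * e \<noteq> 0" using ab(3) e by simp
  then show ?thesis unfolding represents_def
    using r_add[OF r_mult[OF ab(1) ef(1)] r_mult[OF cd(1) ef(2)]] r_mult[OF ab(2) ef(1)] y w by blast
qed

lemma represents_mult:
  assumes "represents y1 w1" "represents y2 w2"
  shows "represents (y1 * y2) (w2 * w1)"
proof -
  obtain a a' b b' where ab: "r a a'" "r b b'" "b \<noteq> 0" "y1 = a * inverse b" "w1 = inverse b' * a'"
    using assms(1) unfolding represents_def by blast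
  obtain c c' d d' where cd: "r c c'" "r d d'" "d \<noteq> 0" "y2 = c * inverse d" "w2 = inverse d' * c'"
    using assms(2) unfolding represents_def by blast
  obtain e e' f f' where ef: "r e e'" "r f f'" "f \<noteq> 0" "f' \<noteq> 0"
    "inverse b * c = e * inverse f" "c' * inverse b' = inverse f' * e'"
    using common_denominator[OF ab(2) cd(1) ab(3)] by metis
  have d': "d' \<noteq> 0" using nz cd by blast
  have "y1 * y2 = a * (inverse b * c) * inverse d" unfolding ab(4) cd(4) by (simp only: mult.assoc)
  also have "\<dots> = (a * e) * inverse (d * f)" unfolding ef(5)
    using ef(3) cd(3) by (simp add: nonzero_inverse_mult_distrib mult.assoc)
  finally have y: "y1 * y2 = (a * e) * inverse (d * f)" .
  have "w2 * w1 = inverse d' * (c' * inverse b') * a'" unfolding ab(5) cd(5) by (simp only: mult.assoc)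
  also have "\<dots> = inverse (f' * d') * (e' * a')" unfolding ef(6)
    using ef(4) d' by (simp add: nonzero_inverse_mult_distrib mult.assoc)
  finally have w: "w2 * w1 = inverse (f' * d') * (e' * a')" .
  have "d * f \<noteq> 0" using cd(3) ef(3) by simp
  then show ?thesis unfolding represents_def
    using r_mult[OF ab(1) ef(1)] r_mult[OF cd(2) ef(2)] y w by blast
qed

theorem extension:
  obtains s where "\<And>x y. s (x + y) = s x + s y" "\<And>x y. s (x * y) = s y * s x" "\<And>x x'. r x x' \<Longrightarrow> s x = x'"
proof -
  define s where "s y = (SOME w. represents y w)" for y
  have rep: "represents y (s y)" for y unfolding s_def using represents_exists by (rule someI_ex)
  have eq: "s y = w" if "represents y w" for y w using represents_unique rep that by blast
  show ?thesis
    using that[of s] eq represents_add represents_mult represents_r rep by metis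
qed

end

section \<open>Conjugation of the coefficients in a frame\<close>

context torus_scalars
begin

text \<open>As a relation it is additive by construction; that it is single-valued and injective is
  extracted later from independence.\<close>

inductive bar_image :: "(('n \<Rightarrow> int) \<Rightarrow> 'a) \<Rightarrow> 'a \<Rightarrow> 'a \<Rightarrow> bool" for M where
  zero: "bar_image M 0 0"
| step: "bar_image M y y' \<Longrightarrow> a \<in> A \<Longrightarrow> bar_image M (y + a * M f) (y' + bar a * M f)"

lemma bar_image_add: "bar_image M x x' \<Longrightarrow> bar_image M y y' \<Longrightarrow> bar_image M (x + y) (x' + y')"
proof (induction x x' rule: bar_image.induct)
  case (step x x' a f)
  then show ?case using bar_image.step[of M "x + y" "x' + y'" a f] by (simp add: algebra_simps)
qed auto

lemma bar_image_term: "a \<in> A \<Longrightarrow> bar_image M (a * M f) (bar a * M f)"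
  using bar_image.step[OF bar_image.zero] by fastforce

lemma bar_0: "bar 0 = 0"
  using bar_add[OF zero_A zero_A] by simp

lemma bar_uminus: "a \<in> A \<Longrightarrow> bar (- a) = - bar a"
  using bar_add[of a "- a"] uminus_A[of a] bar_0 by (simp add: eq_neg_iff_add_eq_0 add.commute)

lemma bar_image_uminus: "bar_image M x x' \<Longrightarrow> bar_image M (- x) (- x')"
proof (induction x x' rule: bar_image.induct)
  case (step x x' a f)
  then show ?case
    using bar_image.step[of M "- x" "- x'" "- a" f] by (simp add: bar_uminus uminus_A)
qed (simp add: bar_image.zero)

text \<open>Reversing a product of monomials changes the sign of the form, and so does
  \<open>bar\<close> in the power of \<open>q\<close>.\<close>

lemma bar_image_mult_term:
  assumes M: "frame M L" and a: "a \<in> A" and "bar_image M y y'"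
  shows "bar_image M (a * M f * y) (y' * (bar a * M f))"
  using assms(3)
proof (induction y y' rule: bar_image.induct)
  case (step y y' b g)
  let ?c = "a * b * q (bilin L f g)"
  have cA: "?c \<in> A" by (intro mult_A q_A a step(2))
  have "a * M f * (b * M g) = a * (b * (M f * M g))"
    by (simp only: mult.assoc A_move[OF step(2), of "M f"])
  then have 1: "a * M f * (b * M g) = ?c * M (f + g)" by (simp only: frame_mult[OF M] mult.assoc)
  have "bar b * M g * (bar a * M f) = bar a * (bar b * (M g * M f))"
    by (simp only: mult.assoc A_move[OF bar_A[OF a]])
  also have "M g * M f = q (- bilin L f g) * M (f + g)"
    using q_cong[OF bilin_skew'[OF M, of g f]] by (simp add: frame_mult[OF M] add.commute)
  finally have 2: "bar b * M g * (bar a * M f) = bar ?c * M (f + g)"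
    using a step(2) by (simp add: bar_mult mult_A q_A bar_q mult.assoc)
  have "bar_image M (a * M f * (b * M g)) (bar b * M g * (bar a * M f))"
    unfolding 1 2 by (rule bar_image_term[OF cA])
  then show ?case using step bar_image_add by (simp only: distrib_left distrib_right)
qed (simp add: bar_image.zero)

lemma bar_image_mult:
  assumes M: "frame M L" and "bar_image M x x'" "bar_image M y y'"
  shows "bar_image M (x * y) (y' * x')"
  using assms(2)
proof (induction x x' rule: bar_image.induct)
  case (step x x' a f)
  show ?case unfolding distrib_left distrib_right
    by (rule bar_image_add[OF step.IH bar_image_mult_term[OF M step(2) assms(3)]])
qed (simp add: bar_image.zero)

lemma bar_image_sumD:
  assumes "bar_image M y y'"
  shows "\<exists>S c. finite S \<and> (\<forall>f. c f \<in> A) \<and> y = (\<Sum>f\<in>S. c f * M f) \<and> y' = (\<Sum>f\<in>S. bar (c f) * M f)"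
  using assms
proof (induction y y' rule: bar_image.induct)
  case zero
  then show ?case by (intro exI[of _ "{}"] exI[of _ "\<lambda>_. 0"]) (simp add: zero_A)
next
  case (step y y' a f)
  then obtain S c where S: "finite S" "\<forall>f. c f \<in> A" "y = (\<Sum>f\<in>S. c f * M f)" "y' = (\<Sum>f\<in>S. bar (c f) * M f)"
    by blast
  define c' where "c' = c(f := (if f \<in> S then c f + a else a))"
  have rest: "(\<Sum>h\<in>S - {f}. c' h * M h) = (\<Sum>h\<in>S - {f}. c h * M h)"
    "(\<Sum>h\<in>S - {f}. bar (c' h) * M h) = (\<Sum>h\<in>S - {f}. bar (c h) * M h)"
    by (rule sum.cong; auto simp: c'_def)+
  have "y + a * M f = (\<Sum>h\<in>insert f S. c' h * M h) \<and> y' + bar a * M f = (\<Sum>h\<in>insert f S. bar (c' h) * M h)"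
  proof (cases "f \<in> S")
    case True
    then have "insert f S = S" by auto
    with True S rest step(2) show ?thesis
      by (simp add: sum.remove[of S f] c'_def bar_add algebra_simps)
  next
    case False
    with S rest show ?thesis by (simp add: c'_def algebra_simps)
  qed
  moreover have "\<forall>h. c' h \<in> A" using S step by (auto simp: c'_def add_A)
  ultimately show ?case using S by (intro exI[of _ "insert f S"] exI[of _ c']) auto
qed

text \<open>Applied to differences, one direction shows that images are unique; the other shows that
  only 0 has image 0.\<close>

lemma bar_image_zero_iff:
  assumes M: "frame M L" and "bar_image M y y'"
  shows "y = 0 \<longleftrightarrow> y' = 0"
proof -
  obtain S c where S: "finite S" "\<forall>f. c f \<in> A" "y = (\<Sum>f\<in>S. c f * M f)" "y' = (\<Sum>f\<in>S. bar (c f) * M f)"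
    using bar_image_sumD[OF assms(2)] by blast
  show ?thesis
  proof
    assume "y = 0"
    then have 0: "(\<Sum>f\<in>S. c f * M f) = 0" using S(3) by metis
    have "c f = 0" if "f \<in> S" for f
      by (rule independentD[OF frame_indep[OF M] S(1) _ 0 that]) (use S(2) in blast)
    then show "y' = 0" unfolding S(4) by (intro sum.neutral) (simp add: bar_0)
  next
    assume "y' = 0"
    then have 0: "(\<Sum>f\<in>S. bar (c f) * M f) = 0" using S(4) by metis
    have "bar (c f) = 0" if "f \<in> S" for f
      by (rule independentD[OF frame_indep[OF M] S(1) _ 0 that]) (use S(2) bar_A in blast)
    then show "y = 0" unfolding S(3) using S(2) bar_nz by (intro sum.neutral) simp
  qed
qed

lemma bar_image_total: "y \<in> lspan M UNIV \<Longrightarrow> \<exists>y'. bar_image M y y'"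
proof (induction y rule: lspan.induct)
  case zero
  then show ?case using bar_image.zero by blast
next
  case (step y a f)
  then show ?case using bar_image.step by blast
qed

lemma frame_bar_involution:
  assumes M: "frame M L"
  obtains s where "\<And>x y. s (x + y) = s x + s y" "\<And>x y. s (x * y) = s y * s x"
    "\<And>a. a \<in> A \<Longrightarrow> s a = bar a" "\<And>f. s (M f) = M f"
proof -
  have bar_1: "bar 1 = 1" using bar_q[of 0] by simp
  interpret fraction_involution "bar_image M"
  proof
    show "bar_image M 1 1" using bar_image_term[OF one_A, of M 0] frame_0[OF M] bar_1 by simp
    show "x' = x''" if "bar_image M x x'" "bar_image M x x''" for x x' x''
      using bar_image_zero_iff[OF M bar_image_add[OF that(1) bar_image_uminus[OF that(2)]]] by simp
    show "\<exists>a a' b b'. bar_image M a a' \<and> bar_image M b b' \<and> b \<noteq> 0 \<and> y = a * inverse b" for y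
      using frame_fractions[OF M, of y] bar_image_total by blast
  qed (use bar_image_add bar_image_mult[OF M] bar_image.zero bar_image_zero_iff[OF M] in blast)+
  obtain s where s: "\<And>x y. s (x + y) = s x + s y" "\<And>x y. s (x * y) = s y * s x"
    "\<And>x x'. bar_image M x x' \<Longrightarrow> s x = x'"
    using extension by blast
  show ?thesis
  proof (rule that[of s, OF s(1,2)])
    show "s a = bar a" if "a \<in> A" for a
      using s(3)[OF bar_image_term[OF that, of M 0]] frame_0[OF M] by simp
    show "s (M f) = M f" for f
      using s(3)[OF bar_image_term[OF one_A, of M f]] bar_1 by simp
  qed
qed

end

section \<open>Frames with equal powers\<close>

context torus_scalars
begin

lemma power_top_part:
  assumes M: "frame M L" and d: "\<And>f g. d (f + g) = d f + d g"
    and yt: "yt \<in> lspan M {f. d f = (m::int)}" and yr: "yr \<in> lspan M {f. d f < m}"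
  shows "(yt + yr) ^ n - yt ^ n \<in> lspan M {f. d f < int n * m}"
proof (induction n)
  case 0
  show ?case by (simp only: power_0 diff_self lspan.zero)
next
  case (Suc n)
  define w where "w = (yt + yr) ^ n - yt ^ n"
  have w: "w \<in> lspan M {f. d f < int n * m}" unfolding w_def by (rule Suc)
  have pt: "yt ^ n \<in> lspan M {f. d f = int n * m}" by (rule homogeneous_power[OF M d yt])
  have "(yt + yr) ^ Suc n = (yt + yr) * (yt ^ n + w)" by (simp add: w_def)
  then have eq: "(yt + yr) ^ Suc n - yt ^ Suc n = yt * w + yr * yt ^ n + yr * w"
    by (simp add: distrib_left distrib_right)
  show ?case unfolding eq
    by (intro lspan_add lspan_mult[OF M yt w] lspan_mult[OF M yr pt] lspan_mult[OF M yr w])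
       (auto simp: d algebra_simps)
qed

text \<open>A division ring has no zero divisors, so the \<open>n\<close>-th power of the top part
  of degree \<open>m\<close> is nonzero of degree \<open>n m\<close>. It is the top part of a
  monomial of degree \<open>n k\<close>, so \<open>m\<close> cannot exceed \<open>k\<close>.\<close>

lemma root_degree_le:
  assumes M: "frame M L" and d: "\<And>f g. d (f + g) = d f + (d g :: int)"
    and S: "finite S" "\<And>f. f \<in> S \<Longrightarrow> c f \<in> A" "\<And>f. f \<in> S \<Longrightarrow> c f \<noteq> 0"
    and y: "(\<Sum>f\<in>S. c f * M f) ^ n = M v" and v: "d v = int n * k" and n: "n > 0" and f: "f \<in> S"
  shows "d f \<le> k"
proof -
  define m where "m = Max (d ` S)"
  have le: "d g \<le> m" if "g \<in> S" for g unfolding m_def using S(1) that by simp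
  have "m \<in> d ` S" unfolding m_def using S(1) f by (intro Max_in) auto
  then obtain g where g: "g \<in> S" "d g = m" by auto
  define yt yr where "yt = (\<Sum>f | f \<in> S \<and> d f = m. c f * M f)" and "yr = (\<Sum>f | f \<in> S \<and> d f \<noteq> m. c f * M f)"
  have "S = {f. f \<in> S \<and> d f = m} \<union> {f. f \<in> S \<and> d f \<noteq> m}" by blast
  then have sum: "(\<Sum>f\<in>S. c f * M f) = yt + yr"
    unfolding yt_def yr_def using S(1) by (subst sum.union_disjoint[symmetric]) auto
  have yt: "yt \<in> lspan M {f. d f = m}" unfolding yt_def
    by (intro lspan_sum lspan_term) (use S(2) in auto)
  have yr: "yr \<in> lspan M {f. d f < m}" unfolding yr_def
    by (intro lspan_sum lspan_term) (use S(2) le in force)+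
  have "yt \<noteq> 0"
  proof
    assume "yt = 0"
    then have 0: "(\<Sum>f | f \<in> S \<and> d f = m. c f * M f) = 0" unfolding yt_def .
    have "c g = 0"
      by (rule independentD[OF frame_indep[OF M] _ _ 0]) (use S g in auto)
    then show False using S(3) g by blast
  qed
  then have nz: "yt ^ n \<noteq> 0" by simp
  have top: "yt ^ n \<in> lspan M {f. d f = int n * m}" by (rule homogeneous_power[OF M d yt])
  have low: "(yt + yr) ^ n - yt ^ n \<in> lspan M {f. d f < int n * m}" by (rule power_top_part[OF M d yt yr])
  have "\<not> k < m"
  proof
    assume "k < m"
    then have "int n * k < int n * m" using n by simp
    then have "M v \<in> lspan M {f. d f < int n * m}" by (intro lspan_gen) (simp add: v)
    then have "M v - ((yt + yr) ^ n - yt ^ n) \<in> lspan M {f. d f < int n * m}" using low by (rule lspan_diff)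
    also have "M v - ((yt + yr) ^ n - yt ^ n) = yt ^ n" using y sum by simp
    finally have low': "yt ^ n \<in> lspan M {f. d f < int n * m}" .
    have "yt ^ n = 0" by (rule lspan_disjoint[OF frame_indep[OF M] top low']) auto
    then show False using nz by blast
  qed
  then show ?thesis using le[OF f] by linarith
qed

text \<open>Each coordinate and its negative are gradings; together they bound every exponent of
  \<open>y\<close> from both sides by \<open>v\<close>.\<close>

lemma monomial_root:
  assumes M: "frame M L" and y: "y \<in> lspan M UNIV" "y ^ n = M (smul (int n) v)" and n: "n > 0"
  shows "\<exists>a\<in>A. y = a * M v"
proof -
  obtain S c where S: "finite S" "\<forall>f. c f \<in> A" "y = (\<Sum>f\<in>S. c f * M f)"
    using lspan_sumD[OF y(1)] by blast
  define T where "T = {f\<in>S. c f \<noteq> 0}"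
  have T: "finite T" "\<And>f. f \<in> T \<Longrightarrow> c f \<in> A" "\<And>f. f \<in> T \<Longrightarrow> c f \<noteq> 0" using S by (auto simp: T_def)
  have yT: "y = (\<Sum>f\<in>T. c f * M f)" unfolding S(3) T_def
    by (rule sum.mono_neutral_right) (use S(1) in auto)
  have pT: "(\<Sum>f\<in>T. c f * M f) ^ n = M (smul (int n) v)" using y(2) yT by simp
  have "f = v" if f: "f \<in> T" for f
  proof
    fix i
    have "f i \<le> v i"
      by (rule root_degree_le[OF M _ T pT _ n f, of "\<lambda>f. f i" "v i"]) (simp_all add: smul_apply)
    moreover have "- f i \<le> - v i"
      by (rule root_degree_le[OF M _ T pT _ n f, of "\<lambda>f. - f i" "- v i"]) (simp_all add: smul_apply)
    ultimately show "f i = v i" by simp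
  qed
  then have "T = {} \<or> T = {v}" by blast
  then show ?thesis
  proof
    assume "T = {}"
    then show ?thesis unfolding yT using zero_A by (intro bexI[of _ 0]) auto
  next
    assume "T = {v}"
    then show ?thesis unfolding yT using T(2)[of v] by auto
  qed
qed

definition bar_involution :: "('a \<Rightarrow> 'a) \<Rightarrow> bool" where
  "bar_involution s \<longleftrightarrow> (\<forall>x y. s (x + y) = s x + s y \<and> s (x * y) = s y * s x) \<and> (\<forall>a\<in>A. s a = bar a)"

text \<open>In \<open>q (- bilin L f g) * (M f * M g)\<close>, reversing the product and inverting
  \<open>q\<close> compensate each other by skew-symmetry. Invariance thus spreads from the
  variables and their inverses to all monomials.\<close>

lemma bar_involution_frame:
  assumes s: "bar_involution s" and M: "frame M L" and gen: "\<And>j. s (M (unitv j)) = M (unitv j)"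
  shows "s (M f) = M f"
proof -
  have add: "s (M (f + g)) = M (f + g)" if "s (M f) = M f" "s (M g) = M g" for f g
  proof -
    have "M (f + g) = q (- bilin L f g) * (M f * M g)" by (simp add: frame_mult[OF M] q_mult_left)
    then have "s (M (f + g)) = M g * M f * q (bilin L f g)"
      using s that by (simp add: bar_involution_def q_A bar_q)
    also have "\<dots> = q (bilin L f g) * (q (- bilin L f g) * M (f + g))"
      using q_cong[OF bilin_skew'[OF M, of g f]] by (simp add: q_comm frame_mult[OF M] add.commute)
    finally show ?thesis by (simp add: q_mult_left)
  qed
  have minus: "s (M (- unitv j)) = M (- unitv j)" for j
  proof -
    have "s 1 = 1" using s one_A bar_q[of 0] by (simp add: bar_involution_def)
    then have "s (M (unitv j) * M (- unitv j)) = 1" unfolding frame_inverse_mult[OF M] .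
    then have "s (M (- unitv j)) * M (unitv j) = 1" using s gen by (simp add: bar_involution_def)
    then have "s (M (- unitv j)) * M (unitv j) = M (- unitv j) * M (unitv j)"
      unfolding frame_inverse_mult[OF M] .
    then show ?thesis using frame_nz[OF M, of "unitv j"] by simp
  qed
  show ?thesis
  proof (rule exponent_induct[of UNIV f])
    have "s 1 = 1" using s one_A bar_q[of 0] by (simp add: bar_involution_def)
    then show "s (M 0) = M 0" unfolding frame_0[OF M] .
    show "s (M (f + unitv j)) = M (f + unitv j)" if "s (M f) = M f" for f j
      by (rule add[OF that gen])
    show "s (M (f - unitv j)) = M (f - unitv j)" if "s (M f) = M f" for f j
      using add[OF that minus] by simp
  qed simp
qed

end

section \<open>Recovering seeds from powers along mutation paths\<close>

context seed_scalars
begin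

lemma path_append: "path ks s t \<Longrightarrow> path ks' t u \<Longrightarrow> path (ks @ ks') s u"
proof (induction ks arbitrary: s)
  case (Cons k ks)
  then obtain v where "mstep k s v" "path ks v t" unfolding path.simps by blast
  then show ?case using Cons.IH[OF _ Cons.prems(2)] unfolding append_Cons path.simps by blast
qed simp

lemma path_rev: "path ks s t \<Longrightarrow> path (rev ks) t s"
proof (induction ks arbitrary: s)
  case (Cons k ks)
  then obtain v where v: "mstep k s v" "path ks v t" unfolding path.simps by blast
  have "path [k] v s" unfolding path.simps using mstep_sym[OF v(1)] by blast
  then show ?case using path_append[OF Cons.IH[OF v(2)]] by simp
qed simp

lemma path_seed: "path ks s t \<Longrightarrow> \<exists>L. seed (fst s) L (snd s) \<Longrightarrow> \<exists>L. seed (fst t) L (snd t)"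
proof (induction ks arbitrary: s)
  case (Cons k ks)
  then obtain v where "mstep k s v" "path ks v t" unfolding path.simps by blast
  then show ?case using Cons.IH mstepD(3) by blast
qed simp

text \<open>The new variable is a sum of two monomials of the old frame with coefficient 1, so it is
  fixed when they are.\<close>

lemma path_bar_involution:
  assumes s: "bar_involution \<sigma>" and "path ks u t" "\<And>f. \<sigma> (fst u f) = fst u f"
  shows "\<sigma> (fst t f) = fst t f"
  using assms(2,3)
proof (induction ks arbitrary: u)
  case (Cons k ks)
  then obtain v where v: "mstep k u v" "path ks v t" unfolding path.simps by blast
  obtain L L' where "frame (fst v) L'" using mstep_frames[OF v(1)] by metis
  moreover have "\<sigma> (fst v (unitv j)) = fst v (unitv j)" for j
  proof (cases "j = k")
    case True
    have add: "\<sigma> (x + y) = \<sigma> x + \<sigma> y" for x y using s by (simp add: bar_involution_def)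
    show ?thesis unfolding True mstepD(6)[OF v(1)] exchange_def add Cons.prems(2) ..
  next
    case False
    then show ?thesis using mstepD(5)[OF v(1) False] Cons.prems(2) by simp
  qed
  ultimately have "\<sigma> (fst v f) = fst v f" for f by (rule bar_involution_frame[OF s])
  then show ?case using Cons.IH v(2) by blast
qed simp

theorem frame_determined_by_powers:
  assumes seed: "seed (fst s) L (snd s)" and t: "path ks s t" and u: "path ks' s u"
    and eq: "\<And>i. fst t (unitv i) ^ l = fst u (unitv i) ^ l"
  shows "fst t = fst u"
proof -
  obtain Lt where Lt: "seed (fst t) Lt (snd t)" using path_seed[OF t] seed by blast
  obtain Lu where Lu: "seed (fst u) Lu (snd u)" using path_seed[OF u] seed by blast
  note Ft = seedD(1)[OF Lt] and Fu = seedD(1)[OF Lu]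
  have gen: "fst t (unitv i) = fst u (unitv i)" for i
  \<comment> \<open>The Laurent theorem assumes \<open>l > 1\<close>; in the remaining case the
    powers are the variables themselves.\<close>
  proof (cases "l = 1")
    case True
    then show ?thesis using eq[of i] by simp
  next
    case False
    then have l: "l > 1" using l_pos by linarith
    obtain \<sigma> where "\<And>x y. \<sigma> (x + y) = \<sigma> x + \<sigma> y" "\<And>x y. \<sigma> (x * y) = \<sigma> y * \<sigma> x"
      "\<And>a. a \<in> A \<Longrightarrow> \<sigma> a = bar a" and fix0: "\<And>f. \<sigma> (fst s f) = fst s f"
      using frame_bar_involution[OF seedD(1)[OF seed]] by metis
    then have \<sigma>: "bar_involution \<sigma>" unfolding bar_involution_def by blast
    have fixt: "\<sigma> (fst t f) = fst t f" and fixu: "\<sigma> (fst u f) = fst u f" for f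
      by (rule path_bar_involution[OF \<sigma> t fix0], rule path_bar_involution[OF \<sigma> u fix0])
    have "fst u (unitv i) \<in> lspan (fst t) UNIV"
      by (rule laurent[OF l path_append[OF path_rev[OF t] u]])
    moreover have pow: "fst u (unitv i) ^ l = fst t (smul (int l) (unitv i))"
      using eq[of i] frame_power[OF Ft, of "unitv i" l] by simp
    ultimately obtain a where a: "a \<in> A" "fst u (unitv i) = a * fst t (unitv i)"
      using monomial_root[OF Ft _ _ l_pos] by blast
    have nz: "fst t f \<noteq> 0" for f by (rule frame_nz[OF Ft])
    have pow_a: "(a * x) ^ n = a ^ n * x ^ n" for x n
    proof (induction n)
      case (Suc n)
      then show ?case using A_move[OF power_A[OF a(1), of n], of x "x ^ n"] by (simp add: mult.assoc)
    qed simp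
    have "a ^ l * fst t (unitv i) ^ l = fst t (unitv i) ^ l"
      using eq[of i] unfolding a(2) pow_a by simp
    then have "a ^ l = 1" using nz by (metis mult_1 mult_right_cancel power_not_zero)
    moreover have "bar a = a"
    proof -
      have "\<sigma> (a * fst t (unitv i)) = fst t (unitv i) * bar a"
        using \<sigma> a(1) fixt by (simp add: bar_involution_def)
      then have "a * fst t (unitv i) = bar a * fst t (unitv i)"
        using fixu[of "unitv i"] unfolding a(2) central_A[OF bar_A[OF a(1)]] by simp
      then show ?thesis using nz by simp
    qed
    ultimately have "a = 1" using real_root a(1) by blast
    then show ?thesis using a(2) by simp
  qed
  show ?thesis by (rule frames_eq[OF Ft Fu gen])
qed

end

section \<open>Comparison with classical mutation\<close>

lemma (in torus_scalars) central_product: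
  assumes M: "frame M L" and "distinct xs"
  shows "prod_list (map (\<lambda>i. M (smul (int l) (smul (h i) (unitv i)))) xs)
    = M (smul (int l) (\<lambda>i. if i \<in> set xs then h i else 0))"
  using assms(2)
proof (induction xs)
  case Nil
  have "smul (int l) (\<lambda>i. if i \<in> set [] then h i else 0) = 0"
    by (simp add: fun_eq_iff smul_apply)
  then have "M (smul (int l) (\<lambda>i. if i \<in> set [] then h i else 0)) = 1"
    using frame_0[OF M] by metis
  then show ?case by (simp only: list.map prod_list.Nil)
next
  case (Cons a xs)
  have "smul (int l) (\<lambda>i. if i \<in> set (a # xs) then h i else 0)
      = smul (int l) (smul (h a) (unitv a)) + smul (int l) (\<lambda>i. if i \<in> set xs then h i else 0)"
    using Cons.prems by (auto simp: fun_eq_iff smul_apply unitv_def)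
  then show ?case using Cons by (simp only: list.map prod_list.Cons distinct.simps frame_add_central[OF M] simp_thms)
qed

text \<open>Monomials with exponents divisible by \<open>l\<close> multiply without powers of
  \<open>q\<close>, so the classical exchange formula collapses to the two terms of
  \<open>mstep_power\<close>, in any ordering of the indices.\<close>

lemma (in seed_scalars) central_mutation:
  assumes ord: "distinct xs" "set xs = UNIV" and st: "mstep k s t"
  defines "x \<equiv> \<lambda>i. fst s (unitv i) ^ l" and "b \<equiv> col (snd s) k"
  shows "(prod_list (map (\<lambda>i. if b i > 0 then x i ^ nat (b i) else 1) xs) +
      prod_list (map (\<lambda>i. if b i < 0 then x i ^ nat (- b i) else 1) xs)) * inverse (x k)
    = fst t (unitv k) ^ l"
proof -
  obtain L where L: "frame (fst s) L" using mstepD(2)[OF st] seedD(1) by blast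
  have x: "x i = fst s (smul (int l) (unitv i))" for i
    unfolding x_def by (rule frame_power[OF L])
  have zero: "fst s (smul (int l) (smul 0 f)) = 1" for f
  proof -
    have "smul (int l) (smul 0 f) = 0" by (simp add: fun_eq_iff smul_apply)
    then show ?thesis using frame_0[OF L] by metis
  qed
  have pw: "x i ^ n = fst s (smul (int l) (smul (int n) (unitv i)))" for i n
  proof -
    have "smul (int n) (smul (int l) (unitv i)) = smul (int l) (smul (int n) (unitv i))"
      by (simp add: fun_eq_iff smul_apply)
    then show ?thesis unfolding x frame_power[OF L] by simp
  qed
  have "(if b i > 0 then x i ^ nat (b i) else 1) = fst s (smul (int l) (smul (posp b i) (unitv i)))" for i
    using zero by (auto simp: pw posp_def)
  then have P: "prod_list (map (\<lambda>i. if b i > 0 then x i ^ nat (b i) else 1) xs) = fst s (smul (int l) (posp b))"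
    using central_product[OF L ord(1), of "posp b"] ord(2) by simp
  have "(if b i < 0 then x i ^ nat (- b i) else 1) = fst s (smul (int l) (smul ((- negp b) i) (unitv i)))" for i
    using zero by (auto simp: pw negp_def)
  then have Q: "prod_list (map (\<lambda>i. if b i < 0 then x i ^ nat (- b i) else 1) xs) = fst s (smul (int l) (- negp b))"
    using central_product[OF L ord(1), of "- negp b"] ord(2) by (simp add: fun_Compl_def)
  have inv: "inverse (x k) = fst s (smul (int l) (- unitv k))"
  proof -
    have "- smul (int l) (unitv k) = smul (int l) (- unitv k)" by (simp add: fun_eq_iff smul_apply)
    then show ?thesis unfolding x frame_inverse[OF L] by simp
  qed
  have mult: "fst s (smul (int l) f) * fst s (smul (int l) (- unitv k)) = fst s (smul (int l) (- unitv k + f))" for f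
  proof -
    have "smul (int l) (- unitv k + f) = smul (int l) f + smul (int l) (- unitv k)"
      by (simp add: fun_eq_iff smul_apply algebra_simps)
    then show ?thesis by (simp only: frame_add_central[OF L])
  qed
  show ?thesis unfolding P Q inv distrib_right mult unfolding mstep_power[OF st] b_def
    by (simp only: add_uminus_conv_diff)
qed

section \<open>Scalars in a cyclotomic ring\<close>

locale cyclotomic_scalars =
  fixes l :: nat and z :: complex
  assumes prim: "primitive_root l z"
begin

lemma l_pos: "l > 0" and z_l: "z ^ l = 1"
  using prim by (simp_all add: primitive_root_def)

lemma z_power_ne_1: "0 < m \<Longrightarrow> m < l \<Longrightarrow> z ^ m \<noteq> 1"
  using prim by (simp add: primitive_root_def)

lemma z_power_mod: "z ^ (n mod l) = z ^ n"
proof -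
  have "z ^ n = z ^ (n div l * l + n mod l)" by simp
  also have "\<dots> = z ^ (n mod l)" by (simp only: power_add mult.commute[of _ l] power_mult z_l power_one mult_1)
  finally show ?thesis ..
qed

text \<open>\<open>Zring\<close> prescribes one coefficient for each exponent below
  \<open>l\<close>; grouping by residues admits arbitrary exponents. Closure under sums, products
  and conjugation reduces to this.\<close>

lemma Zring_sum_power: "(\<Sum>a\<in>S. of_int (c a) * z ^ (e a)) \<in> Zring l z" if "finite S"
proof -
  define d where "d r = (\<Sum>a | a \<in> S \<and> e a mod l = r. c a)" for r
  have "(\<Sum>a\<in>S. of_int (c a) * z ^ (e a)) = (\<Sum>a\<in>S. of_int (c a) * z ^ (e a mod l))"
    by (simp add: z_power_mod)
  also have "\<dots> = (\<Sum>r<l. \<Sum>a | a \<in> S \<and> e a mod l = r. of_int (c a) * z ^ (e a mod l))"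
    using that l_pos by (intro sum.group[symmetric]) auto
  also have "\<dots> = (\<Sum>r<l. of_int (d r) * z ^ r)"
    unfolding d_def of_int_sum sum_distrib_right by (intro sum.cong refl) auto
  finally show ?thesis unfolding Zring_def by blast
qed

lemma Zring_add: assumes "x \<in> Zring l z" "y \<in> Zring l z" shows "x + y \<in> Zring l z"
proof -
  obtain c d where "x = (\<Sum>a<l. of_int (c a) * z ^ a)" "y = (\<Sum>a<l. of_int (d a) * z ^ a)"
    using assms unfolding Zring_def by blast
  then have "x + y = (\<Sum>a<l. of_int (c a + d a) * z ^ a)" by (simp add: sum.distrib distrib_right)
  then show ?thesis using Zring_sum_power[of "{..<l}" "\<lambda>a. c a + d a" "\<lambda>a. a"] by simp
qed

lemma Zring_uminus: assumes "x \<in> Zring l z" shows "- x \<in> Zring l z"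
proof -
  obtain c where "x = (\<Sum>a<l. of_int (c a) * z ^ a)"
    using assms unfolding Zring_def by blast
  then have "- x = (\<Sum>a<l. of_int (- c a) * z ^ a)" by (simp add: sum_negf)
  then show ?thesis using Zring_sum_power[of "{..<l}" "\<lambda>a. - c a" "\<lambda>a. a"] by simp
qed

lemma Zring_mult: assumes "x \<in> Zring l z" "y \<in> Zring l z" shows "x * y \<in> Zring l z"
proof -
  obtain c d where "x = (\<Sum>a<l. of_int (c a) * z ^ a)" "y = (\<Sum>a<l. of_int (d a) * z ^ a)"
    using assms unfolding Zring_def by blast
  then have "x * y = (\<Sum>p\<in>{..<l} \<times> {..<l}. of_int (c (fst p) * d (snd p)) * z ^ (fst p + snd p))"
    by (simp add: sum_product sum.cartesian_product power_add mult_ac case_prod_beta)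
  then show ?thesis
    using Zring_sum_power[of "{..<l} \<times> {..<l}" "\<lambda>p. c (fst p) * d (snd p)" "\<lambda>p. fst p + snd p"] by simp
qed

lemma Zring_power: "z ^ n \<in> Zring l z"
  using Zring_sum_power[of "{()}" "\<lambda>_. 1" "\<lambda>_. n"] by simp

lemma Zring_1: "1 \<in> Zring l z"
  using Zring_power[of 0] by simp

lemma Zring_0: "0 \<in> Zring l z"
  using Zring_add[OF Zring_1 Zring_uminus[OF Zring_1]] by simp

lemma Zring_Qfield: "x \<in> Zring l z \<Longrightarrow> x \<in> Qfield l z"
  unfolding Zring_def Qfield_def by (force intro: exI[of _ "\<lambda>a. of_int (c a)" for c])

lemma norm_z: "norm z = 1"
proof -
  have "norm z ^ l = 1" using z_l by (metis norm_one norm_power)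
  then show ?thesis using l_pos power_eq_imp_eq_base[of "norm z" l 1] by simp
qed

lemma cnj_z: "cnj z = z ^ (l - 1)"
proof -
  have "z * cnj z = 1" using norm_z by (simp add: complex_norm_square[symmetric])
  moreover have "z * z ^ (l - 1) = 1" using z_l l_pos by (simp flip: power_Suc)
  ultimately show ?thesis by (metis mult_cancel_left mult_zero_left zero_neq_one)
qed

lemma Zring_cnj: assumes "x \<in> Zring l z" shows "cnj x \<in> Zring l z"
proof -
  obtain c where "x = (\<Sum>a<l. of_int (c a) * z ^ a)"
    using assms unfolding Zring_def by blast
  then have "cnj x = (\<Sum>a<l. of_int (c a) * z ^ ((l - 1) * a))"
    by (simp add: cnj_z power_mult)
  then show ?thesis using Zring_sum_power[of "{..<l}" c "\<lambda>a. (l - 1) * a"] by simp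
qed

lemma rpow_Zring: "rpow l z n \<in> Zring l z"
  by (simp add: rpow_def Zring_power)

lemma rpow_add: "rpow l z (m + n) = rpow l z m * rpow l z n"
proof -
  have "int (nat ((m + n) mod int l)) = int ((nat (m mod int l) + nat (n mod int l)) mod l)"
    using l_pos by (simp add: zmod_int mod_add_eq)
  then have "nat ((m + n) mod int l) = (nat (m mod int l) + nat (n mod int l)) mod l"
    by (simp only: of_nat_eq_iff)
  then show ?thesis unfolding rpow_def by (simp add: z_power_mod power_add)
qed

lemma rpow_eq_1_iff: "rpow l z n = 1 \<longleftrightarrow> int l dvd n"
proof
  assume "int l dvd n"
  then show "rpow l z n = 1" by (simp add: rpow_def dvd_eq_mod_eq_0)
next
  assume 1: "rpow l z n = 1"
  have "nat (n mod int l) < l" using l_pos by (simp add: nat_less_iff)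
  then have "nat (n mod int l) = 0" using 1 z_power_ne_1[of "nat (n mod int l)"] unfolding rpow_def by linarith
  moreover have "n mod int l \<ge> 0" using l_pos by simp
  ultimately show "int l dvd n" by (simp add: dvd_eq_mod_eq_0)
qed

lemma cnj_rpow: "cnj (rpow l z n) = rpow l z (- n)"
proof -
  have "rpow l z n * cnj (rpow l z n) = 1"
    using complex_norm_square[of "rpow l z n"] norm_z by (simp add: rpow_def norm_power)
  moreover have "rpow l z n * rpow l z (- n) = 1"
    using rpow_add[of n "- n"] rpow_eq_1_iff[of 0] by simp
  ultimately show ?thesis by (metis mult_cancel_left mult_zero_left zero_neq_one)
qed

lemma real_root_of_unity:
  assumes "odd l" "cnj c = c" "c ^ l = 1"
  shows "c = 1"
proof -
  obtain r where r: "c = of_real r" using assms(2) by (metis Reals_cases Reals_cnj_iff)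
  have "r ^ l = 1" using assms(3) unfolding r of_real_power[symmetric] of_real_eq_1_iff .
  moreover have "\<not> r < 0" using \<open>r ^ l = 1\<close> assms(1) power_less_zero_eq[of r l] by auto
  ultimately have "r = 1" using power_eq_imp_eq_base[of r l 1] l_pos by simp
  then show ?thesis by (simp add: r)
qed

end

lemma mod_eq_uminus_iff: "(a :: int) mod m = (- b) mod m \<longleftrightarrow> m dvd a + b"
  by (simp add: mod_eq_dvd_iff)

text \<open>Injectivity is not part of \<open>cyclo_algebra\<close>; it comes from linear
  independence of the single element \<open>M 0\<close>.\<close>

lemma cyclo_algebra_inj:
  fixes sc :: "complex \<Rightarrow> 'a::division_ring"
  assumes "cyclo_algebra l z sc" "toric_frame l z sc M L"
  shows "inj_on sc (Zring l z)"
proof (rule inj_onI)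
  interpret cyclotomic_scalars l z using assms(1) by unfold_locales (simp add: cyclo_algebra_def)
  have add: "sc (u + v) = sc u + sc v" if "u \<in> Zring l z" "v \<in> Zring l z" for u v
    using assms(1) that Zring_Qfield unfolding cyclo_algebra_def by blast
  fix x y assume xy: "x \<in> Zring l z" "y \<in> Zring l z" "sc x = sc y"
  let ?d = "x + - y"
  have d: "?d \<in> Zring l z" using xy by (intro Zring_add Zring_uminus)
  have "sc x = sc ?d + sc y" using add[OF d xy(2)] by simp
  then have "sc ?d = 0" using xy(3) by simp
  then have 0: "(\<Sum>f\<in>{0}. sc ((\<lambda>_. ?d) f) * M f) = 0" by simp
  have indep: "\<forall>S c. finite S \<longrightarrow> (\<forall>f\<in>S. c f \<in> Zring l z) \<longrightarrow>
      (\<Sum>f\<in>S. sc (c f) * M f) = 0 \<longrightarrow> (\<forall>f\<in>S. c f = 0)"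
    using assms(2) by (simp add: toric_frame_def)
  have "?d = 0" using indep[rule_format, of "{0}" "\<lambda>_. ?d" 0] 0 d by simp
  then show "x = y" by simp
qed

section \<open>Quantum seeds over the cyclotomic scalars\<close>

locale cyclotomic_seeds = cyclotomic_scalars l z for l z +
  fixes sc :: "complex \<Rightarrow> 'a::division_ring" and ex :: "'n::{finite,linorder} set" and D :: "'n \<Rightarrow> int"
  assumes alg: "cyclo_algebra l z sc" and sc_inj: "inj_on sc (Zring l z)" and odd_l: "odd l"
    and coprime_D: "\<And>k. k \<in> ex \<Longrightarrow> coprime (int l) (D k)"
begin

abbreviation "R \<equiv> Zring l z"

lemma sc_1: "sc 1 = 1"
  using alg by (simp add: cyclo_algebra_def)

lemma sc_add: "x \<in> R \<Longrightarrow> y \<in> R \<Longrightarrow> sc (x + y) = sc x + sc y"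
  using alg Zring_Qfield unfolding cyclo_algebra_def by blast

lemma sc_mult: "x \<in> R \<Longrightarrow> y \<in> R \<Longrightarrow> sc (x * y) = sc x * sc y"
  using alg Zring_Qfield unfolding cyclo_algebra_def by blast

lemma sc_central: "x \<in> R \<Longrightarrow> sc x * y = y * sc x"
  using alg Zring_Qfield unfolding cyclo_algebra_def by blast

lemma sc_0: "sc 0 = 0"
  using sc_add[OF Zring_0 Zring_0] by simp

lemma sc_uminus: "x \<in> R \<Longrightarrow> sc (- x) = - sc x"
  using sc_add[of x "- x"] Zring_uminus[of x] sc_0 by (simp add: eq_neg_iff_add_eq_0 add.commute)

lemma sc_eq_iff: "x \<in> R \<Longrightarrow> y \<in> R \<Longrightarrow> sc x = sc y \<longleftrightarrow> x = y"
  using sc_inj by (auto dest: inj_onD)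

lemma Zring_pow: "x \<in> R \<Longrightarrow> x ^ n \<in> R"
  by (induction n) (auto intro: Zring_1 Zring_mult)

lemma sc_power: "x \<in> R \<Longrightarrow> sc (x ^ n) = sc x ^ n"
  by (induction n) (auto simp: sc_1 sc_mult Zring_pow)

definition conj where "conj x = sc (cnj (inv_into R sc x))"

lemma conj_sc: "x \<in> R \<Longrightarrow> conj (sc x) = sc (cnj x)"
  by (simp add: conj_def inv_into_f_f[OF sc_inj])

sublocale seed_scalars l "sc ` R" "\<lambda>n. sc (rpow l z n)" conj ex D
proof unfold_locales
  show "odd l" by (rule odd_l)
  show "1 \<in> sc ` R" using sc_1 Zring_1 by (metis imageI)
  show "a + b \<in> sc ` R" if "a \<in> sc ` R" "b \<in> sc ` R" for a b
    using that Zring_add by (auto simp: sc_add[symmetric])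
  show "a * b \<in> sc ` R" if "a \<in> sc ` R" "b \<in> sc ` R" for a b
    using that Zring_mult by (auto simp: sc_mult[symmetric])
  show "- a \<in> sc ` R" if "a \<in> sc ` R" for a
    using that Zring_uminus by (auto simp: sc_uminus[symmetric])
  show "a * y = y * a" if "a \<in> sc ` R" for a y
    using that sc_central by blast
  have "sc (1 + 1) \<noteq> sc 0" using sc_eq_iff[OF Zring_add[OF Zring_1 Zring_1] Zring_0] by simp
  then show "(2::'a) \<noteq> 0" unfolding sc_add[OF Zring_1 Zring_1] sc_1 sc_0 by simp
  show "sc (rpow l z n) \<in> sc ` R" for n by (intro imageI rpow_Zring)
  show "sc (rpow l z (m + n)) = sc (rpow l z m) * sc (rpow l z n)" for m n
    by (simp add: rpow_add sc_mult rpow_Zring)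
  show "sc (rpow l z n) = 1 \<longleftrightarrow> int l dvd n" for n
    using sc_eq_iff[OF rpow_Zring[of n] Zring_1] by (simp add: sc_1 rpow_eq_1_iff)
  show "conj a \<in> sc ` R" if "a \<in> sc ` R" for a
    using that Zring_cnj by (auto simp: conj_sc)
  show "conj (a + b) = conj a + conj b" if "a \<in> sc ` R" "b \<in> sc ` R" for a b
    using that by (auto simp: conj_sc sc_add[symmetric] Zring_add Zring_cnj)
  show "conj (a * b) = conj a * conj b" if "a \<in> sc ` R" "b \<in> sc ` R" for a b
    using that by (auto simp: conj_sc sc_mult[symmetric] Zring_mult Zring_cnj)
  show "conj (sc (rpow l z n)) = sc (rpow l z (- n))" for n
    by (simp add: conj_sc rpow_Zring cnj_rpow)
  show "a = 0" if a: "a \<in> sc ` R" "conj a = 0" for a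
  proof -
    obtain x where x: "x \<in> R" "a = sc x" using a(1) by blast
    then have "sc (cnj x) = sc 0" using a(2) by (simp add: conj_sc sc_0)
    then have "cnj x = 0" unfolding sc_eq_iff[OF Zring_cnj[OF x(1)] Zring_0] .
    then show ?thesis using x(2) sc_0 by simp
  qed
  show "a = 1" if a: "a \<in> sc ` R" "conj a = a" "a ^ l = 1" for a
  proof -
    obtain x where x: "x \<in> R" "a = sc x" using a(1) by blast
    have "cnj x = x" using a x by (simp add: conj_sc sc_eq_iff Zring_cnj)
    moreover have "sc (x ^ l) = sc 1" using a x by (simp add: sc_power sc_1)
    then have "x ^ l = 1" using x by (simp add: sc_eq_iff Zring_pow Zring_1)
    ultimately have "x = 1" by (rule real_root_of_unity[OF odd_l])
    then show ?thesis using x(2) sc_1 by simp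
  qed
  show "coprime (int l) (D k)" if "k \<in> ex" for k by (rule coprime_D[OF that])
qed

lemma tspan_eq_lspan: "tspan l z sc M = lspan M UNIV"
proof (intro subset_antisym subsetI)
  fix y assume "y \<in> tspan l z sc M"
  then obtain S c where "finite S" "\<forall>f\<in>S. c f \<in> R" "y = (\<Sum>f\<in>S. sc (c f) * M f)"
    unfolding tspan_def by blast
  then show "y \<in> lspan M UNIV" by (simp add: lspan_sum lspan_term)
next
  fix y assume y: "y \<in> lspan M UNIV"
  obtain S c where S: "finite S" "\<forall>f. c f \<in> sc ` R" "y = (\<Sum>f\<in>S. c f * M f)"
    using lspan_sumD[OF y] by blast
  define c' where "c' f = inv_into R sc (c f)" for f
  have c': "c' f \<in> R" "sc (c' f) = c f" for f
    unfolding c'_def by (rule inv_into_into f_inv_into_f, use S(2) in blast)+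
  have "finite S \<and> (\<forall>f\<in>S. c' f \<in> R) \<and> y = (\<Sum>f\<in>S. sc (c' f) * M f)"
    unfolding c'(2) S(3) using S(1) c'(1) by blast
  then show "y \<in> tspan l z sc M" unfolding tspan_def by blast
qed

lemma independent_iff:
  "independent M \<longleftrightarrow> (\<forall>S c. finite S \<longrightarrow> (\<forall>f\<in>S. c f \<in> R) \<longrightarrow>
    (\<Sum>f\<in>S. sc (c f) * M f) = 0 \<longrightarrow> (\<forall>f\<in>S. c f = 0))" (is "_ \<longleftrightarrow> ?I")
proof
  assume ind: "independent M"
  show ?I
  proof (intro allI impI ballI)
    fix S c f assume S: "finite S" "\<forall>f\<in>S. c f \<in> R" "(\<Sum>f\<in>S. sc (c f) * M f) = 0" "f \<in> S"
    have "sc (c f) = 0"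
      by (rule independentD[OF ind S(1) _ S(3,4)]) (use S(2) in blast)
    then show "c f = 0" using S(2,4) sc_0 sc_eq_iff[OF _ Zring_0] by simp
  qed
next
  assume I: ?I
  show "independent M" unfolding independent_def
  proof (intro allI impI ballI)
    fix S c f assume S: "finite S" "\<forall>f\<in>S. c f \<in> sc ` R" "(\<Sum>f\<in>S. c f * M f) = 0" "f \<in> S"
    define c' where "c' f = inv_into R sc (c f)" for f
    have c': "c' f \<in> R" "sc (c' f) = c f" if "f \<in> S" for f
      unfolding c'_def by (rule inv_into_into f_inv_into_f, use S(2) that in blast)+
    have "(\<Sum>f\<in>S. sc (c' f) * M f) = 0" using S(3) c'(2) by simp
    then have "c' f = 0" using I S(1,4) c'(1) by blast
    then show "c f = 0" using c'(2)[OF S(4)] sc_0 by simp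
  qed
qed

lemma toric_frame_iff: "toric_frame l z sc M L \<longleftrightarrow> frame M L"
  unfolding toric_frame_def frame_def skew_mod_def mod_eq_uminus_iff independent_iff tspan_eq_lspan ..

lemma seed_is_qseed: "seed M L B \<Longrightarrow> is_qseed l z sc ex (M, B)"
  unfolding is_qseed_def compatible_def seed_def toric_frame_iff by auto

text \<open>\<open>qmut\<close> prescribes the transformed form and \<open>is_qseed\<close> allows
  any \<open>D\<close>, while \<open>mstep\<close> fixes \<open>D\<close> and leaves the form open.
  Either kind of target agrees on unit vectors with the frame built by \<open>seed_mutation\<close>,
  hence equals it.\<close>

lemma qstep_iff_mstep:
  assumes L: "seed (fst s) L (snd s)"
  shows "qstep l z sc ex k s t \<longleftrightarrow> mstep k s t"
proof
  assume q: "qstep l z sc ex k s t"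
  then have k: "k \<in> ex" and B: "snd t = bmut ex k (snd s)"
    and fr: "\<exists>L. toric_frame l z sc (fst t) (mut_form k (snd s) L)"
    and rest: "\<And>j. j \<noteq> k \<Longrightarrow> fst t (unitv j) = fst s (unitv j)"
    and new: "fst t (unitv k) = exchange (fst s) (col (snd s) k) k"
    unfolding qstep_def qmut_def Let_def exchange_def by auto
  obtain M' where M': "seed M' (mut_form k (snd s) L) (bmut ex k (snd s))"
    "\<And>j. j \<noteq> k \<Longrightarrow> M' (unitv j) = fst s (unitv j)" "M' (unitv k) = exchange (fst s) (col (snd s) k) k"
    using seed_mutation[OF L k] by blast
  obtain L2 where F: "frame (fst t) L2" using fr toric_frame_iff by blast
  have "fst t = M'"
  proof (rule frames_eq[OF F seedD(1)[OF M'(1)]])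
    show "fst t (unitv j) = M' (unitv j)" for j
      using rest[of j] new M'(2)[of j] M'(3) by (cases "j = k") auto
  qed
  then show "mstep k s t" unfolding mstep_def using k L M'(1) B rest new by auto
next
  assume m: "mstep k s t"
  note t = mstepD[OF m]
  obtain Lt where Lt: "seed (fst t) Lt (snd t)" using t(3) by blast
  obtain M' where M': "seed M' (mut_form k (snd s) L) (bmut ex k (snd s))"
    "\<And>j. j \<noteq> k \<Longrightarrow> M' (unitv j) = fst s (unitv j)" "M' (unitv k) = exchange (fst s) (col (snd s) k) k"
    using seed_mutation[OF L t(1)] by blast
  have "fst t = M'"
  proof (rule frames_eq[OF seedD(1)[OF Lt] seedD(1)[OF M'(1)]])
    show "fst t (unitv j) = M' (unitv j)" for j
      using t(5)[of j] t(6) M'(2)[of j] M'(3) by (cases "j = k") auto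
  qed
  then have "frame (fst t) (mut_form k (snd s) L)" using seedD(1)[OF M'(1)] by simp
  moreover have "is_qseed l z sc ex s" "is_qseed l z sc ex t"
    using seed_is_qseed[OF L] seed_is_qseed[OF Lt] by simp_all
  ultimately show "qstep l z sc ex k s t"
    unfolding qstep_def qmut_def Let_def toric_frame_iff exchange_def[symmetric]
    using t(1,4,5,6) seedD(1)[OF L] by blast
qed

lemma reach_qstep_path:
  assumes L: "\<exists>L. seed (fst s) L (snd s)" and t: "t \<in> reach (qstep l z sc ex) ex s"
  shows "\<exists>ks. path ks s t"
proof -
  have "(\<lambda>u v. \<exists>k\<in>ex. qstep l z sc ex k u v)\<^sup>*\<^sup>* s t" using t unfolding reach_def by simp
  then show ?thesis
  proof (induction rule: rtranclp_induct)
    case base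
    have "path [] s s" by simp
    then show ?case by blast
  next
    case (step u v)
    then obtain ks k where ks: "path ks s u" and k: "qstep l z sc ex k u v" by blast
    obtain L where "seed (fst u) L (snd u)" using path_seed[OF ks L] by blast
    then have "mstep k u v" using qstep_iff_mstep k by blast
    then have "path [k] u v" unfolding path.simps by blast
    then show ?case using path_append[OF ks] by blast
  qed
qed

section \<open>The isomorphism of exchange graphs\<close>

definition classical :: "('a, 'n) qseed \<Rightarrow> ('a, 'n) cseed" where
  "classical s = ((\<lambda>i. fst s (unitv i) ^ l), snd s)"

lemma cmut_deterministic: "cmut ex k s t \<Longrightarrow> cmut ex k s t' \<Longrightarrow> t = t'"
  unfolding cmut_def Let_def by simp

lemma mstep_cmut:
  assumes m: "mstep k s t"
  shows "cmut ex k (classical s) (classical t)"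
proof -
  note t = mstepD[OF m]
  let ?xs = "sorted_list_of_set (UNIV :: 'n set)"
  have xs: "distinct ?xs" "set ?xs = UNIV" by simp_all
  let ?x = "\<lambda>i. fst s (unitv i) ^ l" and ?b = "col (snd s) k"
  let ?new = "(prod_list (map (\<lambda>i. if ?b i > 0 then ?x i ^ nat (?b i) else 1) ?xs) +
      prod_list (map (\<lambda>i. if ?b i < 0 then ?x i ^ nat (- ?b i) else 1) ?xs)) * inverse (?x k)"
  have "?new = fst t (unitv k) ^ l" by (rule central_mutation[OF xs m])
  then have "?x(k := ?new) = (\<lambda>i. fst t (unitv i) ^ l)" using t(5) by (auto simp: fun_eq_iff)
  then show ?thesis unfolding cmut_def classical_def Let_def fst_conv snd_conv using t(1,4) by simp
qed

theorem classical_labelled_iso: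
  assumes L: "seed (fst s) L (snd s)"
  shows "labelled_iso (qstep l z sc ex) (cmut ex) ex s (classical s) classical"
proof -
  let ?Q = "reach (qstep l z sc ex) ex s" and ?C = "reach (cmut ex) ex (classical s)"
  have exL: "\<exists>L. seed (fst s) L (snd s)" using L by blast
  have seedQ: "\<exists>L. seed (fst u) L (snd u)" if "u \<in> ?Q" for u
    using reach_qstep_path[OF exL that] path_seed exL by blast
  have inj: "u = v" if uv: "u \<in> ?Q" "v \<in> ?Q" "classical u = classical v" for u v
  proof (rule prod_eqI)
    obtain ks ks' where "path ks s u" "path ks' s v" 
      using reach_qstep_path[OF exL uv(1)] reach_qstep_path[OF exL uv(2)] by blast
    then show "fst u = fst v"
      by (rule frame_determined_by_powers[OF L]) (use uv(3) in \<open>simp add: classical_def fun_eq_iff\<close>)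
    show "snd u = snd v" using uv(3) by (simp add: classical_def)
  qed
  have closed: "v \<in> ?Q" if "u \<in> ?Q" "qstep l z sc ex k u v" for u v k
  proof -
    have "k \<in> ex" using that(2) by (simp add: qstep_def qmut_def)
    then show ?thesis using that unfolding reach_def by (auto intro: rtranclp.rtrancl_into_rtrancl)
  qed
  have closedC: "v \<in> ?C" if "u \<in> ?C" "cmut ex k u v" for u v k
  proof -
    have "k \<in> ex" using that(2) by (simp add: cmut_def)
    then show ?thesis using that unfolding reach_def by (auto intro: rtranclp.rtrancl_into_rtrancl)
  qed
  have lift: "\<exists>v\<in>?Q. qstep l z sc ex k u v \<and> classical v = w" if u: "u \<in> ?Q" and c: "cmut ex k (classical u) w" for u w k
  proof -
    have k: "k \<in> ex" using c by (simp add: cmut_def)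
    obtain Lu where Lu: "seed (fst u) Lu (snd u)" using seedQ[OF u] by blast
    obtain v where m: "mstep k u v" using mstep_exists[OF Lu k] by blast
    then have "qstep l z sc ex k u v" using qstep_iff_mstep[OF Lu] by blast
    moreover have "classical v = w" by (rule cmut_deterministic[OF mstep_cmut[OF m] c])
    ultimately show ?thesis using closed[OF u] by blast
  qed
  have project: "cmut ex k (classical u) (classical v)" if u: "u \<in> ?Q" and q: "qstep l z sc ex k u v" for u v k
  proof -
    obtain Lu where Lu: "seed (fst u) Lu (snd u)" using seedQ[OF u] by blast
    show ?thesis using q qstep_iff_mstep[OF Lu] mstep_cmut by blast
  qed
  have into: "classical t \<in> ?C" if "t \<in> ?Q" for t
  proof -
    have "(\<lambda>u v. \<exists>k\<in>ex. qstep l z sc ex k u v)\<^sup>*\<^sup>* s t" using that unfolding reach_def by simp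
    then have "t \<in> ?Q \<and> classical t \<in> ?C"
    proof (induction rule: rtranclp_induct)
      case base
      then show ?case unfolding reach_def by simp
    next
      case (step u v)
      then obtain k where "qstep l z sc ex k u v" by blast
      then show ?case using step closed project closedC by blast
    qed
    then show ?thesis by blast
  qed
  have onto: "w \<in> classical ` ?Q" if "w \<in> ?C" for w
  proof -
    have "(\<lambda>u v. \<exists>k\<in>ex. cmut ex k u v)\<^sup>*\<^sup>* (classical s) w" using that unfolding reach_def by simp
    then show ?thesis
    proof (induction rule: rtranclp_induct)
      case base
      have "s \<in> ?Q" unfolding reach_def by simp
      then show ?case by blast
    next
      case (step w w')
      then obtain u k where "u \<in> ?Q" "w = classical u" "cmut ex k w w'" by blast
      then show ?case using lift by blast
    qed
  qed
  have "bij_betw classical ?Q ?C"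
    unfolding bij_betw_def inj_on_def using inj into onto by blast
  moreover have "qstep l z sc ex k u v \<longleftrightarrow> cmut ex k (classical u) (classical v)"
    if uv: "u \<in> ?Q" "v \<in> ?Q" for u v k
  proof
    \<comment> \<open>Edges are reflected by lifting: the classical edge lifts to a quantum edge
      from \<open>u\<close>, whose endpoint must be \<open>v\<close> by injectivity.\<close>
    assume c: "cmut ex k (classical u) (classical v)"
    obtain v' where v': "v' \<in> ?Q" "qstep l z sc ex k u v'" "classical v' = classical v"
      using lift[OF uv(1) c] by blast
    have "v' = v" by (rule inj[OF v'(1) uv(2) v'(3)])
    then show "qstep l z sc ex k u v" using v'(2) by simp
  qed (rule project[OF uv(1)])
  ultimately show ?thesis unfolding labelled_iso_def by blast
qed

end

text \<open>Along a path from the base vertex, each image is forced by the previous one and the edge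
  label, since the target steps are deterministic.\<close>

lemma labelled_iso_unique:
  assumes det: "\<And>k u v v'. step2 k u v \<Longrightarrow> step2 k u v' \<Longrightarrow> v = v'"
    and phi: "labelled_iso step1 step2 ex s1 s2 phi" and psi: "labelled_iso step1 step2 ex s1 s2 psi"
    and t: "t \<in> reach step1 ex s1"
  shows "phi t = psi t"
proof -
  have "(\<lambda>u v. \<exists>k\<in>ex. step1 k u v)\<^sup>*\<^sup>* s1 t" using t unfolding reach_def by simp
  then have "t \<in> reach step1 ex s1 \<and> phi t = psi t"
  proof (induction rule: rtranclp_induct)
    case base
    then show ?case using phi psi unfolding labelled_iso_def reach_def by simp
  next
    case (step u v)
    then obtain k where k: "k \<in> ex" "step1 k u v" by blast
    have v: "v \<in> reach step1 ex s1"
      using step.IH k unfolding reach_def by (auto intro: rtranclp.rtrancl_into_rtrancl)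
    have "step2 k (phi u) (phi v)" "step2 k (psi u) (psi v)"
      using phi psi step.IH v k unfolding labelled_iso_def by blast+
    then show ?case using det v step.IH by metis
  qed
  then show ?thesis by blast
qed

theorem theorem4p8:
  fixes l :: nat and z :: complex and sc :: "complex \<Rightarrow> 'a::division_ring"
    and ex :: "'n::{finite,linorder} set"
    and M :: "('n \<Rightarrow> int) \<Rightarrow> 'a" and B :: "'n \<Rightarrow> 'n \<Rightarrow> int"
    and L :: "'n \<Rightarrow> 'n \<Rightarrow> int" and D :: "'n \<Rightarrow> int"
  assumes alg: "cyclo_algebra l z sc"
    and frame: "toric_frame l z sc M L"
    and exm: "exmat ex B"
    and compat: "compat_with l ex L B D"
    and coprime_cond: "odd l \<and> (\<forall>k\<in>ex. coprime (int l) (D k))"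
  shows "(\<exists>phi. labelled_iso (qstep l z sc ex) (cmut ex) ex (M, B) (\<lambda>i. M (unitv i) ^ l, B) phi) \<and>
         (\<forall>phi psi. labelled_iso (qstep l z sc ex) (cmut ex) ex (M, B) (\<lambda>i. M (unitv i) ^ l, B) phi \<longrightarrow>
            labelled_iso (qstep l z sc ex) (cmut ex) ex (M, B) (\<lambda>i. M (unitv i) ^ l, B) psi \<longrightarrow>
            (\<forall>s\<in>reach (qstep l z sc ex) ex (M, B). phi s = psi s))"

proof -
  interpret cyclotomic_scalars l z using alg by unfold_locales (simp add: cyclo_algebra_def)
  interpret cyclotomic_seeds l z sc ex D
    using alg cyclo_algebra_inj[OF alg frame] coprime_cond by unfold_locales auto
  have "seed M L B" unfolding seed_def using frame toric_frame_iff exm compat by blast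
  then have "labelled_iso (qstep l z sc ex) (cmut ex) ex (M, B) (classical (M, B)) classical"
    using classical_labelled_iso[of "(M, B)"] by simp
  then have iso: "labelled_iso (qstep l z sc ex) (cmut ex) ex (M, B) (\<lambda>i. M (unitv i) ^ l, B) classical"
    by (simp add: classical_def)
  show ?thesis
  proof (intro conjI allI impI ballI)
    show "\<exists>phi. labelled_iso (qstep l z sc ex) (cmut ex) ex (M, B) (\<lambda>i. M (unitv i) ^ l, B) phi"
      using iso by blast
  qed (rule labelled_iso_unique[OF cmut_deterministic])
qed

end
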